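(* Let $D$ be a bowtie-shaped domain, and for small $\delta>0$ let $D_\delta$ be the corresponding bowtie with close-to-touching wings. The limit spectrum of the Poincaré variational operators $T_{D_\delta}$ is exactly the spectrum of the Poincaré variational operator $T_D$ of $D$: $$\lim_{\delta\to0}\sigma(T_{D_\delta})=\sigma(T_D)=[0,1],$$ where $$\lim_{\delta\to0}\sigma(T_{D_\delta}):=\{\beta\in\mathbf{R}:\ \exists\,\delta_n\downarrow0,\ \exists\,\beta_n\in\sigma(T_{D_{\delta_n}}),\ \beta_n\to\beta\}.$$
   Context: Setting. $\Omega\subset\mathbf{R}^2$ is a bounded open set with smooth boundary containing the origin $0$; $B_r$ is the open disc of radius $r$ centred at $0$. A bowtie-shaped domain is an open set $D=D_1\cup D_2$ with $\overline{D}\subset\Omega$, where $D_1,D_2$ are connected open sets whose boundaries are smooth except at $0$, whose closures meet only at $0$, and such that there exist $r_0>0$ and $0<\alpha<\pi$ with (in polar coordinates) $$D_1\cap B_{r_0}=\{(r\cos\theta,r\sin\theta):0<r<r_0,\ -\alpha/2<\theta<\alpha/2\},$$ $$D_2\cap B_{r_0}=\{(r\cos\theta,r\sin\theta):0<r<r_0,\ \pi-\alpha/2<\theta<\pi+\alpha/2\}.$$ Bowtie with close-to-touching wings: for $\delta>0$ small enough that $\overline{D_\delta}\subset\Omega$, $D_\delta=D_{1,\delta}\cup D_{2,\delta}$ with $D_{1,\delta}=(\delta/2,0)+D_1$ and $D_{2,\delta}=(-\delta/2,0)+D_2$. It is assumed that the two translated wings are separated (have disjoint closures), so that $D_\delta$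 is a Lipschitz open set. $H^1_0(\Omega)$ is equipped with the inner product $\langle u,v\rangle=\int_\Omega\nabla u\cdot\nabla v\,dx$ and the associated norm. For an open set $E\Subset\Omega$, the Poincaré variational operator $T_E:H^1_0(\Omega)\to H^1_0(\Omega)$ is defined by: for $u\in H^1_0(\Omega)$, $T_Eu$ is the unique element of $H^1_0(\Omega)$ with $\int_\Omega\nabla(T_Eu)\cdot\nabla v\,dx=\int_E\nabla u\cdot\nabla v\,dx$ for all $v\in H^1_0(\Omega)$. $\sigma(\cdot)$ denotes the spectrum. *)

theory Defs
  imports "HOL-Analysis.Analysis"
begin

section \<open>Smooth functions and smooth boundaries\<close>

definition partial_deriv :: "2 \<Rightarrow> (real^2 \<Rightarrow> real) \<Rightarrow> real^2 \<Rightarrow> real" where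
  "partial_deriv i f x = frechet_derivative f (at x) (axis i 1)"

text \<open>The set \<open>S\<close> is meant to be open.\<close>

primrec Ck_on :: "nat \<Rightarrow> (real^2 \<Rightarrow> real) \<Rightarrow> (real^2) set \<Rightarrow> bool" where
  "Ck_on 0 f S \<longleftrightarrow> continuous_on S f"
| "Ck_on (Suc k) f S \<longleftrightarrow>
     (\<forall>x\<in>S. f differentiable (at x)) \<and> (\<forall>i. Ck_on k (partial_deriv i f) S)"

definition smooth_on :: "(real^2 \<Rightarrow> real) \<Rightarrow> (real^2) set \<Rightarrow> bool" where
  "smooth_on f S \<longleftrightarrow> (\<forall>k. Ck_on k f S)"

text \<open>Near \<open>p\<close> the set lies on one side of a smooth curve, described by a local defining
  function \<open>\<rho>\<close> without critical points. It follows that the part of the boundary in \<open>U\<close>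
  is the zero set of \<open>\<rho>\<close>.\<close>

definition smooth_boundary_at :: "(real^2) set \<Rightarrow> real^2 \<Rightarrow> bool" where
  "smooth_boundary_at A p \<longleftrightarrow>
     (\<exists>U \<rho>. open U \<and> p \<in> U \<and> smooth_on \<rho> U \<and>
        (\<forall>x\<in>U. \<exists>i. partial_deriv i \<rho> x \<noteq> 0) \<and>
        A \<inter> U = {x \<in> U. \<rho> x < 0})"

definition smooth_boundary :: "(real^2) set \<Rightarrow> bool" where
  "smooth_boundary A \<longleftrightarrow> (\<forall>p\<in>frontier A. smooth_boundary_at A p)"


section \<open>The space \<open>H\<^sup>1\<^sub>0(\<Omega>)\<close>\<close>

text \<open>Elements of \<open>L\<^sup>2\<close>, \<open>H\<^sup>1\<close> and \<open>H\<^sup>1\<^sub>0\<close> are represented by functions on the whole plane;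
  only the values in \<open>\<Omega>\<close> matter, and two functions represent the same element iff they are
  equal almost everywhere in \<open>\<Omega>\<close>.\<close>

definition ae_eq :: "(real^2) set \<Rightarrow> (real^2 \<Rightarrow> real) \<Rightarrow> (real^2 \<Rightarrow> real) \<Rightarrow> bool" where
  "ae_eq \<Omega> u v \<longleftrightarrow> (AE x in lebesgue_on \<Omega>. u x = v x)"

definition L2 :: "(real^2) set \<Rightarrow> (real^2 \<Rightarrow> 'b::euclidean_space) set" where
  "L2 \<Omega> = {f. f \<in> borel_measurable (lebesgue_on \<Omega>) \<and>
                integrable (lebesgue_on \<Omega>) (\<lambda>x. (norm (f x))\<^sup>2)}"

definition test_functions :: "(real^2) set \<Rightarrow> (real^2 \<Rightarrow> real) set" where
  "test_functions \<Omega> =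
     {\<phi>. smooth_on \<phi> UNIV \<and> compact (closure {x. \<phi> x \<noteq> 0}) \<and> closure {x. \<phi> x \<noteq> 0} \<subseteq> \<Omega>}"

definition has_weak_gradient ::
  "(real^2) set \<Rightarrow> (real^2 \<Rightarrow> real) \<Rightarrow> (real^2 \<Rightarrow> real^2) \<Rightarrow> bool" where
  "has_weak_gradient \<Omega> u g \<longleftrightarrow>
     (\<forall>\<phi>\<in>test_functions \<Omega>. \<forall>i.
        (LINT x|lebesgue_on \<Omega>. u x * partial_deriv i \<phi> x) =
        - (LINT x|lebesgue_on \<Omega>. g x $ i * \<phi> x))"

definition H1 :: "(real^2) set \<Rightarrow> (real^2 \<Rightarrow> real) set" where
  "H1 \<Omega> = {u \<in> L2 \<Omega>. \<exists>g \<in> L2 \<Omega>. has_weak_gradient \<Omega> u g}"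

text \<open>For \<open>u \<in> H1 \<Omega>\<close> the weak gradient is unique up to null sets, so that the choice made
  here does not affect any of the integrals below.\<close>

definition weak_gradient :: "(real^2) set \<Rightarrow> (real^2 \<Rightarrow> real) \<Rightarrow> real^2 \<Rightarrow> real^2" where
  "weak_gradient \<Omega> u = (SOME g. g \<in> L2 \<Omega> \<and> has_weak_gradient \<Omega> u g)"

definition H1_norm :: "(real^2) set \<Rightarrow> (real^2 \<Rightarrow> real) \<Rightarrow> real" where
  "H1_norm \<Omega> u =
     sqrt ((LINT x|lebesgue_on \<Omega>. (u x)\<^sup>2) +
           (LINT x|lebesgue_on \<Omega>. (norm (weak_gradient \<Omega> u x))\<^sup>2))"

definition H10 :: "(real^2) set \<Rightarrow> (real^2 \<Rightarrow> real) set" where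
  "H10 \<Omega> = {u \<in> H1 \<Omega>. \<exists>\<phi> :: nat \<Rightarrow> real^2 \<Rightarrow> real.
      (\<forall>n. \<phi> n \<in> test_functions \<Omega>) \<and>
      (\<lambda>n. H1_norm \<Omega> (\<lambda>x. \<phi> n x - u x)) \<longlonglongrightarrow> 0}"

definition dirichlet_form ::
  "(real^2) set \<Rightarrow> (real^2) set \<Rightarrow> (real^2 \<Rightarrow> real) \<Rightarrow> (real^2 \<Rightarrow> real) \<Rightarrow> real" where
  "dirichlet_form \<Omega> E u v =
     (LINT x|lebesgue_on E. weak_gradient \<Omega> u x \<bullet> weak_gradient \<Omega> v x)"

definition H10_inner :: "(real^2) set \<Rightarrow> (real^2 \<Rightarrow> real) \<Rightarrow> (real^2 \<Rightarrow> real) \<Rightarrow> real" where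
  "H10_inner \<Omega> u v = dirichlet_form \<Omega> \<Omega> u v"

definition H10_norm :: "(real^2) set \<Rightarrow> (real^2 \<Rightarrow> real) \<Rightarrow> real" where
  "H10_norm \<Omega> u = sqrt (H10_inner \<Omega> u u)"


section \<open>The Poincare variational operator and its spectrum\<close>

text \<open>The choice operator picks a representative of the element \<open>T\<^sub>E u\<close>, which is unique up to
  equality almost everywhere in \<open>\<Omega>\<close>.\<close>

definition poincare_op ::
  "(real^2) set \<Rightarrow> (real^2) set \<Rightarrow> (real^2 \<Rightarrow> real) \<Rightarrow> (real^2 \<Rightarrow> real)" where
  "poincare_op \<Omega> E u =
     (SOME w. w \<in> H10 \<Omega> \<and> (\<forall>v\<in>H10 \<Omega>. H10_inner \<Omega> w v = dirichlet_form \<Omega> E u v))"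

text \<open>Bijectivity on the space of classes modulo \<open>ae_eq \<Omega>\<close>, with bounded inverse.\<close>

definition boundedly_invertible ::
  "(real^2) set \<Rightarrow> ((real^2 \<Rightarrow> real) \<Rightarrow> (real^2 \<Rightarrow> real)) \<Rightarrow> bool" where
  "boundedly_invertible \<Omega> A \<longleftrightarrow>
     (\<forall>u\<in>H10 \<Omega>. \<forall>v\<in>H10 \<Omega>. ae_eq \<Omega> (A u) (A v) \<longrightarrow> ae_eq \<Omega> u v) \<and>
     (\<forall>f\<in>H10 \<Omega>. \<exists>u\<in>H10 \<Omega>. ae_eq \<Omega> (A u) f) \<and>
     (\<exists>C. \<forall>u\<in>H10 \<Omega>. H10_norm \<Omega> u \<le> C * H10_norm \<Omega> (A u))"

definition spectrum ::
  "(real^2) set \<Rightarrow> ((real^2 \<Rightarrow> real) \<Rightarrow> (real^2 \<Rightarrow> real)) \<Rightarrow> real set" where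
  "spectrum \<Omega> T = {\<beta>. \<not> boundedly_invertible \<Omega> (\<lambda>u x. T u x - \<beta> * u x)}"


section \<open>Bowties\<close>

definition sector :: "real \<Rightarrow> real \<Rightarrow> real \<Rightarrow> (real^2) set" where
  "sector r0 a b = {vector [r * cos \<theta>, r * sin \<theta>] |r \<theta>. 0 < r \<and> r < r0 \<and> a < \<theta> \<and> \<theta> < b}"

definition bowtie :: "(real^2) set \<Rightarrow> (real^2) set \<Rightarrow> (real^2) set \<Rightarrow> bool" where
  "bowtie \<Omega> D1 D2 \<longleftrightarrow>
     open D1 \<and> connected D1 \<and> open D2 \<and> connected D2 \<and>
     closure (D1 \<union> D2) \<subseteq> \<Omega> \<and>
     (\<forall>p\<in>frontier D1 - {0}. smooth_boundary_at D1 p) \<and>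
     (\<forall>p\<in>frontier D2 - {0}. smooth_boundary_at D2 p) \<and>
     closure D1 \<inter> closure D2 = {0} \<and>
     (\<exists>r0 \<alpha>. 0 < r0 \<and> 0 < \<alpha> \<and> \<alpha> < pi \<and>
        D1 \<inter> ball 0 r0 = sector r0 (- \<alpha> / 2) (\<alpha> / 2) \<and>
        D2 \<inter> ball 0 r0 = sector r0 (pi - \<alpha> / 2) (pi + \<alpha> / 2))"

definition right_wing :: "(real^2) set \<Rightarrow> real \<Rightarrow> (real^2) set" where
  "right_wing D1 \<delta> = (+) (vector [\<delta> / 2, 0]) ` D1"

definition left_wing :: "(real^2) set \<Rightarrow> real \<Rightarrow> (real^2) set" where
  "left_wing D2 \<delta> = (+) (vector [- \<delta> / 2, 0]) ` D2"

definition near_bowtie :: "(real^2) set \<Rightarrow> (real^2) set \<Rightarrow> real \<Rightarrow> (real^2) set" where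
  "near_bowtie D1 D2 \<delta> = right_wing D1 \<delta> \<union> left_wing D2 \<delta>"

text \<open>The limit of a family of sets \<open>S \<delta>\<close> indexed by \<open>0 < \<delta> < \<delta>0\<close>, as \<open>\<delta>\<close> decreases to \<open>0\<close>;
  it does not depend on the choice of \<open>\<delta>0\<close>.\<close>

definition limit_spectrum :: "real \<Rightarrow> (real \<Rightarrow> real set) \<Rightarrow> real set" where
  "limit_spectrum \<delta>0 S =
     {\<beta>. \<exists>\<delta> b :: nat \<Rightarrow> real. (\<forall>n. 0 < \<delta> n \<and> \<delta> n < \<delta>0) \<and> decseq \<delta> \<and> \<delta> \<longlonglongrightarrow> 0 \<and>
          (\<forall>n. b n \<in> S (\<delta> n)) \<and> b \<longlonglongrightarrow> \<beta>}"

end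

theory Submission
  imports Defs "HOL-Real_Asymp.Real_Asymp" "HOL-Computational_Algebra.Polynomial"
begin

text \<open>
  Put \<open>a = \<one>\<^sub>E - \<beta>\<close>. Then \<open>T\<^sub>E - \<beta>\<close> is the operator of the form \<open>\<integral> a \<nabla>u \<bullet> \<nabla>v\<close>. Since
  \<open>0 \<le> T\<^sub>E \<le> 1\<close>, this form or its negative is coercive for \<open>\<beta>\<close> outside the unit interval, and all
  spectra lie in the unit interval by the theorem of Lax and Milgram
  (\<open>spectrum_poincare_op_subset\<close>). It remains to produce approximate eigenfunctions for every
  \<open>\<beta>\<close> between \<open>0\<close> and \<open>1\<close>.

  A quasi-mode is a pair of test functions \<open>u\<close> and \<open>f\<close> for which the flux \<open>a \<nabla>u\<close> is close in
  \<open>L\<^sup>2\<close>, relative to the energy of \<open>u\<close>, to the rotated gradient of \<open>f\<close>. A rotated gradient is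
  orthogonal to all gradients, so that the norm of \<open>(T\<^sub>E - \<beta>) u\<close> is bounded by the norm of the flux
  defect (\<open>quasimode_residual\<close>).

  At the tip of the bowtie the coefficient \<open>a\<close> depends on the polar angle only. In the coordinates
  \<open>t = ln r\<close> and \<open>\<theta>\<close> the equation \<open>div (a \<nabla>w) = 0\<close> separates: it is solved by
  \<open>cos (\<xi> t) \<phi>(\<theta>)\<close> with stream function \<open>sin (\<xi> t) \<psi>(\<theta>)\<close> if \<open>\<phi>'' = \<xi>\<^sup>2 \<phi>\<close> off the
  interfaces, \<open>\<psi> = a \<phi>' / \<xi>\<close>, and both profiles are continuous. Profiles that are even about the
  axis of the wings and odd about the perpendicular axis exist iff
  \<open>(1 - \<beta>) / \<beta> = coth (\<xi> \<alpha> / 2) coth (\<xi> (\<pi> - \<alpha>) / 2)\<close>; as \<open>\<xi>\<close> runs through the positive reals,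
  \<open>\<beta>\<close> runs through the open interval from \<open>0\<close> to \<open>1/2\<close> (\<open>corner_\<beta>_surj\<close>). Cutting these
  solutions off in \<open>t\<close> at both ends of a long interval costs a bounded defect, by dilation
  invariance, whereas the energy grows with the length of the interval. Hence they are quasi-modes
  (\<open>corner_has_quasimodes\<close>). Exchanging a function with its stream function replaces \<open>\<beta>\<close> by
  \<open>1 - \<beta>\<close> (\<open>has_quasimodes_dual\<close>), and the set of these \<open>\<beta>\<close> is closed
  (\<open>has_quasimodes_closed\<close>), which gives the whole unit interval.

  The separated wings have no such corner. But they differ from the bowtie by a set of small
  measure, on which the bounded gradient of a fixed quasi-mode carries little energy. So a quasi-mode
  of the bowtie is one for the separated wings, with a small residual, and a self-adjoint operator has
  spectrum within the residual of an approximate eigenvalue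
  (\<open>spectrum_near_approximate_eigenvalue\<close>, \<open>spectrum_stability\<close>). This makes every \<open>\<beta>\<close> in the
  unit interval a limit point.
\<close>

section \<open>Calculus of \<open>C\<^sup>k\<close> functions in the plane\<close>

declare Ck_on.simps(2) [simp del]

lemma Ck_on_SucD:
  assumes "Ck_on (Suc k) f S"
  shows "x \<in> S \<Longrightarrow> f differentiable (at x)" and "Ck_on k (partial_deriv i f) S"
  using assms by (auto simp: Ck_on.simps(2))

lemma partial_deriv_eqI:
  assumes "(f has_derivative (\<lambda>h. \<Sum>i\<in>UNIV. D i * h $ i)) (at x)"
  shows "partial_deriv i f x = D i"
proof -
  have "frechet_derivative f (at x) = (\<lambda>h. \<Sum>i\<in>UNIV. D i * h $ i)"
    using assms by (metis frechet_derivative_at)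
  then show ?thesis
    by (simp add: partial_deriv_def axis_def if_distrib sum.delta cong: if_cong)
qed

lemma has_derivative_partial_deriv:
  fixes f :: "real^2 \<Rightarrow> real"
  assumes "f differentiable (at x)"
  shows "(f has_derivative (\<lambda>h. \<Sum>i\<in>UNIV. partial_deriv i f x * h $ i)) (at x)"
proof -
  let ?L = "frechet_derivative f (at x)"
  have L: "(f has_derivative ?L) (at x)"
    using assms frechet_derivative_works by blast
  then have lin: "linear ?L"
    using has_derivative_linear by blast
  have "?L h = (\<Sum>i\<in>UNIV. partial_deriv i f x * h $ i)" for h
  proof -
    have "?L h = ?L (\<Sum>i\<in>UNIV. (h $ i) *\<^sub>R axis i 1)"
      by (simp add: basis_expansion scalar_mult_eq_scaleR[symmetric])
    also have "\<dots> = (\<Sum>i\<in>UNIV. (h $ i) *\<^sub>R ?L (axis i 1))"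
      by (simp add: linear_sum[OF lin] linear_scale[OF lin] o_def)
    finally show ?thesis
      by (simp add: partial_deriv_def mult.commute)
  qed
  then show ?thesis
    using L by (metis (no_types, lifting) ext)
qed

text \<open>Partial derivatives at points of an open set depend on the values in that set only. Hence any
  family of \<open>C\<^sup>k\<close> functions that represents the derivative on the set certifies the order \<open>k + 1\<close>;
  the closure properties below are inductions on the order by means of this rule.\<close>

lemma Ck_on_SucI:
  assumes "\<And>x. x \<in> S \<Longrightarrow> (f has_derivative (\<lambda>h. \<Sum>i\<in>UNIV. D i x * h $ i)) (at x)"
    and "\<And>i. Ck_on k (D i) S" and "open S"
  shows "Ck_on (Suc k) f S"
proof -
  have cong: "Ck_on k g S" if "\<And>x. x \<in> S \<Longrightarrow> g' x = g x" "Ck_on k g' S" for g g'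
    using that
  proof (induction k arbitrary: g g')
    case 0
    then show ?case by (simp cong: continuous_on_cong)
  next
    case (Suc k)
    have d: "g differentiable at x" "partial_deriv i g x = partial_deriv i g' x" if "x \<in> S" for x i
    proof -
      have "g' differentiable at x" using Ck_on_SucD Suc.prems that by blast
      then have "(g' has_derivative (\<lambda>h. \<Sum>i\<in>UNIV. partial_deriv i g' x * h $ i)) (at x)"
        by (rule has_derivative_partial_deriv)
      then have *: "(g has_derivative (\<lambda>h. \<Sum>i\<in>UNIV. partial_deriv i g' x * h $ i)) (at x)"
        using Suc.prems that assms(3) by (intro has_derivative_transform_within_open[of g' _ x UNIV S g]) auto
      then show "g differentiable at x" using differentiable_def by blast
      show "partial_deriv i g x = partial_deriv i g' x" using partial_deriv_eqI[OF *] .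
    qed
    have "Ck_on k (partial_deriv i g) S" for i
      by (rule Suc.IH[of "partial_deriv i g'"]) (use d Suc.prems Ck_on_SucD in auto)
    then show ?case using d by (simp add: Ck_on.simps(2))
  qed
  have "f differentiable at x" if "x \<in> S" for x
    using assms(1)[OF that] differentiable_def by blast
  moreover have "Ck_on k (partial_deriv i f) S" for i
    by (rule cong[of "D i"]) (use assms partial_deriv_eqI in fastforce)+
  ultimately show ?thesis by (simp add: Ck_on.simps(2))
qed

lemma Ck_on_cong:
  assumes "\<And>x. x \<in> S \<Longrightarrow> f x = g x" "open S"
  shows "Ck_on k f S \<longleftrightarrow> Ck_on k g S"
proof -
  have *: "Ck_on k g S" if "Ck_on k f S" "\<And>x. x \<in> S \<Longrightarrow> f x = g x" for f g
  proof (cases k)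
    case 0
    then show ?thesis using that by (simp cong: continuous_on_cong)
  next
    case (Suc k')
    have "(g has_derivative (\<lambda>h. \<Sum>i\<in>UNIV. partial_deriv i f x * h $ i)) (at x)" if "x \<in> S" for x
    proof -
      have "(f has_derivative (\<lambda>h. \<Sum>i\<in>UNIV. partial_deriv i f x * h $ i)) (at x)"
        using has_derivative_partial_deriv that \<open>Ck_on k f S\<close> Suc Ck_on_SucD(1) by blast
      then show ?thesis
        using assms(2) that \<open>\<And>x. x \<in> S \<Longrightarrow> f x = g x\<close>
        by (intro has_derivative_transform_within_open[of f _ x UNIV S g]) auto
    qed
    then show ?thesis using that Suc assms(2) by (auto intro!: Ck_on_SucI[of S g "\<lambda>i. partial_deriv i f"] dest: Ck_on_SucD)
  qed
  show ?thesis using *[of f g] *[of g f] assms by metis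
qed

lemma Ck_on_Suc_imp:
  "Ck_on (Suc k) f S \<Longrightarrow> Ck_on k f S"
proof (induction k arbitrary: f)
  case 0
  then show ?case
    by (auto intro!: continuous_at_imp_continuous_on differentiable_imp_continuous_within dest: Ck_on_SucD)
qed (auto simp: Ck_on.simps(2))

lemma Ck_on_Un: "Ck_on k f S \<Longrightarrow> Ck_on k f T \<Longrightarrow> open S \<Longrightarrow> open T \<Longrightarrow> Ck_on k f (S \<union> T)"
  by (induction k arbitrary: f) (auto intro: continuous_on_open_Un simp: Ck_on.simps(2))

lemma Ck_on_subset: "Ck_on k f S \<Longrightarrow> T \<subseteq> S \<Longrightarrow> Ck_on k f T"
  by (induction k arbitrary: f) (auto intro: continuous_on_subset simp: Ck_on.simps(2))

lemma Ck_on_const: "open S \<Longrightarrow> Ck_on k (\<lambda>x. c) S"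
proof (induction k arbitrary: c)
  case (Suc k)
  then show ?case by (intro Ck_on_SucI[where D="\<lambda>i x. 0"]) auto
qed simp

lemma Ck_on_component: "open S \<Longrightarrow> Ck_on k (\<lambda>x. x $ j) S"
proof (induction k)
  case 0
  show ?case by (auto intro!: continuous_intros)
next
  case (Suc k)
  show ?case
  proof (intro Ck_on_SucI[where D="\<lambda>i x. if i = j then 1 else 0"])
    fix x :: "real^2"
    have eq: "(\<lambda>h::real^2. \<Sum>i\<in>UNIV. (if i = j then 1 else 0) * h $ i) = (\<lambda>h. h $ j)"
      by (auto simp: fun_eq_iff if_distrib[of "\<lambda>a. a * _"] cong: if_cong)
    show "((\<lambda>x. x $ j) has_derivative (\<lambda>h. \<Sum>i\<in>UNIV. (if i = j then 1 else 0) * h $ i)) (at x)"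
      unfolding eq by (rule bounded_linear_imp_has_derivative) (rule bounded_linear_vec_nth)
  qed (use Suc Ck_on_const in auto)
qed

lemma Ck_on_add: "Ck_on k f S \<Longrightarrow> Ck_on k g S \<Longrightarrow> open S \<Longrightarrow> Ck_on k (\<lambda>x. f x + g x) S"
proof (induction k arbitrary: f g)
  case 0
  then show ?case by (auto intro!: continuous_intros)
next
  case (Suc k)
  show ?case
  proof (intro Ck_on_SucI[where D="\<lambda>i x. partial_deriv i f x + partial_deriv i g x"])
    fix x assume "x \<in> S"
    then have d: "(f has_derivative (\<lambda>h. \<Sum>i\<in>UNIV. partial_deriv i f x * h $ i)) (at x)"
      "(g has_derivative (\<lambda>h. \<Sum>i\<in>UNIV. partial_deriv i g x * h $ i)) (at x)"
      using Suc.prems Ck_on_SucD(1) has_derivative_partial_deriv by blast+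
    show "((\<lambda>x. f x + g x) has_derivative
        (\<lambda>h. \<Sum>i\<in>UNIV. (partial_deriv i f x + partial_deriv i g x) * h $ i)) (at x)"
      by (rule has_derivative_eq_rhs[OF has_derivative_add[OF d]])
         (simp add: algebra_simps sum.distrib)
  qed (use Suc Ck_on_SucD in auto)
qed

lemma has_derivative_mult_grad:
  fixes f g :: "real^2 \<Rightarrow> real"
  assumes "(f has_derivative (\<lambda>h. \<Sum>i\<in>UNIV. F i * h $ i)) (at x)"
    and "(g has_derivative (\<lambda>h. \<Sum>i\<in>UNIV. G i * h $ i)) (at x)"
  shows "((\<lambda>x. f x * g x) has_derivative (\<lambda>h. \<Sum>i\<in>UNIV. (f x * G i + F i * g x) * h $ i)) (at x)"
  by (rule has_derivative_eq_rhs[OF has_derivative_mult[OF assms]])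
     (simp add: algebra_simps sum.distrib sum_distrib_left)

lemma Ck_on_mult: "Ck_on k f S \<Longrightarrow> Ck_on k g S \<Longrightarrow> open S \<Longrightarrow> Ck_on k (\<lambda>x. f x * g x) S"
proof (induction k arbitrary: f g)
  case 0
  then show ?case by (auto intro!: continuous_intros)
next
  case (Suc k)
  show ?case
  proof (intro Ck_on_SucI[where D="\<lambda>i x. f x * partial_deriv i g x + partial_deriv i f x * g x"]
      has_derivative_mult_grad)
    fix i show "Ck_on k (\<lambda>x. f x * partial_deriv i g x + partial_deriv i f x * g x) S"
      using Suc Ck_on_Suc_imp[OF Suc.prems(1)] Ck_on_Suc_imp[OF Suc.prems(2)]
      by (intro Ck_on_add Suc.IH Ck_on_SucD(2))
  qed (use Suc Ck_on_SucD has_derivative_partial_deriv in blast)+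
qed

text \<open>The chain rule raises the order of differentiability by one, provided that the derivative
  \<open>h' \<circ> f\<close> of the outer function has the order of the induction hypothesis.\<close>

lemma Ck_on_compose_SucI:
  assumes f: "Ck_on (Suc k) f S"
    and h: "\<And>x. x \<in> S \<Longrightarrow> (h has_real_derivative h' (f x)) (at (f x))"
    and h': "Ck_on k (\<lambda>x. h' (f x)) S" and S: "open S"
  shows "Ck_on (Suc k) (\<lambda>x. h (f x)) S"
proof (intro Ck_on_SucI[where D="\<lambda>i x. h' (f x) * partial_deriv i f x"])
  fix x assume x: "x \<in> S"
  then have d: "(f has_derivative (\<lambda>h. \<Sum>i\<in>UNIV. partial_deriv i f x * h $ i)) (at x)"
    using Ck_on_SucD(1)[OF f] has_derivative_partial_deriv by blast
  have "(h has_derivative (\<lambda>y. h' (f x) * y)) (at (f x))"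
    using h[OF x] by (simp add: has_field_derivative_def)
  from has_derivative_compose[OF d this]
  show "((\<lambda>x. h (f x)) has_derivative (\<lambda>v. \<Sum>i\<in>UNIV. h' (f x) * partial_deriv i f x * v $ i)) (at x)"
    by (rule has_derivative_eq_rhs) (simp add: sum_distrib_left mult_ac)
qed (use f h' S Ck_on_mult Ck_on_SucD in auto)

lemma Ck_on_uminus: "Ck_on k f S \<Longrightarrow> open S \<Longrightarrow> Ck_on k (\<lambda>x. - f x) S"
  using Ck_on_mult[OF Ck_on_const[of S k "-1"]] by force

lemma Ck_on_diff: "Ck_on k f S \<Longrightarrow> Ck_on k g S \<Longrightarrow> open S \<Longrightarrow> Ck_on k (\<lambda>x. f x - g x) S"
  using Ck_on_add[OF _ Ck_on_uminus, of k f S g] by simp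

lemma Ck_on_inverse:
  "Ck_on k f S \<Longrightarrow> open S \<Longrightarrow> (\<And>x. x \<in> S \<Longrightarrow> f x \<noteq> 0) \<Longrightarrow> Ck_on k (\<lambda>x. inverse (f x)) S"
proof (induction k)
  case 0
  then show ?case by (auto intro!: continuous_intros)
next
  case (Suc k)
  have "Ck_on k (\<lambda>x. inverse (f x)) S" using Suc Ck_on_Suc_imp by blast
  then have "Ck_on k (\<lambda>x. - (inverse (f x) ^ 2)) S"
    unfolding power2_eq_square using Suc.prems by (intro Ck_on_uminus Ck_on_mult)
  then show ?case
    using Suc.prems DERIV_inverse[unfolded numeral_2_eq_2[symmetric]]
    by (intro Ck_on_compose_SucI[where h=inverse and h'="\<lambda>x. - (inverse x ^ 2)" and f=f]) auto
qed

lemma Ck_on_divide: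
  "Ck_on k f S \<Longrightarrow> Ck_on k g S \<Longrightarrow> open S \<Longrightarrow> (\<And>x. x \<in> S \<Longrightarrow> g x \<noteq> 0)
    \<Longrightarrow> Ck_on k (\<lambda>x. f x / g x) S"
  unfolding divide_inverse by (intro Ck_on_mult Ck_on_inverse)

lemma Ck_on_sin_cos:
  "Ck_on k f S \<Longrightarrow> open S \<Longrightarrow> Ck_on k (\<lambda>x. sin (f x)) S \<and> Ck_on k (\<lambda>x. cos (f x)) S"
proof (induction k)
  case 0
  then show ?case by (auto intro!: continuous_intros)
next
  case (Suc k)
  then have "Ck_on k (\<lambda>x. sin (f x)) S" "Ck_on k (\<lambda>x. cos (f x)) S" using Ck_on_Suc_imp by blast+
  then show ?case
    using Suc.prems by (intro conjI Ck_on_compose_SucI[where h=sin and h'=cos and f=f]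
      Ck_on_compose_SucI[where h=cos and h'="\<lambda>x. - sin x" and f=f]) (auto intro!: Ck_on_uminus DERIV_sin DERIV_cos)
qed

lemma Ck_on_sinh_cosh:
  "Ck_on k f S \<Longrightarrow> open S \<Longrightarrow> Ck_on k (\<lambda>x. sinh (f x)) S \<and> Ck_on k (\<lambda>x. cosh (f x)) S"
proof (induction k)
  case 0
  then show ?case by (auto intro!: continuous_intros)
next
  case (Suc k)
  then have "Ck_on k (\<lambda>x. sinh (f x)) S" "Ck_on k (\<lambda>x. cosh (f x)) S" using Ck_on_Suc_imp by blast+
  then show ?case
    using Suc.prems by (intro conjI Ck_on_compose_SucI[where h=sinh and h'=cosh and f=f]
      Ck_on_compose_SucI[where h=cosh and h'=sinh and f=f]) (auto intro!: derivative_eq_intros)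
qed

lemma Ck_on_ln:
  assumes "Ck_on k f S" "open S" "\<And>x. x \<in> S \<Longrightarrow> f x > 0"
  shows "Ck_on k (\<lambda>x. ln (f x)) S"
proof (cases k)
  case 0
  then show ?thesis using assms by (auto intro!: continuous_intros) (metis less_irrefl)
next
  case (Suc k')
  then show ?thesis using assms Ck_on_Suc_imp[of k' f S]
    by (auto intro!: Ck_on_compose_SucI[where h=ln and h'=inverse and f=f] Ck_on_inverse DERIV_ln)
      (metis less_irrefl)
qed

lemma Ck_on_arctan:
  assumes "Ck_on k f S" "open S"
  shows "Ck_on k (\<lambda>x. arctan (f x)) S"
proof (cases k)
  case 0
  then show ?thesis using assms by (auto intro!: continuous_intros)
next
  case (Suc k')
  have nz: "1 + (f x)\<^sup>2 \<noteq> 0" for x by (smt (verit) zero_le_power2)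
  have d: "(arctan has_real_derivative inverse (1 + f x * f x)) (at (f x))" for x
    using DERIV_arctan[of "f x"] by (simp add: power2_eq_square)
  show ?thesis unfolding Suc
    using assms Ck_on_Suc_imp[of k' f S] Suc nz d
    by (intro Ck_on_compose_SucI[where h=arctan and h'="\<lambda>y. inverse (1 + y * y)" and f=f])
      (auto intro!: Ck_on_inverse Ck_on_add Ck_on_mult Ck_on_const simp: power2_eq_square)
qed

lemma smooth_on_const: "open S \<Longrightarrow> smooth_on (\<lambda>x. c) S"
  and smooth_on_component: "open S \<Longrightarrow> smooth_on (\<lambda>x. x $ j) S"
  and smooth_on_add: "smooth_on f S \<Longrightarrow> smooth_on g S \<Longrightarrow> open S \<Longrightarrow> smooth_on (\<lambda>x. f x + g x) S"
  and smooth_on_diff: "smooth_on f S \<Longrightarrow> smooth_on g S \<Longrightarrow> open S \<Longrightarrow> smooth_on (\<lambda>x. f x - g x) S"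
  and smooth_on_mult: "smooth_on f S \<Longrightarrow> smooth_on g S \<Longrightarrow> open S \<Longrightarrow> smooth_on (\<lambda>x. f x * g x) S"
  and smooth_on_divide: "smooth_on f S \<Longrightarrow> smooth_on g S \<Longrightarrow> open S \<Longrightarrow> (\<And>x. x \<in> S \<Longrightarrow> g x \<noteq> 0)
    \<Longrightarrow> smooth_on (\<lambda>x. f x / g x) S"
  and smooth_on_sin: "smooth_on f S \<Longrightarrow> open S \<Longrightarrow> smooth_on (\<lambda>x. sin (f x)) S"
  and smooth_on_cos: "smooth_on f S \<Longrightarrow> open S \<Longrightarrow> smooth_on (\<lambda>x. cos (f x)) S"
  and smooth_on_sinh: "smooth_on f S \<Longrightarrow> open S \<Longrightarrow> smooth_on (\<lambda>x. sinh (f x)) S"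
  and smooth_on_cosh: "smooth_on f S \<Longrightarrow> open S \<Longrightarrow> smooth_on (\<lambda>x. cosh (f x)) S"
  and smooth_on_ln: "smooth_on f S \<Longrightarrow> open S \<Longrightarrow> (\<And>x. x \<in> S \<Longrightarrow> f x > 0) \<Longrightarrow> smooth_on (\<lambda>x. ln (f x)) S"
  and smooth_on_arctan: "smooth_on f S \<Longrightarrow> open S \<Longrightarrow> smooth_on (\<lambda>x. arctan (f x)) S"
  and smooth_on_Un: "smooth_on f S \<Longrightarrow> smooth_on f T \<Longrightarrow> open S \<Longrightarrow> open T \<Longrightarrow> smooth_on f (S \<union> T)"
  and smooth_on_subset: "smooth_on f S \<Longrightarrow> T \<subseteq> S \<Longrightarrow> smooth_on f T"
  and smooth_on_cong: "(\<And>x. x \<in> S \<Longrightarrow> f x = g x) \<Longrightarrow> open S \<Longrightarrow> smooth_on f S = smooth_on g S"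
  by (simp_all add: smooth_on_def Ck_on_const Ck_on_component Ck_on_add Ck_on_diff Ck_on_mult
      Ck_on_divide Ck_on_sin_cos Ck_on_sinh_cosh Ck_on_ln Ck_on_arctan Ck_on_Un cong: Ck_on_cong)
    (use Ck_on_subset in blast)

lemma smooth_on_partial_deriv: "smooth_on f S \<Longrightarrow> smooth_on (partial_deriv i f) S"
  using Ck_on.simps(2) unfolding smooth_on_def by blast

lemma smooth_on_differentiable: "smooth_on f S \<Longrightarrow> x \<in> S \<Longrightarrow> f differentiable (at x)"
  unfolding smooth_on_def by (metis Ck_on.simps(2))

lemma smooth_on_continuous_on: "smooth_on f S \<Longrightarrow> continuous_on S f"
  using Ck_on.simps(1) unfolding smooth_on_def by blast


section \<open>A smooth step\<close>

text \<open>The functions \<open>p(1/x) exp(-1/x)\<close> for \<open>x > 0\<close>, extended by zero, with \<open>p\<close> a polynomial.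
  This class contains \<open>exp(-1/x)\<close> and is closed under differentiation.\<close>

definition flat :: "real poly \<Rightarrow> real \<Rightarrow> real" where
  "flat p x = (if x > 0 then poly p (1 / x) * exp (- (1 / x)) else 0)"

definition flat_deriv :: "real poly \<Rightarrow> real poly" where
  "flat_deriv p = [:0, 0, 1:] * (p - pderiv p)"

lemma poly_exp_tendsto_0: "((\<lambda>y::real. poly p y * exp (- y)) \<longlongrightarrow> 0) at_top"
proof -
  have "((\<lambda>y::real. y ^ n * exp (- y)) \<longlongrightarrow> 0) at_top" for n
    by real_asymp
  then have "((\<lambda>y. \<Sum>i\<le>degree p. coeff p i * (y ^ i * exp (- y))) \<longlongrightarrow> (\<Sum>i\<le>degree p. coeff p i * 0)) at_top"
    by (intro tendsto_sum tendsto_mult tendsto_const)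
  then show ?thesis
    by (simp add: poly_altdef sum_distrib_right mult.assoc)
qed

lemma flat_has_derivative: "(flat p has_real_derivative flat (flat_deriv p) x) (at x)"
proof -
  consider "x > 0" | "x < 0" | "x = 0" by linarith
  then show ?thesis
  proof cases
    case 1
    have "((\<lambda>x. poly p (1 / x) * exp (- (1 / x))) has_real_derivative flat (flat_deriv p) x) (at x)"
      using 1 by (auto intro!: derivative_eq_intros poly_DERIV[THEN DERIV_chain2]
          simp: flat_def flat_deriv_def field_simps power2_eq_square)
    then show ?thesis
      by (rule has_field_derivative_transform_within_open[where S="{0<..}"]) (use 1 in \<open>auto simp: flat_def\<close>)
  next
    case 2
    have "((\<lambda>x. 0) has_real_derivative flat (flat_deriv p) x) (at x)"
      using 2 by (auto simp: flat_def)
    then show ?thesis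
      by (rule has_field_derivative_transform_within_open[where S="{..<0}"]) (use 2 in \<open>auto simp: flat_def\<close>)
  next
    case 3
    have "((\<lambda>h. flat p h / h) \<longlongrightarrow> 0) (at_right 0)"
    proof -
      have "((\<lambda>h. poly (pCons 0 p) (inverse h) * exp (- inverse h)) \<longlongrightarrow> 0) (at_right (0::real))"
        using filterlim_compose[OF poly_exp_tendsto_0 filterlim_inverse_at_top_right] .
      then show ?thesis
        by (rule Lim_transform_eventually)
           (auto simp: eventually_at_filter flat_def field_simps)
    qed
    moreover have "((\<lambda>h. flat p h / h) \<longlongrightarrow> 0) (at_left 0)"
      by (rule Lim_transform_eventually[of "\<lambda>_. 0"]) (auto simp: eventually_at_filter flat_def)
    ultimately have "((\<lambda>h. flat p h / h) \<longlongrightarrow> 0) (at 0)"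
      by (simp add: filterlim_split_at)
    then show ?thesis using 3 by (simp add: DERIV_def flat_def)
  qed
qed

lemma smooth_on_flat:
  assumes "smooth_on f S" "open S" shows "smooth_on (\<lambda>x. flat p (f x)) S"
proof -
  have "Ck_on k (\<lambda>x. flat p (f x)) S" for k
  proof (induction k arbitrary: p)
    case 0
    have "continuous_on UNIV (flat p)"
      using flat_has_derivative DERIV_isCont continuous_at_imp_continuous_on by blast
    then show ?case using smooth_on_continuous_on[OF assms(1)]
      by (simp add: continuous_on_compose2[of UNIV "flat p"])
  next
    case (Suc k)
    show ?case
      by (rule Ck_on_compose_SucI[where f=f, OF _ flat_has_derivative Suc])
         (use assms in \<open>auto simp: smooth_on_def\<close>)
  qed
  then show ?thesis by (simp add: smooth_on_def)
qed

definition step :: "real \<Rightarrow> real" where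
  "step x = flat 1 x / (flat 1 x + flat 1 (1 - x))"

lemma flat_1_nonneg: "flat 1 x \<ge> 0" and flat_1_pos: "x > 0 \<Longrightarrow> flat 1 x > 0"
  and flat_1_eq_0: "x \<le> 0 \<Longrightarrow> flat 1 x = 0"
  by (auto simp: flat_def)

lemma step_denominator_pos: "flat 1 x + flat 1 (1 - x) > 0"
  by (cases "x > 0") (use flat_1_nonneg[of "1-x"] flat_1_nonneg[of x] flat_1_pos[of x] flat_1_pos[of "1-x"] in auto)

lemma step_eq_0 [simp]: "x \<le> 0 \<Longrightarrow> step x = 0"
  and step_eq_1 [simp]: "x \<ge> 1 \<Longrightarrow> step x = 1"
  and step_nonneg: "0 \<le> step x" and step_le_1: "step x \<le> 1"
  using flat_1_nonneg[of "1-x"] flat_1_nonneg[of x] step_denominator_pos[of x]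
  by (auto simp: step_def flat_1_eq_0)

lemma smooth_on_step:
  assumes "smooth_on f S" "open S" shows "smooth_on (\<lambda>x. step (f x)) S"
  unfolding step_def using assms step_denominator_pos
  by (auto intro!: smooth_on_divide smooth_on_add smooth_on_flat smooth_on_diff smooth_on_const)
    (metis less_irrefl)

text \<open>The derivative is continuous and vanishes outside the unit interval, hence is bounded.\<close>

lemma step_derivative:
  obtains step' K where "\<And>x. (step has_real_derivative step' x) (at x)" "\<And>x. \<bar>step' x\<bar> \<le> K"
    "\<And>x. x \<le> 0 \<Longrightarrow> step' x = 0" "\<And>x. x \<ge> 1 \<Longrightarrow> step' x = 0"
proof -
  let ?g = "flat (flat_deriv 1)"
  let ?den = "\<lambda>x. flat 1 x + flat 1 (1 - x)"
  define s' where "s' x = (?g x * ?den x - flat 1 x * (?g x - ?g (1 - x))) / (?den x * ?den x)" for x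
  have den: "?den x \<noteq> 0" for x using step_denominator_pos[of x] by simp
  have d: "(step has_real_derivative s' x) (at x)" for x
  proof -
    have 1: "((\<lambda>x. flat 1 (1 - x)) has_real_derivative - ?g (1 - x)) (at x)"
      by (rule DERIV_cong[OF DERIV_chain2[OF flat_has_derivative]]) (auto intro!: derivative_eq_intros)
    show ?thesis unfolding step_def[abs_def] s'_def
      by (rule DERIV_cong[OF DERIV_divide[OF flat_has_derivative DERIV_add[OF flat_has_derivative 1] den]])
        simp
  qed
  have cont: "continuous_on UNIV (flat p)" for p
    using flat_has_derivative DERIV_isCont continuous_at_imp_continuous_on by blast
  have "continuous_on {0..1} s'"
    unfolding s'_def using den
    by (auto intro!: continuous_intros continuous_on_compose2[OF cont])
  then have "bounded (s' ` {0..1})" using compact_imp_bounded compact_continuous_image by blast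
  then obtain K where K: "\<And>x. x \<in> {0..1} \<Longrightarrow> \<bar>s' x\<bar> \<le> K" by (force simp: bounded_iff)
  have 0: "s' x = 0" if "x \<le> 0" for x using that by (auto simp: s'_def flat_def)
  have 1: "s' x = 0" if "x \<ge> 1" for x using that by (auto simp: s'_def flat_def)
  have "\<bar>s' x\<bar> \<le> K" for x
    using K[of x] K[of 0] 0[of x] 1[of x] by (cases "x \<in> {0..1}") auto
  then show ?thesis using that d 0 1 by blast
qed

section \<open>Test functions and integration by parts\<close>

lemma test_functionsI:
  assumes "smooth_on \<phi> UNIV" "compact K" "K \<subseteq> \<Omega>" "\<And>x. x \<notin> K \<Longrightarrow> \<phi> x = 0"
  shows "\<phi> \<in> test_functions \<Omega>"
proof -
  have "{x. \<phi> x \<noteq> 0} \<subseteq> K" using assms by auto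
  then have "closure {x. \<phi> x \<noteq> 0} \<subseteq> K" using \<open>compact K\<close> closure_minimal compact_imp_closed by blast
  moreover from this have "compact (closure {x. \<phi> x \<noteq> 0})"
    using \<open>compact K\<close> compact_Int_closed[of K "closure {x. \<phi> x \<noteq> 0}"] by (simp add: Int_absorb1)
  ultimately show ?thesis using assms by (auto simp: test_functions_def)
qed

lemma test_functionsE:
  assumes "\<phi> \<in> test_functions \<Omega>"
  obtains K where "smooth_on \<phi> UNIV" "compact K" "K \<subseteq> \<Omega>" "\<And>x. x \<notin> K \<Longrightarrow> \<phi> x = 0"
  using assms closure_subset[of "{x. \<phi> x \<noteq> 0}"]
  by (intro that[of "closure {x. \<phi> x \<noteq> 0}"]) (auto simp: test_functions_def)

lemma test_functions_smooth: "\<phi> \<in> test_functions \<Omega> \<Longrightarrow> smooth_on \<phi> UNIV"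
  by (simp add: test_functions_def)

lemma test_functions_eq_0: "\<phi> \<in> test_functions \<Omega> \<Longrightarrow> x \<notin> \<Omega> \<Longrightarrow> \<phi> x = 0"
  by (metis test_functionsE subsetD)

lemma test_functions_mono: "\<phi> \<in> test_functions \<Omega> \<Longrightarrow> \<Omega> \<subseteq> \<Omega>' \<Longrightarrow> \<phi> \<in> test_functions \<Omega>'"
  by (auto simp: test_functions_def)

lemma test_functions_lincomb:
  assumes "\<phi> \<in> test_functions \<Omega>" "\<psi> \<in> test_functions \<Omega>"
  shows "(\<lambda>x. a * \<phi> x + b * \<psi> x) \<in> test_functions \<Omega>"
proof -
  obtain K where K: "smooth_on \<phi> UNIV" "compact K" "K \<subseteq> \<Omega>" "\<And>x. x \<notin> K \<Longrightarrow> \<phi> x = 0"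
    using test_functionsE[OF assms(1)] by metis
  obtain L where L: "smooth_on \<psi> UNIV" "compact L" "L \<subseteq> \<Omega>" "\<And>x. x \<notin> L \<Longrightarrow> \<psi> x = 0"
    using test_functionsE[OF assms(2)] by metis
  show ?thesis
  proof (rule test_functionsI[where K="K \<union> L"])
    show "smooth_on (\<lambda>x. a * \<phi> x + b * \<psi> x) UNIV"
      by (intro smooth_on_add smooth_on_mult smooth_on_const K L open_UNIV)
  qed (use K L in auto)
qed

lemma test_functions_mult:
  assumes "smooth_on f UNIV" "\<phi> \<in> test_functions \<Omega>"
  shows "(\<lambda>x. f x * \<phi> x) \<in> test_functions \<Omega>"
proof -
  obtain K where K: "smooth_on \<phi> UNIV" "compact K" "K \<subseteq> \<Omega>" "\<And>x. x \<notin> K \<Longrightarrow> \<phi> x = 0"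
    using test_functionsE[OF assms(2)] by metis
  show ?thesis
    by (rule test_functionsI[OF smooth_on_mult[OF assms(1) K(1) open_UNIV] K(2,3)]) (simp add: K(4))
qed

lemma test_functions_differentiable: "\<phi> \<in> test_functions \<Omega> \<Longrightarrow> \<phi> differentiable (at x)"
  using smooth_on_differentiable test_functions_smooth by blast

lemma test_functions_partial_deriv:
  assumes "\<phi> \<in> test_functions \<Omega>"
  shows "partial_deriv i \<phi> \<in> test_functions \<Omega>"
proof -
  obtain K where K: "smooth_on \<phi> UNIV" "compact K" "K \<subseteq> \<Omega>" "\<And>x. x \<notin> K \<Longrightarrow> \<phi> x = 0"
    using test_functionsE[OF assms] by metis
  show ?thesis
  proof (rule test_functionsI[OF smooth_on_partial_deriv[OF K(1)] K(2,3)])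
    fix x assume x: "x \<notin> K"
    have "(\<phi> has_derivative (\<lambda>h. \<Sum>i\<in>UNIV. 0 * h $ i)) (at x)"
      by (rule has_derivative_transform_within_open[of "\<lambda>x. 0" _ x UNIV "- K"])
        (use x K compact_imp_closed in auto)
    then show "partial_deriv i \<phi> x = 0" by (rule partial_deriv_eqI)
  qed
qed

lemma partial_deriv_lincomb:
  assumes "f differentiable (at x)" "g differentiable (at x)"
  shows "partial_deriv i (\<lambda>x. a * f x + b * g x) x = a * partial_deriv i f x + b * partial_deriv i g x"
proof (rule partial_deriv_eqI[where D="\<lambda>i. a * partial_deriv i f x + b * partial_deriv i g x"])
  note d = assms[THEN has_derivative_partial_deriv]
  show "((\<lambda>x. a * f x + b * g x) has_derivative
      (\<lambda>h. \<Sum>i\<in>UNIV. (a * partial_deriv i f x + b * partial_deriv i g x) * h $ i)) (at x)"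
    by (rule has_derivative_eq_rhs[OF has_derivative_add[OF
            has_derivative_mult_right[OF d(1)] has_derivative_mult_right[OF d(2)]]])
      (simp add: algebra_simps sum.distrib sum_distrib_left)
qed

lemma partial_deriv_mult:
  assumes "f differentiable (at x)" "g differentiable (at x)"
  shows "partial_deriv i (\<lambda>x. f x * g x) x = f x * partial_deriv i g x + partial_deriv i f x * g x"
  by (rule partial_deriv_eqI[where D="\<lambda>i. f x * partial_deriv i g x + partial_deriv i f x * g x"],
      rule has_derivative_mult_grad) (intro has_derivative_partial_deriv assms)+

lemma partial_deriv_translate:
  assumes "f differentiable (at (x + a))"
  shows "((\<lambda>x. f (x + a)) has_derivative (\<lambda>h. \<Sum>i\<in>UNIV. partial_deriv i f (x + a) * h $ i)) (at x)"
    and "partial_deriv i (\<lambda>x. f (x + a)) x = partial_deriv i f (x + a)"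
proof -
  have "((\<lambda>x. x + a) has_derivative (\<lambda>h. h)) (at x)" by (auto intro!: derivative_eq_intros)
  from has_derivative_compose[OF this has_derivative_partial_deriv[OF assms]]
  show d: "((\<lambda>x. f (x + a)) has_derivative (\<lambda>h. \<Sum>i\<in>UNIV. partial_deriv i f (x + a) * h $ i)) (at x)" .
  show "partial_deriv i (\<lambda>x. f (x + a)) x = partial_deriv i f (x + a)"
    by (rule partial_deriv_eqI[OF d])
qed

lemma smooth_on_translate:
  assumes "smooth_on f UNIV" shows "smooth_on (\<lambda>x. f (x + a)) UNIV"
proof -
  have "Ck_on k (\<lambda>x. f (x + a)) UNIV" if "Ck_on k f UNIV" for k
    using that
  proof (induction k arbitrary: f)
    case 0
    then show ?case by (auto intro!: continuous_intros continuous_on_compose2[of UNIV f])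
  next
    case (Suc k)
    show ?case
      by (rule Ck_on_SucI[where D="\<lambda>i x. partial_deriv i f (x + a)"])
        (use Suc Ck_on_SucD partial_deriv_translate(1) in auto)
  qed
  then show ?thesis using assms by (simp add: smooth_on_def)
qed

lemma test_functions_translate:
  assumes "\<phi> \<in> test_functions \<Omega>"
  shows "(\<lambda>x. \<phi> (x + a)) \<in> test_functions UNIV"
proof -
  obtain K where K: "smooth_on \<phi> UNIV" "compact K" "K \<subseteq> \<Omega>" "\<And>x. x \<notin> K \<Longrightarrow> \<phi> x = 0"
    using test_functionsE[OF assms] by metis
  show ?thesis
  proof (rule test_functionsI[where K="(\<lambda>x. x - a) ` K"])
    fix x assume "x \<notin> (\<lambda>x. x - a) ` K"
    then have "x + a \<notin> K" by force
    then show "\<phi> (x + a) = 0" using K by blast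
  qed (use K smooth_on_translate in \<open>auto intro!: compact_continuous_image continuous_intros\<close>)
qed

lemma has_derivative_along_axis:
  fixes f :: "real^2 \<Rightarrow> real"
  assumes "\<And>x. f differentiable (at x)"
  shows "((\<lambda>s. f (x + s *\<^sub>R axis i 1)) has_real_derivative partial_deriv i f (x + s *\<^sub>R axis i 1)) (at s)"
proof -
  have d: "((\<lambda>s. x + s *\<^sub>R axis i 1) has_derivative (\<lambda>h. h *\<^sub>R axis i 1)) (at s)"
    by (auto intro!: derivative_eq_intros)
  from has_derivative_compose[OF d has_derivative_partial_deriv[OF assms]]
  show ?thesis
    by (simp add: has_field_derivative_def axis_def if_distrib[of "\<lambda>a. _ * a"] sum.delta cong: if_cong)
qed

lemma integrable_continuous_compact_support:
  fixes f :: "real^2 \<Rightarrow> 'b::{banach, second_countable_topology}"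
  assumes "continuous_on UNIV f" "compact K" "\<And>x. x \<notin> K \<Longrightarrow> f x = 0"
  shows "integrable lborel f"
proof -
  have "integrable lborel (\<lambda>x. indicator K x *\<^sub>R f x)"
    using assms continuous_on_subset by (blast intro: borel_integrable_compact)
  also have "(\<lambda>x. indicator K x *\<^sub>R f x) = f" using assms(3) by (auto simp: indicator_def)
  finally show ?thesis .
qed

lemma continuous_test_function: "\<phi> \<in> test_functions \<Omega> \<Longrightarrow> continuous_on UNIV \<phi>"
  using smooth_on_continuous_on test_functions_smooth by blast

lemma integrable_continuous_mult_test_function:
  assumes "continuous_on UNIV f" "\<phi> \<in> test_functions \<Omega>"
  shows "integrable lborel (\<lambda>x. f x * \<phi> x)"
proof -
  obtain K where K: "compact K" "\<And>x. x \<notin> K \<Longrightarrow> \<phi> x = 0"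
    using test_functionsE[OF assms(2)] by metis
  show ?thesis
    by (rule integrable_continuous_compact_support[where K=K])
      (use assms continuous_test_function K in \<open>auto intro!: continuous_intros\<close>)
qed

lemma integrable_test_function: "\<phi> \<in> test_functions \<Omega> \<Longrightarrow> integrable lborel \<phi>"
  using integrable_continuous_mult_test_function[of "\<lambda>x. 1"] by simp

lemma bounded_test_function:
  assumes "\<phi> \<in> test_functions \<Omega>"
  obtains B where "B \<ge> 0" "\<And>x. \<bar>\<phi> x\<bar> \<le> B"
proof -
  obtain K where K: "compact K" "\<And>x. x \<notin> K \<Longrightarrow> \<phi> x = 0"
    using test_functionsE[OF assms] by metis
  have "compact (\<phi> ` K)"
    using assms continuous_test_function K by (metis compact_continuous_image continuous_on_subset subset_UNIV)
  then obtain B where B: "\<And>x. x \<in> K \<Longrightarrow> \<bar>\<phi> x\<bar> \<le> B"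
    using compact_imp_bounded bounded_iff by (metis imageI real_norm_def)
  have "\<bar>\<phi> x\<bar> \<le> max 0 B" for x
    using B[of x] K(2)[of x] by (cases "x \<in> K") auto
  then show ?thesis by (intro that[of "max 0 B"]) auto
qed

text \<open>The difference quotients of a test function are bounded and supported in one compact set, so
  that the integral converges by dominated convergence. Below, they transfer the translation
  invariance of the integral to partial derivatives.\<close>

lemma integral_difference_quotient_tendsto:
  assumes \<phi>: "\<phi> \<in> test_functions \<Omega>" and f: "continuous_on UNIV f"
  shows "(\<lambda>n. LINT x|lborel. f x * (real (Suc n) * (\<phi> (x + (1 / real (Suc n)) *\<^sub>R axis i 1) - \<phi> x)))
    \<longlonglongrightarrow> (LINT x|lborel. f x * partial_deriv i \<phi> x)"
proof -
  let ?e = "axis i 1 :: real^2"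
  let ?q = "\<lambda>n x. real (Suc n) * (\<phi> (x + (1 / real (Suc n)) *\<^sub>R ?e) - \<phi> x)"
  obtain B where B: "B \<ge> 0" "\<And>x. \<bar>partial_deriv i \<phi> x\<bar> \<le> B"
    using bounded_test_function[OF test_functions_partial_deriv[OF \<phi>]] by metis
  obtain K where K: "compact K" "\<And>x. x \<notin> K \<Longrightarrow> \<phi> x = 0"
    using test_functionsE[OF \<phi>] by metis
  obtain R where R: "K \<subseteq> ball 0 R"
    using K(1) compact_imp_bounded bounded_subset_ballD by blast
  let ?K = "cball (0::real^2) (R + 1)"
  have deriv: "((\<lambda>s. \<phi> (x + s *\<^sub>R ?e)) has_real_derivative partial_deriv i \<phi> (x + s *\<^sub>R ?e)) (at s)" for x s
    using has_derivative_along_axis test_functions_differentiable[OF \<phi>] by blast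
  have q_le: "\<bar>?q n x\<bar> \<le> indicator ?K x * B" for n x
  proof (cases "x \<in> ?K")
    case True
    have "norm (\<phi> (x + (1 / real (Suc n)) *\<^sub>R ?e) - \<phi> (x + 0 *\<^sub>R ?e)) \<le> B * norm (1 / real (Suc n) - 0)"
      by (rule field_differentiable_bound[where S=UNIV and f="\<lambda>s. \<phi> (x + s *\<^sub>R ?e)"
            and f'="\<lambda>s. partial_deriv i \<phi> (x + s *\<^sub>R ?e)"]) (use B deriv in auto)
    then have "real (Suc n) * \<bar>\<phi> (x + (1 / real (Suc n)) *\<^sub>R ?e) - \<phi> x\<bar> \<le> B"
      by (simp add: field_simps)
    then show ?thesis using True by (simp add: abs_mult)
  next
    case False
    have "norm ((1 / real (Suc n)) *\<^sub>R ?e) \<le> 1" by (simp add: norm_axis_1)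
    then have "norm (x + (1 / real (Suc n)) *\<^sub>R ?e) \<ge> norm x - 1"
      by (smt (verit) norm_diff_ineq)
    then have "x + (1 / real (Suc n)) *\<^sub>R ?e \<notin> ball 0 R" "x \<notin> ball 0 R" using False by auto
    then have "\<phi> (x + (1 / real (Suc n)) *\<^sub>R ?e) = 0" "\<phi> x = 0"
      using R K(2) by blast+
    then show ?thesis using False by simp
  qed
  have cont: "continuous_on UNIV (?q n)" for n
    using continuous_test_function[OF \<phi>]
    by (auto intro!: continuous_intros continuous_on_compose2[of UNIV \<phi>])
  have "integrable lborel (\<lambda>x. indicator ?K x *\<^sub>R (\<bar>f x\<bar> * B))"
    by (rule borel_integrable_compact) (auto intro!: continuous_intros continuous_on_subset[OF f])
  then have w: "integrable lborel (\<lambda>x. indicator ?K x * B * \<bar>f x\<bar>)" by (simp add: mult_ac)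
  show ?thesis
  proof (rule integral_dominated_convergence[OF _ _ w])
    have "continuous_on UNIV (partial_deriv i \<phi>)"
      using continuous_test_function test_functions_partial_deriv \<phi> by blast
    then show "(\<lambda>x. f x * partial_deriv i \<phi> x) \<in> borel_measurable lborel"
      using f by (auto intro!: borel_measurable_continuous_onI continuous_intros)
    show "(\<lambda>x. f x * ?q n x) \<in> borel_measurable lborel" for n
      using f cont[of n] by (auto intro!: borel_measurable_continuous_onI continuous_on_mult)
    show "AE x in lborel. norm (f x * ?q n x) \<le> indicator ?K x * B * \<bar>f x\<bar>" for n
      using mult_left_mono[OF q_le[of n], of "\<bar>f _\<bar>"] by (auto simp: abs_mult mult_ac simp del: of_nat_Suc)
    have "(\<lambda>n. ?q n x) \<longlonglongrightarrow> partial_deriv i \<phi> x" for x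
    proof -
      have "((\<lambda>h. (\<phi> (x + h *\<^sub>R ?e) - \<phi> x) / h) \<longlongrightarrow> partial_deriv i \<phi> x) (at 0)"
        using deriv[of x 0] by (simp add: DERIV_def)
      moreover have "filterlim (\<lambda>n. 1 / real (Suc n)) (at 0) sequentially"
        using LIMSEQ_inverse_real_of_nat by (intro filterlim_atI) (auto simp: inverse_eq_divide)
      ultimately show ?thesis
        using filterlim_compose by (fastforce simp: mult.commute)
    qed
    then show "AE x in lborel. (\<lambda>n. f x * ?q n x) \<longlonglongrightarrow> f x * partial_deriv i \<phi> x"
      by (auto intro!: tendsto_mult)
  qed
qed

lemma integral_lborel_translate:
  fixes f :: "'a::euclidean_space \<Rightarrow> real"
  assumes "f \<in> borel_measurable borel"
  shows "(LINT x|lborel. f (x + a)) = (LINT x|lborel. f x)"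
proof -
  have "(LINT x|lborel. f x) = (LINT x|distr lborel borel ((+) a). f x)"
    by (simp add: lborel_distr_plus)
  also have "\<dots> = (LINT x|lborel. f (x + a))"
    using assms by (subst integral_distr) (auto simp: add.commute)
  finally show ?thesis ..
qed

lemma integral_partial_deriv_eq_0:
  assumes \<phi>: "\<phi> \<in> test_functions \<Omega>"
  shows "(LINT x|lborel. partial_deriv i \<phi> x) = 0"
proof -
  have "(LINT x|lborel. real (Suc n) * (\<phi> (x + a) - \<phi> x)) = 0" for n a
  proof -
    have "integrable lborel (\<lambda>x. \<phi> (x + a))"
      using integrable_test_function test_functions_translate[OF \<phi>] by blast
    then show ?thesis
      by (simp only: integral_mult_right_zero integrable_test_function[OF \<phi>] Bochner_Integration.integral_diff
          integral_lborel_translate[OF borel_measurable_continuous_onI[OF continuous_test_function[OF \<phi>]]])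
        simp
  qed
  with integral_difference_quotient_tendsto[OF \<phi>, of "\<lambda>x. 1" i]
  have "(\<lambda>n. 0) \<longlonglongrightarrow> (LINT x|lborel. partial_deriv i \<phi> x)"
    by (simp only: mult_1 continuous_on_const)
  then show ?thesis by (simp add: LIMSEQ_const_iff)
qed

lemma integration_by_parts:
  assumes f: "smooth_on f UNIV" and \<phi>: "\<phi> \<in> test_functions \<Omega>"
  shows "(LINT x|lborel. f x * partial_deriv i \<phi> x) = - (LINT x|lborel. partial_deriv i f x * \<phi> x)"
proof -
  have 1: "integrable lborel (\<lambda>x. f x * partial_deriv i \<phi> x)"
    "integrable lborel (\<lambda>x. partial_deriv i f x * \<phi> x)"
    using f \<phi> smooth_on_continuous_on smooth_on_partial_deriv test_functions_partial_deriv
    by (blast intro: integrable_continuous_mult_test_function)+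
  have "partial_deriv i (\<lambda>x. f x * \<phi> x) x = f x * partial_deriv i \<phi> x + partial_deriv i f x * \<phi> x" for x
    using smooth_on_differentiable[OF f] test_functions_differentiable[OF \<phi>] by (simp add: partial_deriv_mult)
  then show ?thesis
    using integral_partial_deriv_eq_0[OF test_functions_mult[OF f \<phi>], of i] 1 by simp
qed

text \<open>Symmetry of second derivatives, in weak form: replacing \<open>\<partial>\<^sub>j \<phi>\<close> by difference quotients,
  which commute with \<open>\<partial>\<^sub>i\<close>, one can integrate by parts in both variables.\<close>

lemma integral_partial_deriv_swap:
  assumes f: "f \<in> test_functions \<Omega>" and \<phi>: "\<phi> \<in> test_functions \<Omega>"
  shows "(LINT x|lborel. partial_deriv i f x * partial_deriv j \<phi> x)
       = (LINT x|lborel. partial_deriv j f x * partial_deriv i \<phi> x)"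
proof -
  let ?a = "\<lambda>n. (1 / real (Suc n)) *\<^sub>R axis j 1 :: real^2"
  let ?A = "\<lambda>n. LINT x|lborel. partial_deriv i f x * (real (Suc n) * (\<phi> (x + ?a n) - \<phi> x))"
  let ?B = "\<lambda>n. LINT x|lborel. f x * (real (Suc n) * (partial_deriv i \<phi> (x + ?a n) - partial_deriv i \<phi> x))"
  note sm = test_functions_smooth[OF f]
  have "?A n = - ?B n" for n
  proof -
    let ?\<psi> = "\<lambda>x. real (Suc n) * \<phi> (x + ?a n) + - real (Suc n) * \<phi> x"
    have \<psi>: "?\<psi> \<in> test_functions UNIV"
      using test_functions_translate[OF \<phi>] test_functions_mono[OF \<phi>] by (intro test_functions_lincomb) auto
    have d: "partial_deriv i ?\<psi> x = real (Suc n) * partial_deriv i \<phi> (x + ?a n) + - real (Suc n) * partial_deriv i \<phi> x" for x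
      using test_functions_differentiable[OF \<phi>]
        test_functions_differentiable[OF test_functions_translate[OF \<phi>]]
      by (simp only: partial_deriv_lincomb partial_deriv_translate(2))
    show ?thesis
      using integration_by_parts[OF sm \<psi>, of i] by (simp only: d) (simp add: algebra_simps)
  qed
  moreover have "?A \<longlonglongrightarrow> (LINT x|lborel. partial_deriv i f x * partial_deriv j \<phi> x)"
    using f \<phi> continuous_test_function test_functions_partial_deriv
    by (blast intro: integral_difference_quotient_tendsto)
  moreover have "?B \<longlonglongrightarrow> (LINT x|lborel. f x * partial_deriv j (partial_deriv i \<phi>) x)"
    using f \<phi> continuous_test_function test_functions_partial_deriv
    by (blast intro: integral_difference_quotient_tendsto)
  then have "(\<lambda>n. - ?B n) \<longlonglongrightarrow> - (LINT x|lborel. f x * partial_deriv j (partial_deriv i \<phi>) x)"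
    by (rule tendsto_minus)
  ultimately have "(LINT x|lborel. partial_deriv i f x * partial_deriv j \<phi> x)
      = - (LINT x|lborel. f x * partial_deriv j (partial_deriv i \<phi>) x)"
    using LIMSEQ_unique by simp
  then show ?thesis
    using integration_by_parts[OF sm test_functions_partial_deriv[OF \<phi>], of j i] by simp
qed

text \<open>The Poincare inequality: integrate \<open>\<phi>\<^sup>2 = \<phi>\<^sup>2 \<cdot> \<partial>\<^sub>1 x\<^sub>1\<close> by parts.\<close>

lemma poincare_inequality_test_function:
  assumes \<phi>: "\<phi> \<in> test_functions (ball 0 R)"
  shows "(LINT x|lborel. (\<phi> x)\<^sup>2) \<le> 4 * R\<^sup>2 * (LINT x|lborel. (partial_deriv 1 \<phi> x)\<^sup>2)"
proof -
  let ?d = "partial_deriv 1 \<phi>"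
  have d: "?d \<in> test_functions (ball 0 R)" using test_functions_partial_deriv \<phi> .
  have sq: "(\<lambda>x. \<phi> x * \<phi> x) \<in> test_functions (ball 0 R)"
    using test_functions_mult \<phi> test_functions_smooth by blast
  have int: "integrable lborel (\<lambda>x. (\<phi> x)\<^sup>2)" "integrable lborel (\<lambda>x. (?d x)\<^sup>2)"
    unfolding power2_eq_square using \<phi> d continuous_test_function
    by (auto intro!: integrable_continuous_mult_test_function)
  have "partial_deriv 1 (\<lambda>x. x $ 1) x = 1" for x :: "real^2"
  proof -
    have "((\<lambda>x::real^2. x $ 1) has_derivative (\<lambda>h. \<Sum>i\<in>UNIV. (if i = 1 then 1 else 0) * h $ i)) (at x)"
      by (rule has_derivative_eq_rhs[OF bounded_linear_imp_has_derivative[OF bounded_linear_vec_nth]])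
        (auto simp: fun_eq_iff if_distrib[of "\<lambda>a. a * _"] cong: if_cong)
    from partial_deriv_eqI[OF this] show ?thesis by simp
  qed
  then have "(LINT x|lborel. (\<phi> x)\<^sup>2) = - (LINT x|lborel. x $ 1 * (2 * \<phi> x * ?d x))"
    using integration_by_parts[OF smooth_on_component[OF open_UNIV] sq, of 1 1]
      partial_deriv_mult[OF test_functions_differentiable[OF \<phi>] test_functions_differentiable[OF \<phi>], of 1]
    by (simp add: power2_eq_square algebra_simps)
  also have "\<dots> = (LINT x|lborel. - (x $ 1 * (2 * \<phi> x * ?d x)))" by simp
  also have "\<dots> \<le> (LINT x|lborel. (1/2) * (\<phi> x)\<^sup>2 + (2 * R\<^sup>2) * (?d x)\<^sup>2)"
  proof (rule integral_mono)
    have "continuous_on UNIV (\<lambda>x. - (x $ 1 * (2 * \<phi> x)))"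
      using \<phi> continuous_test_function by (auto intro!: continuous_intros)
    from integrable_continuous_mult_test_function[OF this d]
    show "integrable lborel (\<lambda>x. - (x $ 1 * (2 * \<phi> x * ?d x)))" by (simp add: mult.assoc)
    show "integrable lborel (\<lambda>x. (1/2) * (\<phi> x)\<^sup>2 + (2 * R\<^sup>2) * (?d x)\<^sup>2)" using int by simp
    fix x :: "real^2"
    show "- (x $ 1 * (2 * \<phi> x * ?d x)) \<le> (1/2) * (\<phi> x)\<^sup>2 + (2 * R\<^sup>2) * (?d x)\<^sup>2"
    proof (cases "x \<in> ball 0 R")
      case True
      then have "\<bar>x $ 1\<bar> \<le> R" using component_le_norm_cart[of x 1] by auto
      then have "(x $ 1)\<^sup>2 \<le> R\<^sup>2" by (metis abs_ge_zero power2_abs power_mono)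
      then have *: "2 * (x $ 1)\<^sup>2 * (?d x)\<^sup>2 \<le> (2 * R\<^sup>2) * (?d x)\<^sup>2" by (intro mult_right_mono) auto
      have "0 \<le> (1/2) * (\<phi> x + 2 * (x $ 1 * ?d x))\<^sup>2" by simp
      then show ?thesis using * by (simp add: power2_eq_square algebra_simps)
    next
      case False
      then show ?thesis using test_functions_eq_0[OF \<phi>] by simp
    qed
  qed
  also have "\<dots> = (1/2) * (LINT x|lborel. (\<phi> x)\<^sup>2) + (2 * R\<^sup>2) * (LINT x|lborel. (?d x)\<^sup>2)"
    using int by simp
  finally show ?thesis by simp
qed

section \<open>Square integrable functions\<close>

lemma nonneg_quadratic_imp_discriminant:
  fixes a b c :: real
  assumes "\<And>s. 0 \<le> a + 2 * s * b + s\<^sup>2 * c" and "0 \<le> c"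
  shows "b\<^sup>2 \<le> a * c"
proof (cases "c = 0")
  case True
  have "b = 0"
  proof (rule ccontr)
    assume "b \<noteq> 0"
    then have "2 * (- (a + 1) / (2 * b)) * b = - (a + 1)" by simp
    then show False using assms(1)[of "- (a + 1) / (2 * b)"] True by simp
  qed
  then show ?thesis using assms(1)[of 0] True by simp
next
  case False
  then show ?thesis using assms(1)[of "- b / c"] assms(2)
    by (simp add: power2_eq_square field_simps)
qed

locale bounded_domain =
  fixes \<Omega> :: "(real^2) set"
  assumes open_domain: "open \<Omega>" and bounded_domain: "bounded \<Omega>"
begin

abbreviation M :: "(real^2) measure" where "M \<equiv> lebesgue_on \<Omega>"

lemma domain_measurable [measurable, simp]: "\<Omega> \<in> sets lebesgue"
  using open_domain borel_open by (auto simp: sets_completionI_sets)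

lemma domain_lmeasurable: "\<Omega> \<in> lmeasurable"
  using open_domain bounded_domain lmeasurable_open by blast

lemma finite_measure_domain: "finite_measure M"
  using domain_lmeasurable by (intro finite_measureI)
    (auto simp: space_restrict_space emeasure_restrict_space fmeasurable_def)

sublocale finite_measure M by (rule finite_measure_domain)

lemma L2_D:
  assumes "f \<in> L2 \<Omega>"
  shows "f \<in> borel_measurable M" "integrable M (\<lambda>x. (norm (f x))\<^sup>2)"
  using assms by (auto simp: L2_def)

lemma L2_inner_integrable:
  assumes "f \<in> L2 \<Omega>" "g \<in> L2 \<Omega>"
  shows "integrable M (\<lambda>x. f x \<bullet> g x)"
proof (rule Bochner_Integration.integrable_bound)
  show "integrable M (\<lambda>x. (norm (f x))\<^sup>2 + (norm (g x))\<^sup>2)"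
    by (intro Bochner_Integration.integrable_add L2_D(2)[OF assms(1)] L2_D(2)[OF assms(2)])
  show "(\<lambda>x. f x \<bullet> g x) \<in> borel_measurable M"
    by (intro borel_measurable_inner L2_D(1)[OF assms(1)] L2_D(1)[OF assms(2)])
  have "\<bar>a \<bullet> b\<bar> \<le> (norm a)\<^sup>2 + (norm b)\<^sup>2" for a b :: 'a
  proof -
    have "\<bar>a \<bullet> b\<bar> \<le> norm a * norm b" by (rule Cauchy_Schwarz_ineq2)
    moreover have "2 * (norm a * norm b) \<le> (norm a)\<^sup>2 + (norm b)\<^sup>2"
      using sum_squares_bound[of "norm a" "norm b"] by (simp add: mult.assoc)
    moreover have "0 \<le> norm a * norm b" by simp
    ultimately show ?thesis by linarith
  qed
  then show "AE x in M. norm (f x \<bullet> g x) \<le> norm ((norm (f x))\<^sup>2 + (norm (g x))\<^sup>2)" by simp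
qed

lemma L2_indicator_inner_integrable:
  assumes "f \<in> L2 \<Omega>" "g \<in> L2 \<Omega>" "E \<in> sets lebesgue"
  shows "integrable M (\<lambda>x. indicator E x * (f x \<bullet> g x))"
proof -
  have "E \<inter> \<Omega> \<in> sets M" using assms(3) by (auto simp: sets_restrict_space)
  from integrable_mult_indicator[OF this L2_inner_integrable[OF assms(1,2)]]
  have "integrable M (\<lambda>x. indicator (E \<inter> \<Omega>) x *\<^sub>R (f x \<bullet> g x))" .
  then show ?thesis
    by (rule Bochner_Integration.integrable_cong[THEN iffD1, rotated 2])
      (auto simp: space_restrict_space indicator_def)
qed

lemma norm_lincomb_sq_le:
  fixes u v :: "'b::real_inner"
  shows "(norm (a *\<^sub>R u + b *\<^sub>R v))\<^sup>2 \<le> 2 * a\<^sup>2 * (norm u)\<^sup>2 + 2 * b\<^sup>2 * (norm v)\<^sup>2"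
proof -
  have "0 \<le> (norm (a *\<^sub>R u - b *\<^sub>R v))\<^sup>2" by simp
  then show ?thesis
    unfolding power2_norm_eq_inner
    by (simp add: inner_add_left inner_add_right inner_diff_left inner_diff_right
        inner_commute power2_eq_square algebra_simps)
qed

lemma L2_lincomb:
  assumes "f \<in> L2 \<Omega>" "g \<in> L2 \<Omega>"
  shows "(\<lambda>x. a *\<^sub>R f x + b *\<^sub>R g x) \<in> L2 \<Omega>"
    and "(LINT x|M. (norm (a *\<^sub>R f x + b *\<^sub>R g x))\<^sup>2)
      \<le> 2 * a\<^sup>2 * (LINT x|M. (norm (f x))\<^sup>2) + 2 * b\<^sup>2 * (LINT x|M. (norm (g x))\<^sup>2)"
proof -
  have m: "(\<lambda>x. a *\<^sub>R f x + b *\<^sub>R g x) \<in> borel_measurable M"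
    by (intro borel_measurable_add borel_measurable_scaleR borel_measurable_const
        L2_D(1)[OF assms(1)] L2_D(1)[OF assms(2)])
  have I: "integrable M (\<lambda>x. 2 * a\<^sup>2 * (norm (f x))\<^sup>2 + 2 * b\<^sup>2 * (norm (g x))\<^sup>2)"
    using L2_D(2)[OF assms(1)] L2_D(2)[OF assms(2)] by simp
  have J: "integrable M (\<lambda>x. (norm (a *\<^sub>R f x + b *\<^sub>R g x))\<^sup>2)"
    by (rule Bochner_Integration.integrable_bound[OF I]) (use m in \<open>auto simp: norm_lincomb_sq_le\<close>)
  then show "(\<lambda>x. a *\<^sub>R f x + b *\<^sub>R g x) \<in> L2 \<Omega>" using m by (simp add: L2_def)
  have "(LINT x|M. (norm (a *\<^sub>R f x + b *\<^sub>R g x))\<^sup>2)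
      \<le> (LINT x|M. 2 * a\<^sup>2 * (norm (f x))\<^sup>2 + 2 * b\<^sup>2 * (norm (g x))\<^sup>2)"
    by (rule integral_mono[OF J I]) (rule norm_lincomb_sq_le)
  also have "\<dots> = 2 * a\<^sup>2 * (LINT x|M. (norm (f x))\<^sup>2) + 2 * b\<^sup>2 * (LINT x|M. (norm (g x))\<^sup>2)"
    using L2_D(2)[OF assms(1)] L2_D(2)[OF assms(2)] by simp
  finally show "(LINT x|M. (norm (a *\<^sub>R f x + b *\<^sub>R g x))\<^sup>2)
      \<le> 2 * a\<^sup>2 * (LINT x|M. (norm (f x))\<^sup>2) + 2 * b\<^sup>2 * (LINT x|M. (norm (g x))\<^sup>2)" .
qed

lemma L2_diff:
  assumes "f \<in> L2 \<Omega>" "g \<in> L2 \<Omega>"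
  shows "(\<lambda>x. f x - g x) \<in> L2 \<Omega>"
    and "(LINT x|M. (norm (f x - g x))\<^sup>2) \<le> 2 * (LINT x|M. (norm (f x))\<^sup>2) + 2 * (LINT x|M. (norm (g x))\<^sup>2)"
  using L2_lincomb[OF assms, of 1 "-1"] by auto

lemma L2_scale: "f \<in> L2 \<Omega> \<Longrightarrow> (\<lambda>x. a *\<^sub>R f x) \<in> L2 \<Omega>"
  using L2_lincomb(1)[of f f a 0] by simp

lemma L2_Cauchy_Schwarz:
  assumes "f \<in> L2 \<Omega>" "g \<in> L2 \<Omega>"
  shows "(LINT x|M. f x \<bullet> g x)\<^sup>2 \<le> (LINT x|M. (norm (f x))\<^sup>2) * (LINT x|M. (norm (g x))\<^sup>2)"
proof (rule nonneg_quadratic_imp_discriminant)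
  fix s :: real
  note [simp] = L2_inner_integrable[OF assms] L2_D(2)[OF assms(1)] L2_D(2)[OF assms(2)]
  have "0 \<le> (LINT x|M. (norm (f x + s *\<^sub>R g x))\<^sup>2)" by simp
  also have "\<dots> = (LINT x|M. (norm (f x))\<^sup>2 + (2 * s * (f x \<bullet> g x) + s\<^sup>2 * (norm (g x))\<^sup>2))"
    unfolding power2_norm_eq_inner
    by (intro Bochner_Integration.integral_cong)
      (auto simp: inner_add_left inner_add_right inner_commute power2_eq_square algebra_simps)
  also have "\<dots> = (LINT x|M. (norm (f x))\<^sup>2) + 2 * s * (LINT x|M. f x \<bullet> g x) + s\<^sup>2 * (LINT x|M. (norm (g x))\<^sup>2)"
    by simp
  finally show "0 \<le> (LINT x|M. (norm (f x))\<^sup>2) + 2 * s * (LINT x|M. f x \<bullet> g x) + s\<^sup>2 * (LINT x|M. (norm (g x))\<^sup>2)" .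
qed simp

lemma L2_const: "(\<lambda>x. c) \<in> L2 \<Omega>"
  by (simp add: L2_def)

lemma L2_norm: "f \<in> L2 \<Omega> \<Longrightarrow> (\<lambda>x. norm (f x)) \<in> L2 \<Omega>"
  by (auto simp: L2_def intro: borel_measurable_norm)

lemma L2_integrable:
  assumes "f \<in> L2 \<Omega>" shows "integrable M f"
  using L2_inner_integrable[OF L2_norm[OF assms] L2_const[of 1]] L2_D(1)[OF assms]
  by (simp add: integrable_norm_iff)

lemma integral_norm_le:
  assumes "f \<in> L2 \<Omega>"
  shows "(LINT x|M. norm (f x))\<^sup>2 \<le> (LINT x|M. (norm (f x))\<^sup>2) * measure M \<Omega>"
  using L2_Cauchy_Schwarz[OF L2_norm[OF assms] L2_const[of 1]]
  by (simp add: space_restrict_space)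

text \<open>On a set of finite measure, Cauchy sequences in \<open>L\<^sup>2\<close> are Cauchy in \<open>L\<^sup>1\<close> by the
  Cauchy-Schwarz inequality, and a subsequence converges almost everywhere. Its limit is the limit in
  \<open>L\<^sup>2\<close> by Fatou's lemma.\<close>

lemma L2_complete:
  fixes f :: "nat \<Rightarrow> real^2 \<Rightarrow> 'b::euclidean_space"
  assumes f: "\<And>n. f n \<in> L2 \<Omega>"
    and cauchy: "\<And>e. e > 0 \<Longrightarrow> \<exists>N. \<forall>i\<ge>N. \<forall>j\<ge>N. (LINT x|M. (norm (f i x - f j x))\<^sup>2) < e"
  obtains g where "g \<in> L2 \<Omega>" "(\<lambda>n. LINT x|M. (norm (f n x - g x))\<^sup>2) \<longlonglongrightarrow> 0"
proof -
  have L1: "\<exists>N. \<forall>i\<ge>N. \<forall>j\<ge>N. (LINT x|M. norm (f i x - f j x)) < e" if e: "e > 0" for e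
  proof -
    have pos: "e\<^sup>2 / (measure M \<Omega> + 1) > 0" using e by (simp add: add_nonneg_pos)
    obtain N where N: "\<forall>i\<ge>N. \<forall>j\<ge>N. (LINT x|M. (norm (f i x - f j x))\<^sup>2) < e\<^sup>2 / (measure M \<Omega> + 1)"
      using cauchy[OF pos] by blast
    have "(LINT x|M. norm (f i x - f j x)) < e" if ij: "i \<ge> N" "j \<ge> N" for i j
    proof -
      have "(LINT x|M. norm (f i x - f j x))\<^sup>2 \<le> (LINT x|M. (norm (f i x - f j x))\<^sup>2) * measure M \<Omega>"
        using integral_norm_le[OF L2_diff(1)[OF f f]] .
      also have "\<dots> \<le> (LINT x|M. (norm (f i x - f j x))\<^sup>2) * (measure M \<Omega> + 1)"
        by (intro mult_left_mono) auto
      also have "\<dots> < e\<^sup>2"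
        using N ij by (simp add: pos_less_divide_eq add_nonneg_pos)
      finally show ?thesis by (rule power_less_imp_less_base) (use e in simp)
    qed
    then show ?thesis by blast
  qed
  obtain r where r: "strict_mono r" "AE x in M. Cauchy (\<lambda>i. f (r i) x)"
    by (rule cauchy_L1_AE_cauchy_subseq[of M f, OF L2_integrable[OF f] L1])
  define g where "g x = lim (\<lambda>i. f (r i) x)" for x
  have meas [measurable]: "f n \<in> borel_measurable M" for n using L2_D(1)[OF f] .
  have gm [measurable]: "g \<in> borel_measurable M"
    unfolding g_def by (rule borel_measurable_lim_metric) simp
  have lim: "AE x in M. (\<lambda>i. f (r i) x) \<longlonglongrightarrow> g x"
    using r(2) unfolding g_def by eventually_elim (simp add: Cauchy_convergent_iff convergent_LIMSEQ_iff)
  have le: "integrable M (\<lambda>x. (norm (f n x - g x))\<^sup>2) \<and> (LINT x|M. (norm (f n x - g x))\<^sup>2) \<le> e"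
    if e: "e > 0" and n: "\<And>i. i \<ge> N \<Longrightarrow> (LINT x|M. (norm (f n x - f i x))\<^sup>2) < e" for e n N
  proof -
    have "(\<integral>\<^sup>+x. ennreal ((norm (f n x - g x))\<^sup>2) \<partial>M)
        = (\<integral>\<^sup>+x. liminf (\<lambda>i. ennreal ((norm (f n x - f (r i) x))\<^sup>2)) \<partial>M)"
    proof (rule nn_integral_cong_AE)
      show "AE x in M. ennreal ((norm (f n x - g x))\<^sup>2) = liminf (\<lambda>i. ennreal ((norm (f n x - f (r i) x))\<^sup>2))"
        using lim
      proof eventually_elim
        case (elim x)
        then have "(\<lambda>i. ennreal ((norm (f n x - f (r i) x))\<^sup>2)) \<longlonglongrightarrow> ennreal ((norm (f n x - g x))\<^sup>2)"
          by (intro tendsto_intros) auto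
        then show ?case using lim_imp_Liminf[OF trivial_limit_sequentially] by metis
      qed
    qed
    also have "\<dots> \<le> liminf (\<lambda>i. \<integral>\<^sup>+x. ennreal ((norm (f n x - f (r i) x))\<^sup>2) \<partial>M)"
      by (rule nn_integral_liminf) simp
    also have "\<dots> \<le> liminf (\<lambda>i::nat. ennreal e)"
    proof (rule Liminf_mono)
      have "(\<integral>\<^sup>+x. ennreal ((norm (f n x - f (r i) x))\<^sup>2) \<partial>M) \<le> ennreal e" if "i \<ge> N" for i
        using n[of "r i"] that seq_suble[OF r(1), of i] L2_D(2)[OF L2_diff(1)[OF f f]]
        by (subst nn_integral_eq_integral) (auto intro: ennreal_leI)
      then show "\<forall>\<^sub>F i in sequentially. (\<integral>\<^sup>+x. ennreal ((norm (f n x - f (r i) x))\<^sup>2) \<partial>M) \<le> ennreal e"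
        using eventually_sequentially by blast
    qed
    also have "\<dots> = ennreal e" by (simp add: Liminf_const)
    finally have *: "(\<integral>\<^sup>+x. ennreal ((norm (f n x - g x))\<^sup>2) \<partial>M) \<le> ennreal e" .
    have "integrable M (\<lambda>x. (norm (f n x - g x))\<^sup>2)"
      by (rule integrableI_bounded) (use * in \<open>auto simp: top.not_eq_extremum intro: le_less_trans\<close>)
    moreover from this * have "(LINT x|M. (norm (f n x - g x))\<^sup>2) \<le> e"
      using e by (subst (asm) nn_integral_eq_integral) auto
    ultimately show ?thesis ..
  qed
  have "(\<lambda>x. f n x - g x) \<in> L2 \<Omega>" if "integrable M (\<lambda>x. (norm (f n x - g x))\<^sup>2)" for n
    using that by (simp add: L2_def)
  moreover obtain N where "\<forall>i\<ge>N. \<forall>j\<ge>N. (LINT x|M. (norm (f i x - f j x))\<^sup>2) < 1"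
    using cauchy[of 1] by auto
  ultimately have "(\<lambda>x. f N x - g x) \<in> L2 \<Omega>" using le[of 1 N N] by simp
  from L2_diff(1)[OF f[of N] this] have "g \<in> L2 \<Omega>" by simp
  moreover have "(\<lambda>n. LINT x|M. (norm (f n x - g x))\<^sup>2) \<longlonglongrightarrow> 0"
  proof (rule LIMSEQ_I)
    fix e :: real assume "e > 0"
    then obtain N where N: "\<forall>i\<ge>N. \<forall>j\<ge>N. (LINT x|M. (norm (f i x - f j x))\<^sup>2) < e / 2"
      using cauchy[of "e/2"] by auto
    have "norm ((LINT x|M. (norm (f n x - g x))\<^sup>2) - 0) < e" if "n \<ge> N" for n
      using le[of "e/2" N n] N that \<open>e > 0\<close> by force
    then show "\<exists>N. \<forall>n\<ge>N. norm ((LINT x|M. (norm (f n x - g x))\<^sup>2) - 0) < e" by blast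
  qed
  ultimately show ?thesis using that by blast
qed

lemma L2_AE_eq_0:
  assumes "f \<in> L2 \<Omega>" "(LINT x|M. (norm (f x))\<^sup>2) = 0"
  shows "AE x in M. f x = 0"
  using assms L2_D(2)[OF assms(1)] by (subst (asm) integral_nonneg_eq_0_iff_AE) auto

lemma integral_continuous_domain:
  fixes f :: "real^2 \<Rightarrow> real"
  assumes "f \<in> borel_measurable borel" "\<And>x. x \<notin> \<Omega> \<Longrightarrow> f x = 0"
  shows "(LINT x|M. f x) = (LINT x|lborel. f x)" "integrable M f \<longleftrightarrow> integrable lborel f"
proof -
  have eq: "(\<lambda>x. indicator \<Omega> x *\<^sub>R f x) = f"
    using assms(2) by (auto simp: indicator_def fun_eq_iff)
  have "f \<in> borel_measurable lborel" using assms(1) by simp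
  then show "(LINT x|M. f x) = (LINT x|lborel. f x)" "integrable M f \<longleftrightarrow> integrable lborel f"
    by (simp_all add: integral_restrict_space integrable_restrict_space eq[simplified] integral_completion integrable_completion)
qed

text \<open>Test functions vanish off the domain. So such integrals may be taken over the whole plane,
  where translations act.\<close>

lemma integral_mult_test_function:
  assumes "continuous_on UNIV f" "\<phi> \<in> test_functions \<Omega>"
  shows "(LINT x|M. f x * \<phi> x) = (LINT x|lborel. f x * \<phi> x)" "integrable M (\<lambda>x. f x * \<phi> x)"
proof -
  have m: "(\<lambda>x. f x * \<phi> x) \<in> borel_measurable borel"
    using assms continuous_test_function by (auto intro!: borel_measurable_continuous_onI continuous_intros)
  show "(LINT x|M. f x * \<phi> x) = (LINT x|lborel. f x * \<phi> x)"
    using test_functions_eq_0[OF assms(2)] by (intro integral_continuous_domain m) auto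
  show "integrable M (\<lambda>x. f x * \<phi> x)"
    using integrable_continuous_mult_test_function[OF assms] integral_continuous_domain(2)[OF m]
      test_functions_eq_0[OF assms(2)] by auto
qed

lemma L2_test_function:
  assumes "\<phi> \<in> test_functions \<Omega>" shows "\<phi> \<in> L2 \<Omega>"
proof -
  have "continuous_on UNIV \<phi>" using assms continuous_test_function by blast
  then show ?thesis
    using integral_mult_test_function(2)[of \<phi> \<phi>] assms
    by (auto simp: L2_def power2_eq_square[symmetric] intro!: measurable_restrict_space1 measurable_completion
        borel_measurable_continuous_onI)
qed

lemma box_indicator_approximation:
  assumes "\<And>i. a $ i < b $ i" "cbox a b \<subseteq> \<Omega>"
  obtains \<phi> where "\<And>n. \<phi> n \<in> test_functions \<Omega>" "\<And>n x. \<bar>\<phi> n x\<bar> \<le> 1"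
    "\<And>x. (\<lambda>n. \<phi> n x) \<longlonglongrightarrow> indicator (box a b) x"
proof -
  let ?s = "\<lambda>n i x. step (real n * (x $ i - a $ i)) * step (real n * (b $ i - x $ i))"
  define \<phi> where "\<phi> n x = ?s n 1 x * ?s n 2 x" for n :: nat and x :: "real^2"
  have s01: "0 \<le> ?s n i x" "?s n i x \<le> 1" for n i x
    using mult_mono[OF step_le_1 step_le_1] by (auto simp: step_nonneg)
  have lim: "(\<lambda>n. ?s n i x) \<longlonglongrightarrow> (if a $ i < x $ i \<and> x $ i < b $ i then 1 else 0)" for i x
  proof (cases "a $ i < x $ i \<and> x $ i < b $ i")
    case True
    have "eventually (\<lambda>n. step (real n * c) = 1) sequentially" if "c > 0" for c
    proof -
      obtain N where "1 / c < real N" using reals_Archimedean2 by blast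
      then have N: "1 < real N * c" using that by (simp add: pos_divide_less_eq)
      have "1 \<le> real n * c" if "n \<ge> N" for n
        using N mult_right_mono[of "real N" "real n" c] that \<open>c > 0\<close> by linarith
      then show ?thesis using eventually_sequentially step_eq_1 by blast
    qed
    then have "eventually (\<lambda>n. ?s n i x = 1) sequentially"
      using eventually_conj[of "\<lambda>n. step (real n * (x $ i - a $ i)) = 1" sequentially
          "\<lambda>n. step (real n * (b $ i - x $ i)) = 1"] True by (auto elim!: eventually_mono)
    then show ?thesis using True by (simp add: tendsto_eventually)
  next
    case False
    have "step (real n * c) = 0" if "c \<le> 0" for c n
      using that by (simp add: mult_nonneg_nonpos)
    then have "?s n i x = 0" for n using False by (auto simp: not_less)
    then have "(\<lambda>n. ?s n i x) = (\<lambda>n. 0)" by blast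
    then show ?thesis using False by (simp only: if_False tendsto_const)
  qed
  have zero: "\<phi> n x = 0" if x: "x \<notin> cbox a b" for n x
  proof -
    obtain i where "x $ i < a $ i \<or> b $ i < x $ i"
      using x by (auto simp: mem_box_cart not_le)
    then have "?s n i x = 0" by (auto simp: mult_nonneg_nonpos)
    then show ?thesis using exhaust_2[of i] unfolding \<phi>_def by auto
  qed
  show ?thesis
  proof
    show "\<phi> n \<in> test_functions \<Omega>" for n
    proof (rule test_functionsI[where K="cbox a b"])
      show "smooth_on (\<phi> n) UNIV" unfolding \<phi>_def[abs_def]
        by (intro smooth_on_mult smooth_on_step smooth_on_diff smooth_on_const smooth_on_component open_UNIV)
    qed (use zero assms(2) in auto)
    show "\<bar>\<phi> n x\<bar> \<le> 1" for n x
      unfolding \<phi>_def using s01[where n=n and x=x and i=1] s01[where n=n and x=x and i=2] mult_mono[of "?s n 1 x" 1 "?s n 2 x" 1] by simp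
    have "(\<lambda>n. \<phi> n x) \<longlonglongrightarrow> (if a $ 1 < x $ 1 \<and> x $ 1 < b $ 1 then 1 else 0) * (if a $ 2 < x $ 2 \<and> x $ 2 < b $ 2 then 1 else 0)" for x
      unfolding \<phi>_def by (intro tendsto_mult[OF lim lim])
    moreover have "(if a $ 1 < x $ 1 \<and> x $ 1 < b $ 1 then 1 else 0) * (if a $ 2 < x $ 2 \<and> x $ 2 < b $ 2 then 1 else 0)
        = indicat_real (box a b) x" for x
      by (auto simp: indicator_def mem_box_cart forall_2)
    ultimately show "(\<lambda>n. \<phi> n x) \<longlonglongrightarrow> indicator (box a b) x" for x by metis
  qed
qed

text \<open>The fundamental lemma of the calculus of variations. The integral over every box contained
  in the domain vanishes, and by Lebesgue's differentiation theorem so does the function, almost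
  everywhere.\<close>

lemma AE_eq_0_if_orthogonal_to_test_functions:
  fixes g :: "real^2 \<Rightarrow> real"
  assumes g: "integrable M g" and orth: "\<And>\<phi>. \<phi> \<in> test_functions \<Omega> \<Longrightarrow> (LINT x|M. g x * \<phi> x) = 0"
  shows "AE x in M. g x = 0"
proof -
  define f where "f x = (if x \<in> \<Omega> then g x else 0)" for x
  have f: "integrable lebesgue f" unfolding f_def by (simp add: Lebesgue_Measure.integrable_restrict_UNIV g)
  have box0: "integral (cbox a b) f = 0" if ab: "\<And>i. a $ i < b $ i" "cbox a b \<subseteq> \<Omega>" for a b
  proof -
    obtain \<phi> where \<phi>: "\<And>n. \<phi> n \<in> test_functions \<Omega>" "\<And>n x. \<bar>\<phi> n x\<bar> \<le> 1"
      "\<And>x. (\<lambda>n. \<phi> n x) \<longlonglongrightarrow> indicator (box a b) x"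
      using box_indicator_approximation[of a b] ab by blast
    have gm: "g \<in> borel_measurable M" using g by auto
    have "(\<lambda>n. LINT x|M. g x * \<phi> n x) \<longlonglongrightarrow> (LINT x|M. g x * indicator (box a b) x)"
    proof (rule integral_dominated_convergence)
      show "integrable M (\<lambda>x. norm (g x))" using g by simp
      have "indicat_real (box a b) \<in> borel_measurable M"
        by (intro measurable_restrict_space1 measurable_completion) auto
      then show "(\<lambda>x. g x * indicator (box a b) x) \<in> borel_measurable M" using gm by simp
      have "\<phi> n \<in> borel_measurable M" for n using L2_D(1)[OF L2_test_function[OF \<phi>(1)]] .
      then show "(\<lambda>x. g x * \<phi> n x) \<in> borel_measurable M" for n using gm by simp
      show "AE x in M. (\<lambda>n. g x * \<phi> n x) \<longlonglongrightarrow> g x * indicator (box a b) x"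
        using \<phi>(3) by (auto intro!: tendsto_mult)
      show "AE x in M. norm (g x * \<phi> n x) \<le> norm (g x)" for n
        using \<phi>(2) by (auto simp: abs_mult mult_left_le)
    qed
    then have 0: "(LINT x|M. g x * indicator (box a b) x) = 0"
      using orth[OF \<phi>(1)] LIMSEQ_unique by (simp add: LIMSEQ_const_iff)
    have "box a b \<subseteq> \<Omega>" using ab(2) box_subset_cbox by blast
    then have eq: "(\<lambda>x. if x \<in> \<Omega> then g x * indicator (box a b) x else 0) = (\<lambda>x. if x \<in> box a b then f x else 0)"
      by (auto simp: f_def indicator_def)
    have "(LINT x|lebesgue. (if x \<in> box a b then f x else 0)) = (LINT x|M. g x * indicator (box a b) x)"
      by (subst eq[symmetric]) (simp add: Lebesgue_Measure.integral_restrict_UNIV)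
    moreover have "(LINT x|lebesgue. (if x \<in> box a b then f x else 0)) = (LINT x|lebesgue_on (box a b). f x)"
      by (simp add: Lebesgue_Measure.integral_restrict_UNIV)
    moreover have "integrable (lebesgue_on (box a b)) f"
      using integrable_mult_indicator[OF _ f, of "box a b"] by (simp add: integrable_restrict_space)
    then have "(f has_integral (LINT x|lebesgue_on (box a b). f x)) (box a b)"
      by (intro has_integral_integral_lebesgue_on) auto
    ultimately show ?thesis using 0 integral_open_interval[of a b f] by (simp add: integral_unique)
  qed
  have "f integrable_on cbox a b" for a b
  proof -
    have "f integrable_on UNIV"
      using f integrable_on_lebesgue_on[of UNIV f] by (simp add: lebesgue_on_UNIV_eq)
    then show ?thesis using integrable_on_subcbox by blast
  qed
  then obtain N where N: "negligible N" "\<And>x e. \<lbrakk>x \<notin> N; 0 < e\<rbrakk> \<Longrightarrow>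
      \<exists>d>0. \<forall>h. 0 < h \<and> h < d \<longrightarrow> norm (integral (cbox x (x + h *\<^sub>R One)) f /\<^sub>R h ^ DIM(real^2) - f x) < e"
    using integrable_ccontinuous_explicit[of f] by metis
  have "f x = 0" if x: "x \<in> \<Omega>" "x \<notin> N" for x
  proof (rule ccontr)
    assume "f x \<noteq> 0"
    then obtain d where d: "d > 0" "\<And>h. 0 < h \<Longrightarrow> h < d \<Longrightarrow>
        norm (integral (cbox x (x + h *\<^sub>R One)) f /\<^sub>R h ^ DIM(real^2) - f x) < norm (f x)"
      using N(2)[OF x(2), of "norm (f x)"] by auto
    obtain r where r: "r > 0" "cball x r \<subseteq> \<Omega>" using open_domain x(1) open_contains_cball by blast
    define h where "h = min (d / 2) (r / 2)"
    have h: "h > 0" "h < d" "2 * h \<le> r" using d r by (auto simp: h_def)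
    have "(One :: real^2) $ i = 1" for i
      using const_vector_cart[of 1, where 'n=2] by (simp add: vec_eq_iff)
    then have One: "(\<Sum>b\<in>Basis. (b :: real^2) $ i) = 1" for i by simp
    have "cbox x (x + h *\<^sub>R One) \<subseteq> cball x r"
    proof
      fix y assume y: "y \<in> cbox x (x + h *\<^sub>R One)"
      have "norm (y - x) \<le> (\<Sum>i\<in>UNIV. \<bar>(y - x) $ i\<bar>)" by (rule norm_le_l1_cart)
      also have "\<dots> \<le> (\<Sum>i\<in>(UNIV::2 set). h)"
        using y by (intro sum_mono) (auto simp: mem_box_cart One algebra_simps)
      also have "\<dots> \<le> r" using h by simp
      finally show "y \<in> cball x r" by (simp add: dist_norm norm_minus_commute)
    qed
    then have "integral (cbox x (x + h *\<^sub>R One)) f = 0"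
      using r(2) h(1) by (intro box0) (auto simp: One)
    then show False using d(2)[of h] h by simp
  qed
  then have "{x \<in> space lebesgue. \<not> (x \<in> \<Omega> \<longrightarrow> g x = 0)} \<subseteq> N" by (auto simp: f_def)
  moreover have "N \<in> null_sets lebesgue" using N(1) negligible_iff_null_sets by blast
  ultimately show ?thesis
    by (subst AE_restrict_space_iff) (auto intro: AE_I')
qed

end

section \<open>Symmetric operators on spaces of functions\<close>

text \<open>A constant, rather than its defining term, so that simplification treats a linear combination
  of functions as a single vector.\<close>

definition lincomb :: "real \<Rightarrow> ('a \<Rightarrow> real) \<Rightarrow> real \<Rightarrow> ('a \<Rightarrow> real) \<Rightarrow> 'a \<Rightarrow> real" where
  "lincomb a u b v = (\<lambda>x. a * u x + b * v x)"

text \<open>A complete space with respect to a symmetric positive semidefinite form. Working with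
  representatives, functions at distance zero are not identified.\<close>

locale semi_hilbert =
  fixes V :: "('a \<Rightarrow> real) set" and ip :: "('a \<Rightarrow> real) \<Rightarrow> ('a \<Rightarrow> real) \<Rightarrow> real"
  assumes V_ne: "V \<noteq> {}"
    and V_lincomb: "u \<in> V \<Longrightarrow> v \<in> V \<Longrightarrow> lincomb a u b v \<in> V"
    and ip_sym: "u \<in> V \<Longrightarrow> v \<in> V \<Longrightarrow> ip u v = ip v u"
    and ip_lin: "u \<in> V \<Longrightarrow> v \<in> V \<Longrightarrow> w \<in> V \<Longrightarrow> ip (lincomb a u b v) w = a * ip u w + b * ip v w"
    and ip_nonneg: "u \<in> V \<Longrightarrow> 0 \<le> ip u u"
    and ip_complete: "(\<And>n. f n \<in> V) \<Longrightarrow>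
      (\<And>e. e > 0 \<Longrightarrow> \<exists>N. \<forall>i\<ge>N. \<forall>j\<ge>N. ip (lincomb 1 (f i) (-1) (f j)) (lincomb 1 (f i) (-1) (f j)) < e) \<Longrightarrow>
      \<exists>g\<in>V. (\<lambda>n. ip (lincomb 1 (f n) (-1) g) (lincomb 1 (f n) (-1) g)) \<longlonglongrightarrow> 0"
begin

definition sym_form :: "(('a \<Rightarrow> real) \<Rightarrow> ('a \<Rightarrow> real) \<Rightarrow> real) \<Rightarrow> bool" where
  "sym_form b \<longleftrightarrow> (\<forall>u\<in>V. \<forall>v\<in>V. b u v = b v u) \<and>
     (\<forall>u\<in>V. \<forall>v\<in>V. \<forall>w\<in>V. \<forall>r s. b (lincomb r u s v) w = r * b u w + s * b v w)"

lemma sym_form_sym: "sym_form b \<Longrightarrow> u \<in> V \<Longrightarrow> v \<in> V \<Longrightarrow> b u v = b v u"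
  and sym_form_left: "sym_form b \<Longrightarrow> u \<in> V \<Longrightarrow> v \<in> V \<Longrightarrow> w \<in> V \<Longrightarrow>
    b (lincomb r u s v) w = r * b u w + s * b v w"
  by (auto simp: sym_form_def)

lemma sym_form_right:
  assumes "sym_form b" "u \<in> V" "v \<in> V" "w \<in> V"
  shows "b w (lincomb r u s v) = r * b w u + s * b w v"
proof -
  have "b w (lincomb r u s v) = b (lincomb r u s v) w"
    using sym_form_sym[OF assms(1) assms(4) V_lincomb[OF assms(2,3)]] .
  then show ?thesis using assms sym_form_left[OF assms] sym_form_sym[OF assms(1)] by metis
qed

lemma sym_form_ip: "sym_form ip"
  by (auto simp: sym_form_def ip_sym ip_lin)

lemma sym_form_square:
  assumes "sym_form b" "u \<in> V" "v \<in> V"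
  shows "b (lincomb r u s v) (lincomb r u s v) = r\<^sup>2 * b u u + 2 * r * s * b u v + s\<^sup>2 * b v v"
  using assms sym_form_left[OF assms(1,2,3)] sym_form_right[OF assms(1,2,3)] V_lincomb[OF assms(2,3)]
    sym_form_sym[OF assms]
  by (simp add: power2_eq_square algebra_simps)

lemma sym_form_Cauchy_Schwarz:
  assumes b: "sym_form b" and pos: "\<And>u. u \<in> V \<Longrightarrow> 0 \<le> b u u" and uv: "u \<in> V" "v \<in> V"
  shows "(b u v)\<^sup>2 \<le> b u u * b v v"
proof (rule nonneg_quadratic_imp_discriminant)
  show "0 \<le> b u u + 2 * s * b u v + s\<^sup>2 * b v v" for s
    using pos[OF V_lincomb[OF uv, of 1 s]] sym_form_square[OF b uv, of 1 s] by simp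
qed (use pos uv in auto)

lemma ip_lincomb_le:
  assumes "u \<in> V" "v \<in> V"
  shows "ip (lincomb r u s v) (lincomb r u s v) \<le> 2 * r\<^sup>2 * ip u u + 2 * s\<^sup>2 * ip v v"
  using ip_nonneg[OF V_lincomb[OF assms, of r "- s"]] sym_form_square[OF sym_form_ip assms, of r s]
    sym_form_square[OF sym_form_ip assms, of r "- s"] by (simp add: algebra_simps)

text \<open>The theorem of Lax and Milgram for symmetric forms: the solution minimises
  \<open>b v v - 2 F v\<close>, and minimising sequences are Cauchy by the parallelogram identity.\<close>

lemma lax_milgram:
  assumes b: "sym_form b" and m: "m > 0"
    and coercive: "\<And>u. u \<in> V \<Longrightarrow> m * ip u u \<le> b u u"
    and bounded: "\<And>u. u \<in> V \<Longrightarrow> b u u \<le> B * ip u u"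
    and F_lin: "\<And>u v r s. u \<in> V \<Longrightarrow> v \<in> V \<Longrightarrow> F (lincomb r u s v) = r * F u + s * F v"
    and F_bounded: "\<And>u. u \<in> V \<Longrightarrow> (F u)\<^sup>2 \<le> K * ip u u"
  shows "\<exists>w\<in>V. \<forall>v\<in>V. b w v = F v"
proof -
  define J where "J v = b v v - 2 * F v" for v
  have pos: "0 \<le> b u u" if "u \<in> V" for u
    using coercive[OF that] m ip_nonneg[OF that] by (meson dual_order.trans mult_nonneg_nonneg less_imp_le)
  have J_ge: "- (\<bar>K\<bar> / m) \<le> J v" if v: "v \<in> V" for v
  proof -
    have "2 * F v * m \<le> \<bar>K\<bar> + m\<^sup>2 * ip v v"
    proof (cases "ip v v = 0")
      case True
      then have "F v = 0" using F_bounded[OF v] by simp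
      then show ?thesis using True by simp
    next
      case False
      then have p: "ip v v > 0" using ip_nonneg[OF v] by simp
      have "(F v)\<^sup>2 \<le> \<bar>K\<bar> * ip v v" using F_bounded[OF v] p by (smt (verit) mult_right_mono)
      then have "(F v)\<^sup>2 / ip v v \<le> \<bar>K\<bar>" using p by (simp add: pos_divide_le_eq)
      moreover have "0 \<le> (F v - m * ip v v)\<^sup>2 / ip v v" using p by simp
      then have "2 * F v * m \<le> (F v)\<^sup>2 / ip v v + m\<^sup>2 * ip v v"
        using p by (simp add: power2_eq_square field_simps)
      ultimately show ?thesis by simp
    qed
    then have "2 * F v \<le> \<bar>K\<bar> / m + m * ip v v"
      using m by (simp add: field_simps power2_eq_square)
    then show ?thesis using coercive[OF v] by (simp add: J_def)
  qed
  define I where "I = Inf (J ` V)"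
  have bdd: "bdd_below (J ` V)" using J_ge by (auto intro!: bdd_belowI2)
  have I_le: "I \<le> J v" if "v \<in> V" for v unfolding I_def using bdd that by (rule cINF_lower)
  have "\<exists>v\<in>V. J v < I + 1 / real (Suc n)" for n
    using cInf_lessD[of "J ` V" "I + 1 / real (Suc n)"] V_ne unfolding I_def by auto
  then obtain w where w: "\<And>n. w n \<in> V" "\<And>n. J (w n) < I + 1 / real (Suc n)" by metis
  have half: "1 / real (Suc i) < e" if "i \<ge> N" "1 / e < real N" "e > 0" for i N e
  proof -
    have "1 / e < real (Suc i)" using that by linarith
    then show ?thesis using that(3) by (simp add: field_simps)
  qed
  have "\<exists>N. \<forall>i\<ge>N. \<forall>j\<ge>N. ip (lincomb 1 (w i) (-1) (w j)) (lincomb 1 (w i) (-1) (w j)) < e" if e: "e > 0" for e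
  proof -
    obtain N where N: "1 / (m * e / 4) < real N" using reals_Archimedean2 by blast
    have "ip (lincomb 1 (w i) (-1) (w j)) (lincomb 1 (w i) (-1) (w j)) < e" if ij: "i \<ge> N" "j \<ge> N" for i j
    proof -
      let ?d = "lincomb 1 (w i) (-1) (w j)" and ?a = "lincomb (1/2) (w i) (1/2) (w j)"
      have "?d \<in> V" "?a \<in> V" using w V_lincomb by auto
      have "b ?d ?d = 2 * J (w i) + 2 * J (w j) - 4 * J ?a"
        using sym_form_square[OF b w(1)[of i] w(1)[of j], of 1 "-1"]
          sym_form_square[OF b w(1)[of i] w(1)[of j], of "1/2" "1/2"]
          F_lin[OF w(1)[of i] w(1)[of j], of "1/2" "1/2"]
        by (simp add: J_def power2_eq_square)
      also have "\<dots> < 2 * (1 / real (Suc i)) + 2 * (1 / real (Suc j))"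
        using w(2)[of i] w(2)[of j] I_le[OF \<open>?a \<in> V\<close>] by linarith
      also have "\<dots> < m * e"
        using half[OF ij(1) N] half[OF ij(2) N] e m by simp
      finally have "m * ip ?d ?d < m * e" using coercive[OF \<open>?d \<in> V\<close>] by linarith
      then show ?thesis using m by simp
    qed
    then show ?thesis by blast
  qed
  from ip_complete[OF w(1) this] obtain g where g: "g \<in> V"
    "(\<lambda>n. ip (lincomb 1 (w n) (-1) g) (lincomb 1 (w n) (-1) g)) \<longlonglongrightarrow> 0" by blast
  have "b g v = F v" if v: "v \<in> V" for v
  proof -
    let ?d = "\<lambda>n. lincomb 1 (w n) (-1) g"
    have near: "(b (w n) v - F v)\<^sup>2 \<le> 1 / real (Suc n) * b v v" for n
    proof (rule nonneg_quadratic_imp_discriminant)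
      fix s
      have "J (lincomb 1 (w n) s v) = J (w n) + 2 * s * (b (w n) v - F v) + s\<^sup>2 * b v v"
        using sym_form_square[OF b w(1)[of n] v, of 1 s] F_lin[OF w(1)[of n] v, of 1 s]
        by (simp add: J_def algebra_simps)
      then show "0 \<le> 1 / real (Suc n) + 2 * s * (b (w n) v - F v) + s\<^sup>2 * b v v"
        using I_le[OF V_lincomb[OF w(1)[of n] v, of 1 s]] w(2)[of n] by linarith
    qed (use pos v in auto)
    have le: "(b g v - F v)\<^sup>2 \<le> 2 * (1 / real (Suc n) * b v v) + 2 * (B * ip (?d n) (?d n) * b v v)" for n
    proof -
      have d: "?d n \<in> V" using w g V_lincomb by auto
      have "(b (?d n) v)\<^sup>2 \<le> b (?d n) (?d n) * b v v"
        by (rule sym_form_Cauchy_Schwarz[OF b pos d v])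
      also have "\<dots> \<le> B * ip (?d n) (?d n) * b v v"
        using bounded[OF d] pos[OF v] by (rule mult_right_mono)
      finally have 1: "(b (?d n) v)\<^sup>2 \<le> B * ip (?d n) (?d n) * b v v" .
      have "b g v - F v = (b (w n) v - F v) - b (?d n) v"
        using sym_form_left[OF b w(1)[of n] g(1) v, of 1 "-1"] by simp
      then have "(b g v - F v)\<^sup>2 \<le> 2 * (b (w n) v - F v)\<^sup>2 + 2 * (b (?d n) v)\<^sup>2"
        using sum_squares_bound[of "b (w n) v - F v" "- b (?d n) v"]
        by (simp only: power2_diff[of "b (w n) v - F v" "b (?d n) v"])  simp
      then show ?thesis using 1 near[of n] by linarith
    qed
    have "(\<lambda>n. 2 * (1 / real (Suc n) * b v v) + 2 * (B * ip (?d n) (?d n) * b v v)) \<longlonglongrightarrow> 2 * (0 * b v v) + 2 * (B * 0 * b v v)"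
      using LIMSEQ_inverse_real_of_nat g(2) by (intro tendsto_intros) (simp_all add: inverse_eq_divide)
    then have "(b g v - F v)\<^sup>2 \<le> 2 * (0 * b v v) + 2 * (B * 0 * b v v)"
      by (rule tendsto_lowerbound) (use le in auto)
    then show ?thesis by simp
  qed
  then show ?thesis using g by blast
qed

end

locale positive_contraction = semi_hilbert +
  fixes T :: "('a \<Rightarrow> real) \<Rightarrow> 'a \<Rightarrow> real" and d :: "('a \<Rightarrow> real) \<Rightarrow> ('a \<Rightarrow> real) \<Rightarrow> real"
  assumes d: "sym_form d" and d_nonneg: "u \<in> V \<Longrightarrow> 0 \<le> d u u" and d_le: "u \<in> V \<Longrightarrow> d u u \<le> ip u u"
    and T_V: "u \<in> V \<Longrightarrow> T u \<in> V" and T_d: "u \<in> V \<Longrightarrow> v \<in> V \<Longrightarrow> ip (T u) v = d u v"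
begin

abbreviation R :: "real \<Rightarrow> ('a \<Rightarrow> real) \<Rightarrow> 'a \<Rightarrow> real" where
  "R \<beta> u \<equiv> lincomb 1 (T u) (- \<beta>) u"

lemma R_V: "u \<in> V \<Longrightarrow> R \<beta> u \<in> V"
  using V_lincomb T_V by blast

lemma ip_R: "u \<in> V \<Longrightarrow> v \<in> V \<Longrightarrow> ip (R \<beta> u) v = d u v - \<beta> * ip u v"
  using ip_lin[OF T_V, of u u v 1 "- \<beta>"] T_d by simp

lemma ip_R_R_le:
  assumes "u \<in> V"
  shows "ip (R \<beta> u) (R \<beta> u) \<le> (2 + 2 * \<beta>\<^sup>2) * ip u u"
proof -
  have "(ip (T u) (T u))\<^sup>2 \<le> d u u * d (T u) (T u)"
    using sym_form_Cauchy_Schwarz[OF d d_nonneg assms T_V[OF assms]] T_d[OF assms T_V[OF assms]] by simp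
  also have "\<dots> \<le> ip u u * ip (T u) (T u)"
    using assms T_V d_nonneg d_le ip_nonneg by (intro mult_mono) auto
  finally have "ip (T u) (T u) * ip (T u) (T u) \<le> ip u u * ip (T u) (T u)" by (simp add: power2_eq_square)
  then have "ip (T u) (T u) \<le> ip u u"
    using ip_nonneg[OF assms] ip_nonneg[OF T_V[OF assms]]
    by (cases "ip (T u) (T u) = 0") (auto simp: mult_le_cancel_right)
  then show ?thesis
    using ip_lincomb_le[OF T_V[OF assms] assms, of 1 "- \<beta>"] by (simp add: algebra_simps)
qed

text \<open>The lower bound and the solvability are the ingredients of bounded invertibility, in terms of
  the form.\<close>

lemma resolvent_outside_unit_interval:
  assumes \<beta>: "\<beta> < 0 \<or> 1 < \<beta>"
  shows "\<exists>c>0. \<forall>u\<in>V. c * ip u u \<le> ip (R \<beta> u) (R \<beta> u)"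
    and "f \<in> V \<Longrightarrow> \<exists>u\<in>V. ip (lincomb 1 (R \<beta> u) (-1) f) (lincomb 1 (R \<beta> u) (-1) f) = 0"
proof -
  \<comment> \<open>The form of \<open>\<plusminus>(T - \<beta>)\<close> is coercive for one choice of the sign.\<close>
  define \<sigma> :: real where "\<sigma> = (if \<beta> < 0 then 1 else -1)"
  define m where "m = (if \<beta> < 0 then - \<beta> else \<beta> - 1)"
  define b where "b u v = \<sigma> * (d u v - \<beta> * ip u v)" for u v
  have m: "m > 0" using \<beta> by (auto simp: m_def)
  have \<sigma>: "\<sigma> * \<sigma> = 1" by (simp add: \<sigma>_def)
  have coercive: "m * ip u u \<le> b u u" if "u \<in> V" for u
    using d_nonneg[OF that] d_le[OF that] by (simp add: m_def b_def \<sigma>_def algebra_simps)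
  have b: "sym_form b"
    unfolding b_def sym_form_def
    by (auto simp: sym_form_sym[OF d] ip_sym ip_lin sym_form_left[OF d] algebra_simps)
  have b_R: "b u v = \<sigma> * ip (R \<beta> u) v" if "u \<in> V" "v \<in> V" for u v
    using ip_R[OF that] by (simp add: b_def)
  have "m\<^sup>2 * ip u u \<le> ip (R \<beta> u) (R \<beta> u)" if u: "u \<in> V" for u
  proof (cases "ip u u = 0")
    case True
    then show ?thesis using ip_nonneg[OF R_V[OF u]] by simp
  next
    case False
    then have p: "ip u u > 0" using ip_nonneg[OF u] by simp
    have "(m * ip u u)\<^sup>2 \<le> (b u u)\<^sup>2"
      using coercive[OF u] m p by (intro power_mono) auto
    also have "\<dots> = (ip (R \<beta> u) u)\<^sup>2"
      unfolding b_R[OF u u] using \<sigma> by (simp add: power_mult_distrib power2_eq_square)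
    also have "\<dots> \<le> ip (R \<beta> u) (R \<beta> u) * ip u u"
      by (rule sym_form_Cauchy_Schwarz[OF sym_form_ip ip_nonneg R_V[OF u] u])
    finally have "(m\<^sup>2 * ip u u) * ip u u \<le> ip (R \<beta> u) (R \<beta> u) * ip u u"
      by (simp add: power2_eq_square mult_ac)
    then show ?thesis using p by simp
  qed
  then show "\<exists>c>0. \<forall>u\<in>V. c * ip u u \<le> ip (R \<beta> u) (R \<beta> u)"
    using m by (intro exI[of _ "m\<^sup>2"]) auto
  show "\<exists>u\<in>V. ip (lincomb 1 (R \<beta> u) (-1) f) (lincomb 1 (R \<beta> u) (-1) f) = 0" if f: "f \<in> V"
  proof -
    have "\<exists>w\<in>V. \<forall>v\<in>V. b w v = \<sigma> * ip f v"
    proof (rule lax_milgram[OF b m coercive, where B="1 + \<bar>\<beta>\<bar>" and K="ip f f"])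
      show "b u u \<le> (1 + \<bar>\<beta>\<bar>) * ip u u" if "u \<in> V" for u
        using d_nonneg[OF that] d_le[OF that] ip_nonneg[OF that]
        by (auto simp: b_def \<sigma>_def algebra_simps abs_if)
      show "(\<sigma> * ip f u)\<^sup>2 \<le> ip f f * ip u u" if "u \<in> V" for u
        using sym_form_Cauchy_Schwarz[OF sym_form_ip ip_nonneg f that] \<sigma>
        by (simp add: power_mult_distrib power2_eq_square[of \<sigma>])
      show "\<sigma> * ip f (lincomb r u s v) = r * (\<sigma> * ip f u) + s * (\<sigma> * ip f v)" if "u \<in> V" "v \<in> V" for u v r s
        using sym_form_right[OF sym_form_ip that f] by (simp add: algebra_simps)
    qed
    then obtain w where w: "w \<in> V" "\<And>v. v \<in> V \<Longrightarrow> b w v = \<sigma> * ip f v" by blast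
    have "ip (R \<beta> w) v = ip f v" if "v \<in> V" for v
      using w(2)[OF that] b_R[OF w(1) that] \<sigma> by (metis mult.assoc mult_1)
    then have "ip (lincomb 1 (R \<beta> w) (-1) f) (lincomb 1 (R \<beta> w) (-1) f) = 0"
      using ip_lin[OF R_V[OF w(1)] f V_lincomb[OF R_V[OF w(1)] f]] V_lincomb[OF R_V[OF w(1)] f] by simp
    then show ?thesis using w(1) by blast
  qed
qed

text \<open>Let \<open>\<mu>\<close> be the infimum of \<open>\<parallel>(T - \<beta>) v\<parallel>\<close> over unit vectors \<open>v\<close>. If \<open>T - (\<beta> + \<mu>)\<close> and
  \<open>T - (\<beta> - \<mu>)\<close> were both bounded below, then so would be their product \<open>(T - \<beta>)\<^sup>2 - \<mu>\<^sup>2\<close>; being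
  positive semidefinite, it would then have a coercive form, against the choice of \<open>\<mu>\<close>.\<close>

lemma spectrum_near_approximate_eigenvalue:
  assumes u: "u \<in> V" "ip u u > 0" "ip (R \<beta> u) (R \<beta> u) \<le> \<epsilon>\<^sup>2 * ip u u" and "0 \<le> \<epsilon>"
  shows "\<exists>\<beta>'. \<bar>\<beta>' - \<beta>\<bar> \<le> \<epsilon> \<and> \<not> (\<exists>c>0. \<forall>v\<in>V. c * ip v v \<le> ip (R \<beta>' v) (R \<beta>' v))"
proof (rule ccontr)
  assume contra: "\<not> ?thesis"
  define Q where "Q = {ip (R \<beta> v) (R \<beta> v) / ip v v |v. v \<in> V \<and> ip v v > 0}"
  define \<mu> where "\<mu> = sqrt (Inf Q)"
  have Q_nonneg: "0 \<le> q" if "q \<in> Q" for q using that ip_nonneg R_V by (auto simp: Q_def)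
  then have bdd: "bdd_below Q" by (auto intro: bdd_belowI[of _ 0])
  have mem: "ip (R \<beta> v) (R \<beta> v) / ip v v \<in> Q" if "v \<in> V" "ip v v > 0" for v
    using that by (auto simp: Q_def)
  then have "Q \<noteq> {}" using u by blast
  then have "Inf Q \<ge> 0" using Q_nonneg by (rule cInf_greatest)
  then have \<mu>: "\<mu> \<ge> 0" "\<mu>\<^sup>2 = Inf Q" by (auto simp: \<mu>_def)
  have "Inf Q \<le> \<epsilon>\<^sup>2"
    using cInf_lower[OF mem[OF u(1,2)] bdd] u by (smt (verit) pos_divide_le_eq)
  then have "\<mu> \<le> \<epsilon>" using \<mu>(2) \<open>0 \<le> \<epsilon>\<close> by (metis power2_le_imp_le)
  have lower: "\<mu>\<^sup>2 * ip v v \<le> ip (R \<beta> v) (R \<beta> v)" if v: "v \<in> V" for v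
  proof (cases "ip v v = 0")
    case True
    then show ?thesis using ip_nonneg[OF R_V[OF v]] by simp
  next
    case False
    then have p: "ip v v > 0" using ip_nonneg[OF v] by simp
    then show ?thesis using cInf_lower[OF mem[OF v p] bdd] \<mu>(2) by (simp add: pos_le_divide_eq)
  qed
  obtain c1 c2 where c: "c1 > 0" "c2 > 0"
    "\<And>v. v \<in> V \<Longrightarrow> c1 * ip v v \<le> ip (R (\<beta> - \<mu>) v) (R (\<beta> - \<mu>) v)"
    "\<And>v. v \<in> V \<Longrightarrow> c2 * ip v v \<le> ip (R (\<beta> + \<mu>) v) (R (\<beta> + \<mu>) v)"
  proof -
    have "\<bar>(\<beta> - \<mu>) - \<beta>\<bar> \<le> \<epsilon>" "\<bar>(\<beta> + \<mu>) - \<beta>\<bar> \<le> \<epsilon>" using \<open>\<mu> \<le> \<epsilon>\<close> \<mu>(1) by auto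
    then have "\<exists>c>0. \<forall>v\<in>V. c * ip v v \<le> ip (R (\<beta> - \<mu>) v) (R (\<beta> - \<mu>) v)"
      "\<exists>c>0. \<forall>v\<in>V. c * ip v v \<le> ip (R (\<beta> + \<mu>) v) (R (\<beta> + \<mu>) v)"
      using contra by blast+
    then show ?thesis using that by blast
  qed
  define q where "q v w = ip (R \<beta> v) (R \<beta> w) - \<mu>\<^sup>2 * ip v w" for v w
  have ipR: "ip (R \<beta> v) (R \<gamma> w) = d v (T w) - \<gamma> * d v w - \<beta> * d v w + \<beta> * \<gamma> * ip v w" if "v \<in> V" "w \<in> V" for v w \<beta> \<gamma>
  proof -
    have "ip (R \<beta> v) (R \<gamma> w) = d v (R \<gamma> w) - \<beta> * ip v (R \<gamma> w)" using ip_R that R_V by blast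
    also have "\<dots> = d v (T w) - \<gamma> * d v w - \<beta> * (ip v (T w) - \<gamma> * ip v w)"
      using sym_form_right[OF d T_V[OF that(2)] that(2) that(1), of 1 "-\<gamma>"]
        sym_form_right[OF sym_form_ip T_V[OF that(2)] that(2) that(1), of 1 "-\<gamma>"] by simp
    also have "ip v (T w) = d v w" using that T_V T_d ip_sym sym_form_sym[OF d] by metis
    finally show ?thesis by (simp add: algebra_simps)
  qed
  have d_T_sym: "d v (T w) = d w (T v)" if "v \<in> V" "w \<in> V" for v w
    using that T_V T_d ip_sym sym_form_sym[OF d] by metis
  have T_lin: "d v (T (lincomb r x s y)) = r * d v (T x) + s * d v (T y)" if "v \<in> V" "x \<in> V" "y \<in> V" for v x y r s
    using that d_T_sym[of v] V_lincomb sym_form_left[OF d, of x y "T v" r s] T_V by simp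
  have q: "sym_form q"
  proof -
    have eq: "q v w = d v (T w) - 2 * \<beta> * d v w + (\<beta>\<^sup>2 - \<mu>\<^sup>2) * ip v w" if "v \<in> V" "w \<in> V" for v w
      using ipR[OF that, of \<beta> \<beta>] by (simp add: q_def power2_eq_square algebra_simps)
    show ?thesis unfolding sym_form_def
    proof (intro conjI ballI allI)
      fix v w assume vw: "v \<in> V" "w \<in> V"
      then show "q v w = q w v"
        using eq[of v w] eq[of w v] d_T_sym[of v w] sym_form_sym[OF d, of v w] ip_sym[of v w] by simp
      fix z r s assume z: "z \<in> V"
      show "q (lincomb r v s w) z = r * q v z + s * q w z"
        unfolding eq[OF V_lincomb[OF vw] z] eq[OF vw(1) z] eq[OF vw(2) z]
          sym_form_left[OF d vw T_V[OF z]] sym_form_left[OF d vw z] ip_lin[OF vw z]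
        by (simp add: algebra_simps)
    qed
  qed
  have q_nonneg: "0 \<le> q v v" if "v \<in> V" for v using lower[OF that] by (simp add: q_def)
  define B where "B = 2 + 2 * \<beta>\<^sup>2"
  have B: "B > 0" by (simp add: B_def add_pos_nonneg)
  have q_le: "q v v \<le> B * ip v v" if "v \<in> V" for v
    using ip_R_R_le[OF that] ip_nonneg[OF that] by (simp add: q_def B_def) (smt (verit) mult_nonneg_nonneg zero_le_power2)
  have coercive: "c1 * c2 * ip v v \<le> B * q v v" if v: "v \<in> V" for v
  proof -
    let ?S = "R (\<beta> + \<mu>) (R (\<beta> - \<mu>) v)"
    have SV: "?S \<in> V" using R_V v by blast
    have S: "ip ?S w = q v w" if w: "w \<in> V" for w
    proof -
      have "ip ?S w = d (R (\<beta> - \<mu>) v) w - (\<beta> + \<mu>) * ip (R (\<beta> - \<mu>) v) w" using ip_R R_V v w by blast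
      also have "\<dots> = ip (R (\<beta> - \<mu>) v) (R (\<beta> + \<mu>) w)"
        using sym_form_right[OF sym_form_ip T_V[OF w] w R_V[OF v], of "\<beta> - \<mu>" 1 "- (\<beta> + \<mu>)"]
          T_d[OF w R_V[OF v, of "\<beta> - \<mu>"]] ip_sym[OF T_V[OF w] R_V[OF v, of "\<beta> - \<mu>"]]
          sym_form_sym[OF d w R_V[OF v, of "\<beta> - \<mu>"]] by (simp add: algebra_simps)
      also have "\<dots> = q v w"
        using ipR[OF v w, of "\<beta> - \<mu>" "\<beta> + \<mu>"] ipR[OF v w, of \<beta> \<beta>]
        by (simp add: q_def power2_eq_square algebra_simps)
      finally show ?thesis .
    qed
    have "c2 * (c1 * ip v v) \<le> c2 * ip (R (\<beta> - \<mu>) v) (R (\<beta> - \<mu>) v)"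
      using c(2) c(3)[OF v] by (intro mult_left_mono) auto
    also have "\<dots> \<le> ip ?S ?S" using c(4)[OF R_V[OF v]] .
    finally have 1: "c1 * c2 * ip v v \<le> ip ?S ?S" by (simp add: mult_ac)
    have "ip ?S ?S * ip ?S ?S = (q v ?S)\<^sup>2" using S[OF SV] by (simp add: power2_eq_square)
    also have "\<dots> \<le> q v v * q ?S ?S" by (rule sym_form_Cauchy_Schwarz[OF q q_nonneg v SV])
    also have "\<dots> \<le> q v v * (B * ip ?S ?S)" using q_le[OF SV] q_nonneg[OF v] by (rule mult_left_mono)
    finally have "ip ?S ?S * ip ?S ?S \<le> (B * q v v) * ip ?S ?S" by (simp add: mult_ac)
    moreover have "0 \<le> ip ?S ?S" using ip_nonneg[OF SV] .
    ultimately have "ip ?S ?S \<le> B * q v v"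
      using B q_nonneg[OF v] by (cases "ip ?S ?S = 0") (auto simp: mult_le_cancel_right)
    then show ?thesis using 1 by linarith
  qed
  have "Inf Q + c1 * c2 / B \<le> x" if x: "x \<in> Q" for x
  proof -
    obtain v where v: "v \<in> V" "ip v v > 0" "x = ip (R \<beta> v) (R \<beta> v) / ip v v" using x by (auto simp: Q_def)
    have "c1 * c2 / B * ip v v \<le> q v v" using coercive[OF v(1)] B by (simp add: field_simps)
    then have "(\<mu>\<^sup>2 + c1 * c2 / B) * ip v v \<le> ip (R \<beta> v) (R \<beta> v)" by (simp add: q_def algebra_simps)
    then show ?thesis using v \<mu>(2) by (simp add: pos_le_divide_eq)
  qed
  then have "Inf Q + c1 * c2 / B \<le> Inf Q" using \<open>Q \<noteq> {}\<close> by (intro cInf_greatest)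
  then show False using c B by (smt (verit) divide_pos_pos mult_pos_pos)
qed

end

section \<open>Weak gradients and the space \<open>H\<^sup>1\<^sub>0\<close>\<close>

definition grad :: "(real^2 \<Rightarrow> real) \<Rightarrow> real^2 \<Rightarrow> real^2" where
  "grad \<phi> x = (\<chi> i. partial_deriv i \<phi> x)"

definition rot :: "real^2 \<Rightarrow> real^2" where
  "rot a = (\<chi> i. if i = 1 then - a $ 2 else a $ 1)"

lemma rot_nth [simp]: "rot a $ 1 = - a $ 2" "rot a $ 2 = a $ 1"
  by (auto simp: rot_def)

lemma norm_rot [simp]: "norm (rot a) = norm a"
  by (simp add: norm_vec_def L2_set_def sum_2 add.commute)

text \<open>The difference between the flux of \<open>u\<close> for the coefficient \<open>\<one>\<^sub>E - \<beta>\<close> and a field without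
  divergence, of which \<open>f\<close> is the stream function.\<close>

definition flux_defect :: "(real^2) set \<Rightarrow> real \<Rightarrow> (real^2 \<Rightarrow> real) \<Rightarrow> (real^2 \<Rightarrow> real) \<Rightarrow> real^2 \<Rightarrow> real^2" where
  "flux_defect E \<beta> u f x = (indicator E x - \<beta>) *\<^sub>R grad u x - rot (grad f x)"

lemma component_sq_le: "(x $ i)\<^sup>2 \<le> (norm (x :: real^2))\<^sup>2"
  using power_mono[OF component_le_norm_cart[of x i], of 2] by simp

context bounded_domain
begin

abbreviation "wg \<equiv> weak_gradient \<Omega>"

lemma L2_component:
  fixes g :: "real^2 \<Rightarrow> real^2"
  assumes "g \<in> L2 \<Omega>" shows "(\<lambda>x. g x $ i) \<in> L2 \<Omega>"
proof -
  have m: "(\<lambda>x. g x $ i) \<in> borel_measurable M"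
    using borel_measurable_inner[OF L2_D(1)[OF assms] borel_measurable_const[of "axis i (1::real)"]]
    by (simp add: inner_axis)
  have "integrable M (\<lambda>x. (norm (g x $ i))\<^sup>2)"
    by (rule Bochner_Integration.integrable_bound[OF L2_D(2)[OF assms]])
      (use m in \<open>auto simp: component_sq_le\<close>)
  then show ?thesis using m by (simp add: L2_def)
qed

lemma L2_mult_integrable:
  fixes f g :: "real^2 \<Rightarrow> real"
  shows "f \<in> L2 \<Omega> \<Longrightarrow> g \<in> L2 \<Omega> \<Longrightarrow> integrable M (\<lambda>x. f x * g x)"
  using L2_inner_integrable[of f g] by simp

lemma weak_gradient_integrable:
  assumes "u \<in> L2 \<Omega>" "g \<in> L2 \<Omega>" "\<phi> \<in> test_functions \<Omega>"
  shows "integrable M (\<lambda>x. u x * partial_deriv i \<phi> x)" "integrable M (\<lambda>x. g x $ i * \<phi> x)"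
  by (intro L2_mult_integrable L2_component L2_test_function test_functions_partial_deriv assms)+

text \<open>The difference of the two gradients is orthogonal to all test functions.\<close>

lemma has_weak_gradient_unique:
  assumes "g \<in> L2 \<Omega>" "h \<in> L2 \<Omega>" "has_weak_gradient \<Omega> u g" "has_weak_gradient \<Omega> v h"
    and "AE x in M. u x = v x" "u \<in> L2 \<Omega>" "v \<in> L2 \<Omega>"
  shows "AE x in M. g x = h x"
proof -
  have "AE x in M. g x $ i - h x $ i = 0" for i
  proof (rule AE_eq_0_if_orthogonal_to_test_functions)
    show "integrable M (\<lambda>x. g x $ i - h x $ i)"
      by (intro Bochner_Integration.integrable_diff L2_integrable L2_component assms)
    fix \<phi> assume \<phi>: "\<phi> \<in> test_functions \<Omega>"
    have 1: "integrable M (\<lambda>x. g x $ i * \<phi> x)" "integrable M (\<lambda>x. h x $ i * \<phi> x)"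
      using weak_gradient_integrable assms \<phi> by blast+
    have "(LINT x|M. u x * partial_deriv i \<phi> x) = (LINT x|M. v x * partial_deriv i \<phi> x)"
    proof (rule integral_cong_AE)
      show "AE x in M. u x * partial_deriv i \<phi> x = v x * partial_deriv i \<phi> x"
        using assms(5) by eventually_elim simp
    qed (use weak_gradient_integrable(1) assms \<phi> in blast)+
    moreover have "(LINT x|M. u x * partial_deriv i \<phi> x) = - (LINT x|M. g x $ i * \<phi> x)"
      "(LINT x|M. v x * partial_deriv i \<phi> x) = - (LINT x|M. h x $ i * \<phi> x)"
      using assms(3,4) \<phi> unfolding has_weak_gradient_def by auto
    ultimately have "(LINT x|M. g x $ i * \<phi> x) - (LINT x|M. h x $ i * \<phi> x) = 0" by simp
    then show "(LINT x|M. (g x $ i - h x $ i) * \<phi> x) = 0"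
      using 1 by (simp add: left_diff_distrib)
  qed
  from this[of 1] this[of 2] show ?thesis by eventually_elim (simp add: vec_eq_iff forall_2)
qed

lemma H1_D:
  assumes "u \<in> H1 \<Omega>"
  shows "u \<in> L2 \<Omega>" "wg u \<in> L2 \<Omega>" "has_weak_gradient \<Omega> u (wg u)"
proof -
  have "\<exists>g. g \<in> L2 \<Omega> \<and> has_weak_gradient \<Omega> u g" using assms by (auto simp: H1_def)
  then have "wg u \<in> L2 \<Omega> \<and> has_weak_gradient \<Omega> u (wg u)"
    unfolding weak_gradient_def by (rule someI_ex)
  then show "u \<in> L2 \<Omega>" "wg u \<in> L2 \<Omega>" "has_weak_gradient \<Omega> u (wg u)"
    using assms by (auto simp: H1_def)
qed

lemma weak_gradient_AE_eq:
  assumes "u \<in> L2 \<Omega>" "g \<in> L2 \<Omega>" "has_weak_gradient \<Omega> u g"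
  shows "u \<in> H1 \<Omega>" "AE x in M. wg u x = g x"
proof -
  show H: "u \<in> H1 \<Omega>" using assms by (auto simp: H1_def)
  show "AE x in M. wg u x = g x"
    by (rule has_weak_gradient_unique[OF H1_D(2)[OF H] assms(2) H1_D(3)[OF H] assms(3) _ assms(1,1)]) simp
qed

lemma has_weak_gradient_lincomb:
  assumes "u \<in> L2 \<Omega>" "v \<in> L2 \<Omega>" "g \<in> L2 \<Omega>" "h \<in> L2 \<Omega>"
    "has_weak_gradient \<Omega> u g" "has_weak_gradient \<Omega> v h"
  shows "has_weak_gradient \<Omega> (lincomb a u b v) (\<lambda>x. a *\<^sub>R g x + b *\<^sub>R h x)"
  unfolding has_weak_gradient_def
proof (intro ballI allI)
  fix \<phi> i assume \<phi>: "\<phi> \<in> test_functions \<Omega>"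
  note int = weak_gradient_integrable[OF assms(1,3) \<phi>, of i] weak_gradient_integrable[OF assms(2,4) \<phi>, of i]
  have eq: "(LINT x|M. u x * partial_deriv i \<phi> x) = - (LINT x|M. g x $ i * \<phi> x)"
    "(LINT x|M. v x * partial_deriv i \<phi> x) = - (LINT x|M. h x $ i * \<phi> x)"
    using assms(5,6) \<phi> unfolding has_weak_gradient_def by auto
  have "(LINT x|M. lincomb a u b v x * partial_deriv i \<phi> x)
      = (LINT x|M. a * (u x * partial_deriv i \<phi> x) + b * (v x * partial_deriv i \<phi> x))"
    by (simp add: lincomb_def algebra_simps)
  also have "\<dots> = - (LINT x|M. a * (g x $ i * \<phi> x) + b * (h x $ i * \<phi> x))"
    using int eq by simp
  also have "(LINT x|M. a * (g x $ i * \<phi> x) + b * (h x $ i * \<phi> x)) = (LINT x|M. (a *\<^sub>R g x + b *\<^sub>R h x) $ i * \<phi> x)"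
    by (simp add: algebra_simps)
  finally show "(LINT x|M. lincomb a u b v x * partial_deriv i \<phi> x)
      = - (LINT x|M. (a *\<^sub>R g x + b *\<^sub>R h x) $ i * \<phi> x)" .
qed

lemma L2_lincomb_real: "u \<in> L2 \<Omega> \<Longrightarrow> v \<in> L2 \<Omega> \<Longrightarrow> lincomb a u b v \<in> L2 \<Omega>"
  using L2_lincomb(1)[of u v a b] by (simp add: lincomb_def)

lemma H1_lincomb:
  assumes "u \<in> H1 \<Omega>" "v \<in> H1 \<Omega>"
  shows "lincomb a u b v \<in> H1 \<Omega>" "AE x in M. wg (lincomb a u b v) x = a *\<^sub>R wg u x + b *\<^sub>R wg v x"
proof -
  note D = H1_D[OF assms(1)] H1_D[OF assms(2)]
  show "lincomb a u b v \<in> H1 \<Omega>" "AE x in M. wg (lincomb a u b v) x = a *\<^sub>R wg u x + b *\<^sub>R wg v x"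
    using weak_gradient_AE_eq[OF L2_lincomb_real[OF D(1,4)] L2_lincomb(1)[OF D(2,5)]
        has_weak_gradient_lincomb[OF D(1,4,2,5,3,6)]] by auto
qed

lemma continuous_grad: "\<phi> \<in> test_functions \<Omega>' \<Longrightarrow> continuous_on UNIV (grad \<phi>)"
  unfolding grad_def by (intro continuous_on_vec_lambda continuous_test_function test_functions_partial_deriv)

lemma test_function_weak_gradient:
  assumes \<phi>: "\<phi> \<in> test_functions \<Omega>"
  shows "grad \<phi> \<in> L2 \<Omega>" "\<phi> \<in> H1 \<Omega>" "AE x in M. wg \<phi> x = grad \<phi> x"
proof -
  have d: "partial_deriv i \<phi> \<in> L2 \<Omega>" for i
    using L2_test_function test_functions_partial_deriv \<phi> by blast
  have "(norm (grad \<phi> x))\<^sup>2 = (norm (partial_deriv 1 \<phi> x))\<^sup>2 + (norm (partial_deriv 2 \<phi> x))\<^sup>2" for x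
    unfolding power2_norm_eq_inner by (simp add: grad_def inner_vec_def sum_2 power2_eq_square)
  moreover have "grad \<phi> \<in> borel_measurable M"
    using continuous_grad[OF \<phi>] by (intro measurable_restrict_space1 measurable_completion)
      (auto intro!: borel_measurable_continuous_onI)
  ultimately show G: "grad \<phi> \<in> L2 \<Omega>"
    using L2_D(2)[OF d[of 1]] L2_D(2)[OF d[of 2]] by (simp add: L2_def)
  have "has_weak_gradient \<Omega> \<phi> (grad \<phi>)"
    unfolding has_weak_gradient_def
  proof (intro ballI allI)
    fix \<psi> i assume \<psi>: "\<psi> \<in> test_functions \<Omega>"
    show "(LINT x|M. \<phi> x * partial_deriv i \<psi> x) = - (LINT x|M. grad \<phi> x $ i * \<psi> x)"
      using integral_mult_test_function(1)[OF continuous_test_function[OF \<phi>] test_functions_partial_deriv[OF \<psi>], of i]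
        integral_mult_test_function(1)[OF continuous_test_function[OF test_functions_partial_deriv[OF \<phi>]] \<psi>, of i]
        integration_by_parts[OF test_functions_smooth[OF \<phi>] \<psi>, of i]
      by (simp add: grad_def)
  qed
  then show "\<phi> \<in> H1 \<Omega>" "AE x in M. wg \<phi> x = grad \<phi> x"
    using weak_gradient_AE_eq[OF L2_test_function[OF \<phi>] G] by auto
qed

lemma integral_L2_cong_AE:
  assumes "f \<in> L2 \<Omega>" "g \<in> L2 \<Omega>" "AE x in M. f x = g x"
  shows "(LINT x|M. (norm (f x))\<^sup>2) = (LINT x|M. (norm (g x))\<^sup>2)"
proof (rule integral_cong_AE)
  show "AE x in M. (norm (f x))\<^sup>2 = (norm (g x))\<^sup>2" using assms(3) by eventually_elim simp
qed (use L2_D(2) assms in blast)+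

definition H1_sq :: "(real^2 \<Rightarrow> real) \<Rightarrow> real" where
  "H1_sq u = (LINT x|M. (u x)\<^sup>2) + (LINT x|M. (norm (wg u x))\<^sup>2)"

lemma H1_sq_nonneg: "0 \<le> H1_sq u" by (simp add: H1_sq_def)

lemma gradient_sq_lincomb_le:
  assumes "u \<in> H1 \<Omega>" "v \<in> H1 \<Omega>"
  shows "(LINT x|M. (norm (wg (lincomb a u b v) x))\<^sup>2)
    \<le> 2 * a\<^sup>2 * (LINT x|M. (norm (wg u x))\<^sup>2) + 2 * b\<^sup>2 * (LINT x|M. (norm (wg v x))\<^sup>2)"
  using integral_L2_cong_AE[OF H1_D(2)[OF H1_lincomb(1)[OF assms]] L2_lincomb(1)[OF H1_D(2)[OF assms(1)] H1_D(2)[OF assms(2)]]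
      H1_lincomb(2)[OF assms]] L2_lincomb(2)[OF H1_D(2)[OF assms(1)] H1_D(2)[OF assms(2)], of a b]
  by simp

lemma sq_lincomb_le:
  assumes "u \<in> L2 \<Omega>" "v \<in> L2 \<Omega>"
  shows "(LINT x|M. (lincomb a u b v x)\<^sup>2) \<le> 2 * a\<^sup>2 * (LINT x|M. (u x)\<^sup>2) + 2 * b\<^sup>2 * (LINT x|M. (v x)\<^sup>2)"
  using L2_lincomb(2)[OF assms, of a b] by (simp add: lincomb_def)

lemma H1_sq_lincomb_le:
  assumes "u \<in> H1 \<Omega>" "v \<in> H1 \<Omega>"
  shows "H1_sq (lincomb a u b v) \<le> 2 * a\<^sup>2 * H1_sq u + 2 * b\<^sup>2 * H1_sq v"
  using gradient_sq_lincomb_le[OF assms, of a b] sq_lincomb_le[OF H1_D(1)[OF assms(1)] H1_D(1)[OF assms(2)], of a b]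
  by (simp add: H1_sq_def algebra_simps)

text \<open>Approximation up to any positive error, in the square of the norm, is more convenient than
  approximating sequences for the closure properties.\<close>

lemma H10_iff:
  "u \<in> H10 \<Omega> \<longleftrightarrow> u \<in> H1 \<Omega> \<and> (\<forall>e>0. \<exists>\<phi>\<in>test_functions \<Omega>. H1_sq (lincomb 1 \<phi> (-1) u) < e)"
proof safe
  have norm: "H1_norm \<Omega> (\<lambda>x. \<phi> x - u x) = sqrt (H1_sq (lincomb 1 \<phi> (-1) u))" for \<phi>
    by (simp add: H1_norm_def H1_sq_def lincomb_def)
  {
    assume "u \<in> H10 \<Omega>"
    then obtain \<phi> where \<phi>: "u \<in> H1 \<Omega>" "\<And>n. \<phi> n \<in> test_functions \<Omega>"
      "(\<lambda>n. sqrt (H1_sq (lincomb 1 (\<phi> n) (-1) u))) \<longlonglongrightarrow> 0"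
      by (auto simp: H10_def norm)
    show "u \<in> H1 \<Omega>" by fact
    fix e :: real assume "e > 0"
    then have "eventually (\<lambda>n. sqrt (H1_sq (lincomb 1 (\<phi> n) (-1) u)) < sqrt e) sequentially"
      by (intro order_tendstoD[OF \<phi>(3)]) simp
    then obtain n where "sqrt (H1_sq (lincomb 1 (\<phi> n) (-1) u)) < sqrt e"
      using eventually_happens'[OF sequentially_bot] by blast
    then have "H1_sq (lincomb 1 (\<phi> n) (-1) u) < e" by simp
    then show "\<exists>\<phi>\<in>test_functions \<Omega>. H1_sq (lincomb 1 \<phi> (-1) u) < e"
      using \<phi>(2) by blast
  }
  assume u: "u \<in> H1 \<Omega>" and approx: "\<forall>e>0. \<exists>\<phi>\<in>test_functions \<Omega>. H1_sq (lincomb 1 \<phi> (-1) u) < e"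
  have "0 < 1 / real (Suc n)" for n by simp
  with approx have "\<exists>\<phi>. \<phi> \<in> test_functions \<Omega> \<and> H1_sq (lincomb 1 \<phi> (-1) u) < 1 / real (Suc n)" for n
    by blast
  then obtain \<phi> where \<phi>: "\<And>n. \<phi> n \<in> test_functions \<Omega>" "\<And>n. H1_sq (lincomb 1 (\<phi> n) (-1) u) < 1 / real (Suc n)"
    by metis
  have "(\<lambda>n. H1_sq (lincomb 1 (\<phi> n) (-1) u)) \<longlonglongrightarrow> 0"
  proof (rule tendsto_sandwich[OF _ _ tendsto_const])
    show "(\<lambda>n. 1 / real (Suc n)) \<longlonglongrightarrow> 0"
      using LIMSEQ_inverse_real_of_nat by (simp add: inverse_eq_divide)
  qed (use \<phi>(2) H1_sq_nonneg less_imp_le in \<open>auto simp del: of_nat_Suc intro!: always_eventually\<close>)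
  then have "(\<lambda>n. H1_norm \<Omega> (\<lambda>x. \<phi> n x - u x)) \<longlonglongrightarrow> 0"
    using tendsto_real_sqrt[of _ 0] unfolding norm by force
  then show "u \<in> H10 \<Omega>" using u \<phi>(1) by (auto simp: H10_def)
qed

lemma H10_imp_H1: "u \<in> H10 \<Omega> \<Longrightarrow> u \<in> H1 \<Omega>"
  by (simp add: H10_iff)

lemma H1_sq_0: "H1_sq (lincomb 1 u (-1) u) = 0" if "u \<in> H1 \<Omega>"
proof -
  have "(LINT x|M. (norm (wg (lincomb 1 u (-1) u) x))\<^sup>2) = (LINT x|M. (norm (1 *\<^sub>R wg u x + (-1) *\<^sub>R wg u x))\<^sup>2)"
    using that by (intro integral_L2_cong_AE H1_lincomb H1_D L2_lincomb)
  then show ?thesis by (simp add: H1_sq_def lincomb_def)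
qed

lemma test_functions_subset_H10:
  assumes "\<phi> \<in> test_functions \<Omega>" shows "\<phi> \<in> H10 \<Omega>"
  unfolding H10_iff using assms test_function_weak_gradient(2)[OF assms]
  by (auto intro!: bexI[of _ \<phi>] simp: H1_sq_0)

lemma test_functions_lincomb': "\<phi> \<in> test_functions \<Omega> \<Longrightarrow> \<psi> \<in> test_functions \<Omega> \<Longrightarrow> lincomb a \<phi> b \<psi> \<in> test_functions \<Omega>"
  unfolding lincomb_def by (rule test_functions_lincomb)

lemma H10_lincomb:
  assumes "u \<in> H10 \<Omega>" "v \<in> H10 \<Omega>" shows "lincomb a u b v \<in> H10 \<Omega>"
proof -
  note H = H10_imp_H1[OF assms(1)] H10_imp_H1[OF assms(2)]
  have "\<exists>\<phi>\<in>test_functions \<Omega>. H1_sq (lincomb 1 \<phi> (-1) (lincomb a u b v)) < e" if e: "e > 0" for e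
  proof -
    define c where "c = 2 * a\<^sup>2 + 2 * b\<^sup>2 + 1"
    have c: "c > 0" by (simp add: c_def add_nonneg_pos)
    then have ec: "e / c > 0" using e by simp
    obtain \<phi> where \<phi>: "\<phi> \<in> test_functions \<Omega>" "H1_sq (lincomb 1 \<phi> (-1) u) < e / c"
      using assms(1) ec unfolding H10_iff by blast
    obtain \<psi> where \<psi>: "\<psi> \<in> test_functions \<Omega>" "H1_sq (lincomb 1 \<psi> (-1) v) < e / c"
      using assms(2) ec unfolding H10_iff by blast
    note H' = test_function_weak_gradient(2)[OF \<phi>(1)] test_function_weak_gradient(2)[OF \<psi>(1)]
    have eq: "lincomb 1 (lincomb a \<phi> b \<psi>) (-1) (lincomb a u b v)
        = lincomb a (lincomb 1 \<phi> (-1) u) b (lincomb 1 \<psi> (-1) v)"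
      by (auto simp: lincomb_def algebra_simps)
    have "H1_sq (lincomb 1 (lincomb a \<phi> b \<psi>) (-1) (lincomb a u b v))
        \<le> 2 * a\<^sup>2 * H1_sq (lincomb 1 \<phi> (-1) u) + 2 * b\<^sup>2 * H1_sq (lincomb 1 \<psi> (-1) v)"
      unfolding eq by (intro H1_sq_lincomb_le H1_lincomb H H')
    also have "\<dots> \<le> 2 * a\<^sup>2 * (e / c) + 2 * b\<^sup>2 * (e / c)"
      using \<phi>(2) \<psi>(2) by (intro add_mono mult_left_mono) auto
    also have "\<dots> = (2 * a\<^sup>2 + 2 * b\<^sup>2) / c * e" by (simp add: field_simps add_divide_distrib)
    also have "\<dots> < 1 * e" using c e by (intro mult_strict_right_mono) (auto simp: c_def)
    finally show ?thesis using test_functions_lincomb'[OF \<phi>(1) \<psi>(1), of a b] by auto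
  qed
  then show ?thesis using H1_lincomb(1)[OF H] by (simp add: H10_iff)
qed

lemma dirichlet_form_eq:
  assumes "E \<in> sets lebesgue" "E \<subseteq> \<Omega>"
  shows "dirichlet_form \<Omega> E u v = (LINT x|M. indicator E x * (wg u x \<bullet> wg v x))"
proof -
  have "(LINT x|lebesgue_on E. wg u x \<bullet> wg v x) = (LINT x|lebesgue. indicator E x *\<^sub>R (wg u x \<bullet> wg v x))"
    using assms by (simp add: integral_restrict_space)
  also have "\<dots> = (LINT x|lebesgue. indicator \<Omega> x *\<^sub>R (indicator E x * (wg u x \<bullet> wg v x)))"
    using assms(2) by (intro Bochner_Integration.integral_cong) (auto simp: indicator_def)
  also have "\<dots> = (LINT x|M. indicator E x * (wg u x \<bullet> wg v x))"
    by (simp add: integral_restrict_space)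
  finally show ?thesis by (simp add: dirichlet_form_def)
qed

lemma H10_inner_eq: "H10_inner \<Omega> u v = (LINT x|M. wg u x \<bullet> wg v x)"
  by (simp add: H10_inner_def dirichlet_form_def)

lemma H10_inner_self: "H10_inner \<Omega> u u = (LINT x|M. (norm (wg u x))\<^sup>2)"
  by (simp add: H10_inner_eq power2_norm_eq_inner)

lemma dirichlet_form_lincomb:
  assumes E: "E \<in> sets lebesgue" "E \<subseteq> \<Omega>" and "u \<in> H1 \<Omega>" "v \<in> H1 \<Omega>" "w \<in> H1 \<Omega>"
  shows "dirichlet_form \<Omega> E (lincomb a u b v) w = a * dirichlet_form \<Omega> E u w + b * dirichlet_form \<Omega> E v w"
proof -
  note int = L2_indicator_inner_integrable[OF H1_D(2)[OF assms(3)] H1_D(2)[OF assms(5)] E(1)]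
    L2_indicator_inner_integrable[OF H1_D(2)[OF assms(4)] H1_D(2)[OF assms(5)] E(1)]
    L2_indicator_inner_integrable[OF H1_D(2)[OF H1_lincomb(1)[OF assms(3,4)]] H1_D(2)[OF assms(5)] E(1)]
  have "(LINT x|M. indicator E x * (wg (lincomb a u b v) x \<bullet> wg w x))
      = (LINT x|M. a * (indicator E x * (wg u x \<bullet> wg w x)) + b * (indicator E x * (wg v x \<bullet> wg w x)))"
  proof (rule integral_cong_AE)
    show "AE x in M. indicator E x * (wg (lincomb a u b v) x \<bullet> wg w x)
        = a * (indicator E x * (wg u x \<bullet> wg w x)) + b * (indicator E x * (wg v x \<bullet> wg w x))"
      using H1_lincomb(2)[OF assms(3,4), of a b]
      by eventually_elim (simp add: inner_add_left algebra_simps)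
  qed (use int in auto)
  also have "\<dots> = a * (LINT x|M. indicator E x * (wg u x \<bullet> wg w x)) + b * (LINT x|M. indicator E x * (wg v x \<bullet> wg w x))"
    using int by simp
  finally show ?thesis by (simp add: dirichlet_form_eq[OF E])
qed

lemma dirichlet_form_sym: "dirichlet_form \<Omega> E u v = dirichlet_form \<Omega> E v u"
  by (simp add: dirichlet_form_def inner_commute)

lemma dirichlet_form_bounds:
  assumes E: "E \<in> sets lebesgue" "E \<subseteq> \<Omega>" and u: "u \<in> H1 \<Omega>"
  shows "0 \<le> dirichlet_form \<Omega> E u u" "dirichlet_form \<Omega> E u u \<le> H10_inner \<Omega> u u"
proof -
  show "0 \<le> dirichlet_form \<Omega> E u u" by (simp add: dirichlet_form_def)
  show "dirichlet_form \<Omega> E u u \<le> H10_inner \<Omega> u u"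
    unfolding dirichlet_form_eq[OF E] H10_inner_eq
    by (intro integral_mono L2_indicator_inner_integrable L2_inner_integrable H1_D u E(1))
      (auto simp: indicator_def)
qed

text \<open>The inequality passes from test functions to their limits; using only
  \<open>(x + y)\<^sup>2 \<le> 2 x\<^sup>2 + 2 y\<^sup>2\<close> there enlarges the constant.\<close>

lemma poincare_inequality:
  obtains C where "C \<ge> 0" "\<And>u. u \<in> H10 \<Omega> \<Longrightarrow> (LINT x|M. (u x)\<^sup>2) \<le> C * H10_inner \<Omega> u u"
proof -
  obtain R where R: "\<Omega> \<subseteq> ball 0 R" using bounded_domain bounded_subset_ballD by blast
  define C where "C = 4 * R\<^sup>2"
  have C: "C \<ge> 0" by (simp add: C_def)
  have test: "(LINT x|M. (\<phi> x)\<^sup>2) \<le> C * H10_inner \<Omega> \<phi> \<phi>" if \<phi>: "\<phi> \<in> test_functions \<Omega>" for \<phi>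
  proof -
    let ?d = "partial_deriv 1 \<phi>"
    have d: "?d \<in> test_functions \<Omega>" using test_functions_partial_deriv \<phi> .
    have "(LINT x|M. (\<phi> x)\<^sup>2) = (LINT x|lborel. (\<phi> x)\<^sup>2)"
      using integral_mult_test_function(1)[OF continuous_test_function[OF \<phi>] \<phi>] by (simp add: power2_eq_square)
    also have "\<dots> \<le> C * (LINT x|lborel. (?d x)\<^sup>2)"
      unfolding C_def using poincare_inequality_test_function test_functions_mono[OF \<phi> R] .
    also have "(LINT x|lborel. (?d x)\<^sup>2) = (LINT x|M. (?d x)\<^sup>2)"
      using integral_mult_test_function(1)[OF continuous_test_function[OF d] d] by (simp add: power2_eq_square)
    also have "\<dots> \<le> (LINT x|M. (norm (grad \<phi> x))\<^sup>2)"
    proof (rule integral_mono)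
      show "integrable M (\<lambda>x. (?d x)\<^sup>2)" using L2_D(2)[OF L2_test_function[OF d]] by simp
      show "integrable M (\<lambda>x. (norm (grad \<phi> x))\<^sup>2)" using L2_D(2)[OF test_function_weak_gradient(1)[OF \<phi>]] .
      show "(?d x)\<^sup>2 \<le> (norm (grad \<phi> x))\<^sup>2" for x
        using component_sq_le[of "grad \<phi> x" 1] by (simp add: grad_def)
    qed
    also have "\<dots> = H10_inner \<Omega> \<phi> \<phi>"
      unfolding H10_inner_self using test_function_weak_gradient[OF \<phi>] H1_D(2)
      by (intro integral_L2_cong_AE[symmetric]) auto
    finally show ?thesis using C by (simp add: mult_left_mono)
  qed
  have "(LINT x|M. (u x)\<^sup>2) \<le> 4 * C * H10_inner \<Omega> u u" if u: "u \<in> H10 \<Omega>" for u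
  proof (rule field_le_epsilon)
    fix e :: real assume e: "e > 0"
    define k where "k = 4 * C + 2"
    have k: "k > 0" using C by (simp add: k_def)
    then obtain \<phi> where \<phi>: "\<phi> \<in> test_functions \<Omega>" "H1_sq (lincomb 1 \<phi> (-1) u) < e / k"
      using u e unfolding H10_iff by (meson divide_pos_pos)
    let ?w = "lincomb 1 \<phi> (-1) u"
    note H = test_function_weak_gradient(2)[OF \<phi>(1)] H10_imp_H1[OF u]
    have w: "?w \<in> H1 \<Omega>" by (rule H1_lincomb(1)[OF H])
    have "u = lincomb 1 \<phi> (-1) ?w" "\<phi> = lincomb 1 u 1 ?w" by (auto simp: lincomb_def)
    then have 1: "(LINT x|M. (u x)\<^sup>2) \<le> 2 * (LINT x|M. (\<phi> x)\<^sup>2) + 2 * (LINT x|M. (?w x)\<^sup>2)"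
      and 2: "H10_inner \<Omega> \<phi> \<phi> \<le> 2 * H10_inner \<Omega> u u + 2 * H10_inner \<Omega> ?w ?w"
      using sq_lincomb_le[OF H1_D(1)[OF H(1)] H1_D(1)[OF w], of 1 "-1"]
        gradient_sq_lincomb_le[OF H(2) w, of 1 1] by (simp_all add: H10_inner_self)
    have 3: "(LINT x|M. (?w x)\<^sup>2) \<le> e / k" "H10_inner \<Omega> ?w ?w \<le> e / k"
      using \<phi>(2) by (auto simp: H1_sq_def H10_inner_self) (smt (verit) integral_nonneg_AE AE_I2 zero_le_power2)+
    have "(LINT x|M. (u x)\<^sup>2) \<le> 2 * (C * H10_inner \<Omega> \<phi> \<phi>) + 2 * (e / k)"
      using 1 3 test[OF \<phi>(1)] by linarith
    also have "\<dots> \<le> 2 * (C * (2 * H10_inner \<Omega> u u + 2 * (e / k))) + 2 * (e / k)"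
      using 2 3 C by (intro add_mono mult_left_mono) auto
    also have "\<dots> = 4 * C * H10_inner \<Omega> u u + k * (e / k)"
      by (simp add: k_def algebra_simps add_divide_distrib)
    finally show "(LINT x|M. (u x)\<^sup>2) \<le> 4 * C * H10_inner \<Omega> u u + e" using k by simp
  qed
  then show ?thesis using C by (intro that[of "4 * C"]) auto
qed

lemma has_weak_gradient_limit:
  assumes u: "\<And>n. u n \<in> H1 \<Omega>" and w: "w \<in> L2 \<Omega>" and g: "g \<in> L2 \<Omega>"
    and lim: "(\<lambda>n. LINT x|M. (norm (u n x - w x))\<^sup>2) \<longlonglongrightarrow> 0"
      "(\<lambda>n. LINT x|M. (norm (wg (u n) x - g x))\<^sup>2) \<longlonglongrightarrow> 0"
  shows "has_weak_gradient \<Omega> w g"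
  unfolding has_weak_gradient_def
proof (intro ballI allI)
  fix \<phi> i assume \<phi>: "\<phi> \<in> test_functions \<Omega>"
  have conv: "(\<lambda>n. LINT x|M. f n x \<bullet> h x) \<longlonglongrightarrow> (LINT x|M. k x \<bullet> h x)"
    if "\<And>n. f n \<in> L2 \<Omega>" "k \<in> L2 \<Omega>" "h \<in> L2 \<Omega>" "(\<lambda>n. LINT x|M. (norm (f n x - k x))\<^sup>2) \<longlonglongrightarrow> 0"
    for f :: "nat \<Rightarrow> real^2 \<Rightarrow> 'b::euclidean_space" and k h
  proof -
    have "(\<lambda>n. (LINT x|M. (f n x - k x) \<bullet> h x)\<^sup>2) \<longlonglongrightarrow> 0"
    proof (rule tendsto_sandwich[OF _ _ tendsto_const])
      show "(\<lambda>n. (LINT x|M. (norm (f n x - k x))\<^sup>2) * (LINT x|M. (norm (h x))\<^sup>2)) \<longlonglongrightarrow> 0"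
        using tendsto_mult_right[OF that(4)] by fastforce
    qed (use L2_Cauchy_Schwarz[OF L2_diff(1)[OF that(1,2)] that(3)] in \<open>auto intro!: always_eventually\<close>)
    from tendsto_real_sqrt[OF this] have "(\<lambda>n. LINT x|M. (f n x - k x) \<bullet> h x) \<longlonglongrightarrow> 0"
      by (simp add: tendsto_rabs_zero_iff)
    moreover have "(LINT x|M. (f n x - k x) \<bullet> h x) = (LINT x|M. f n x \<bullet> h x) - (LINT x|M. k x \<bullet> h x)" for n
      using L2_inner_integrable[OF that(1,3)] L2_inner_integrable[OF that(2,3)] by (simp add: inner_diff_left)
    ultimately show ?thesis by (simp add: LIM_zero_iff)
  qed
  have test: "\<phi> \<in> L2 \<Omega>" "partial_deriv i \<phi> \<in> L2 \<Omega>" using L2_test_function test_functions_partial_deriv \<phi> by blast+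
  have "(\<lambda>x. \<phi> x *\<^sub>R axis i 1 :: real^2) \<in> L2 \<Omega>"
    using test(1) by (auto simp: L2_def norm_axis_1 intro: borel_measurable_scaleR)
  from conv[OF H1_D(2)[OF u] g this lim(2)]
  have "(\<lambda>n. LINT x|M. wg (u n) x $ i * \<phi> x) \<longlonglongrightarrow> (LINT x|M. g x $ i * \<phi> x)"
    by (simp add: inner_axis mult.commute)
  then have "(\<lambda>n. - (LINT x|M. wg (u n) x $ i * \<phi> x)) \<longlonglongrightarrow> - (LINT x|M. g x $ i * \<phi> x)"
    by (rule tendsto_minus)
  moreover have "(\<lambda>n. LINT x|M. u n x * partial_deriv i \<phi> x) \<longlonglongrightarrow> (LINT x|M. w x * partial_deriv i \<phi> x)"
    using conv[OF H1_D(1)[OF u] w test(2) lim(1)] by simp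
  moreover have "(LINT x|M. u n x * partial_deriv i \<phi> x) = - (LINT x|M. wg (u n) x $ i * \<phi> x)" for n
    using H1_D(3)[OF u] \<phi> unfolding has_weak_gradient_def by auto
  ultimately show "(LINT x|M. w x * partial_deriv i \<phi> x) = - (LINT x|M. g x $ i * \<phi> x)"
    using LIMSEQ_unique by simp
qed

text \<open>By the Poincare inequality, a sequence that is Cauchy for the Dirichlet norm converges in
  \<open>L\<^sup>2\<close> together with its gradients, and the limit of the gradients is the weak gradient of the
  limit. A diagonal choice of test functions approximates the limit.\<close>

lemma H10_complete:
  assumes f: "\<And>n. f n \<in> H10 \<Omega>"
    and cauchy: "\<And>e. e > 0 \<Longrightarrow> \<exists>N. \<forall>i\<ge>N. \<forall>j\<ge>N.
      H10_inner \<Omega> (lincomb 1 (f i) (-1) (f j)) (lincomb 1 (f i) (-1) (f j)) < e"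
  shows "\<exists>g\<in>H10 \<Omega>. (\<lambda>n. H10_inner \<Omega> (lincomb 1 (f n) (-1) g) (lincomb 1 (f n) (-1) g)) \<longlonglongrightarrow> 0"
proof -
  obtain C where C: "C \<ge> 0" "\<And>u. u \<in> H10 \<Omega> \<Longrightarrow> (LINT x|M. (u x)\<^sup>2) \<le> C * H10_inner \<Omega> u u"
    using poincare_inequality by blast
  have H: "f n \<in> H1 \<Omega>" for n using H10_imp_H1 f by blast
  note D = H1_D[OF H]
  have wg_diff: "(LINT x|M. (norm (wg (lincomb 1 u (-1) v) x))\<^sup>2) = (LINT x|M. (norm (wg u x - wg v x))\<^sup>2)"
    if "u \<in> H1 \<Omega>" "v \<in> H1 \<Omega>" for u v
    using integral_L2_cong_AE[OF H1_D(2)[OF H1_lincomb(1)[OF that]] L2_lincomb(1)[OF H1_D(2)[OF that(1)] H1_D(2)[OF that(2)]]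
      H1_lincomb(2)[OF that], of 1 "-1"] by simp
  have "\<exists>N. \<forall>i\<ge>N. \<forall>j\<ge>N. (LINT x|M. (norm (wg (f i) x - wg (f j) x))\<^sup>2) < e" if "e > 0" for e
    using cauchy[OF that] wg_diff[OF H H] by (simp add: H10_inner_self)
  from L2_complete[OF D(2) this] obtain g where g: "g \<in> L2 \<Omega>" "(\<lambda>n. LINT x|M. (norm (wg (f n) x - g x))\<^sup>2) \<longlonglongrightarrow> 0"
    by blast
  have "\<exists>N. \<forall>i\<ge>N. \<forall>j\<ge>N. (LINT x|M. (norm (f i x - f j x))\<^sup>2) < e" if e: "e > 0" for e
  proof -
    obtain N where N: "\<forall>i\<ge>N. \<forall>j\<ge>N. H10_inner \<Omega> (lincomb 1 (f i) (-1) (f j)) (lincomb 1 (f i) (-1) (f j)) < e / (C + 1)"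
      using cauchy[of "e / (C + 1)"] e C(1) by auto
    have "(LINT x|M. (norm (f i x - f j x))\<^sup>2) < e" if ij: "i \<ge> N" "j \<ge> N" for i j
    proof -
      let ?h = "H10_inner \<Omega> (lincomb 1 (f i) (-1) (f j)) (lincomb 1 (f i) (-1) (f j))"
      have "(LINT x|M. (norm (f i x - f j x))\<^sup>2) \<le> C * ?h"
        using C(2)[OF H10_lincomb[OF f f], of 1 i "-1" j] by (simp add: lincomb_def)
      also have "\<dots> \<le> (C + 1) * ?h" by (intro mult_right_mono) (auto simp: H10_inner_self)
      also have "\<dots> < (C + 1) * (e / (C + 1))" using N ij C(1) by (intro mult_strict_left_mono) auto
      finally show ?thesis using C(1) by simp
    qed
    then show ?thesis by blast
  qed
  from L2_complete[OF D(1) this] obtain w where w: "w \<in> L2 \<Omega>" "(\<lambda>n. LINT x|M. (norm (f n x - w x))\<^sup>2) \<longlonglongrightarrow> 0"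
    by blast
  note W = weak_gradient_AE_eq[OF w(1) g(1) has_weak_gradient_limit[OF H w(1) g(1) w(2) g(2)]]
  have conv: "(\<lambda>n. H10_inner \<Omega> (lincomb 1 (f n) (-1) w) (lincomb 1 (f n) (-1) w)) \<longlonglongrightarrow> 0"
  proof -
    have "(LINT x|M. (norm (wg (f n) x - wg w x))\<^sup>2) = (LINT x|M. (norm (wg (f n) x - g x))\<^sup>2)" for n
      using W by (intro integral_L2_cong_AE L2_diff(1) D H1_D(2)[OF W(1)] g(1)) auto
    then show ?thesis using g(2) by (simp add: H10_inner_self wg_diff[OF H W(1)])
  qed
  have "(\<lambda>n. H1_sq (lincomb 1 (f n) (-1) w)) \<longlonglongrightarrow> 0"
    using tendsto_add[OF w(2) conv] by (simp add: H1_sq_def H10_inner_self lincomb_def)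
  moreover have "w \<in> H10 \<Omega>"
    unfolding H10_iff
  proof (intro conjI allI impI W(1))
    fix e :: real assume e: "e > 0"
    then obtain n where n: "H1_sq (lincomb 1 (f n) (-1) w) < e / 4"
      using order_tendstoD(2)[OF calculation, of "e / 4"] by (auto simp: eventually_sequentially)
    obtain \<phi> where \<phi>: "\<phi> \<in> test_functions \<Omega>" "H1_sq (lincomb 1 \<phi> (-1) (f n)) < e / 4"
      using f[of n] e unfolding H10_iff by (meson divide_pos_pos zero_less_numeral)
    have eq: "lincomb 1 \<phi> (-1) w = lincomb 1 (lincomb 1 \<phi> (-1) (f n)) 1 (lincomb 1 (f n) (-1) w)"
      by (auto simp: lincomb_def)
    have "H1_sq (lincomb 1 \<phi> (-1) w) \<le> 2 * 1\<^sup>2 * H1_sq (lincomb 1 \<phi> (-1) (f n)) + 2 * 1\<^sup>2 * H1_sq (lincomb 1 (f n) (-1) w)"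
      unfolding eq by (intro H1_sq_lincomb_le H1_lincomb(1) H W(1) test_function_weak_gradient(2) \<phi>(1))
    then have "H1_sq (lincomb 1 \<phi> (-1) w) < e" using n \<phi>(2) by simp
    then show "\<exists>\<phi>\<in>test_functions \<Omega>. H1_sq (lincomb 1 \<phi> (-1) w) < e" using \<phi>(1) by blast
  qed
  ultimately show ?thesis using conv by blast
qed

sublocale semi_hilbert "H10 \<Omega>" "H10_inner \<Omega>"
proof
  have "(\<lambda>x. 0) \<in> test_functions \<Omega>"
    by (rule test_functionsI[where K="{}"]) (auto intro: smooth_on_const)
  then show "H10 \<Omega> \<noteq> {}" using test_functions_subset_H10 by blast
  show "H10_inner \<Omega> (lincomb a u b v) w = a * H10_inner \<Omega> u w + b * H10_inner \<Omega> v w"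
    if "u \<in> H10 \<Omega>" "v \<in> H10 \<Omega>" "w \<in> H10 \<Omega>" for u v w a b
    unfolding H10_inner_def using that H10_imp_H1 by (intro dirichlet_form_lincomb) auto
  show "H10_inner \<Omega> u v = H10_inner \<Omega> v u" for u v
    unfolding H10_inner_def by (rule dirichlet_form_sym)
  show "0 \<le> H10_inner \<Omega> u u" for u by (simp add: H10_inner_self)
qed (use H10_lincomb H10_complete in auto)

text \<open>Being equal almost everywhere is the same as being at distance zero, again by the Poincare
  inequality. Hence the classes of the semi-Hilbert space are those used for the spectrum.\<close>

lemma ae_eq_iff:
  assumes "u \<in> H10 \<Omega>" "v \<in> H10 \<Omega>"
  shows "ae_eq \<Omega> u v \<longleftrightarrow> H10_inner \<Omega> (lincomb 1 u (-1) v) (lincomb 1 u (-1) v) = 0"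
proof
  let ?w = "lincomb 1 u (-1) v"
  have w: "?w \<in> H10 \<Omega>" using H10_lincomb assms by blast
  note D = H1_D[OF H10_imp_H1[OF w]]
  {
    assume "ae_eq \<Omega> u v"
    then have "AE x in M. ?w x = 0" unfolding ae_eq_def by eventually_elim (simp add: lincomb_def)
    moreover have "has_weak_gradient \<Omega> (\<lambda>x. 0) (\<lambda>x. 0)" by (simp add: has_weak_gradient_def)
    ultimately have "AE x in M. wg ?w x = 0"
      by (intro has_weak_gradient_unique[OF D(2) L2_const D(3) _ _ D(1) L2_const])
    then show "H10_inner \<Omega> ?w ?w = 0"
      using integral_L2_cong_AE[OF D(2) L2_const, of 0] by (simp add: H10_inner_self)
  }
  assume 0: "H10_inner \<Omega> ?w ?w = 0"
  obtain C where "(LINT x|M. (?w x)\<^sup>2) \<le> C * H10_inner \<Omega> ?w ?w"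
    using poincare_inequality w by metis
  then have "(LINT x|M. (norm (?w x))\<^sup>2) = 0" using 0 by (simp add: order_antisym)
  from L2_AE_eq_0[OF D(1) this] show "ae_eq \<Omega> u v"
    unfolding ae_eq_def by eventually_elim (simp add: lincomb_def)
qed

section \<open>The spectrum of the Poincare variational operator\<close>

lemma sym_form_dirichlet_form:
  assumes "E \<in> sets lebesgue" "E \<subseteq> \<Omega>"
  shows "sym_form (dirichlet_form \<Omega> E)"
  using dirichlet_form_lincomb[OF assms] H10_imp_H1 dirichlet_form_sym by (auto simp: sym_form_def)

lemma poincare_op:
  assumes E: "E \<in> sets lebesgue" "E \<subseteq> \<Omega>" and u: "u \<in> H10 \<Omega>"
  shows "poincare_op \<Omega> E u \<in> H10 \<Omega>"
    and "v \<in> H10 \<Omega> \<Longrightarrow> H10_inner \<Omega> (poincare_op \<Omega> E u) v = dirichlet_form \<Omega> E u v"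
proof -
  note b = sym_form_dirichlet_form[OF E]
  note bounds = dirichlet_form_bounds[OF E H10_imp_H1]
  have "\<exists>w\<in>H10 \<Omega>. \<forall>v\<in>H10 \<Omega>. H10_inner \<Omega> w v = dirichlet_form \<Omega> E u v"
  proof (rule lax_milgram[OF sym_form_ip, where m=1 and B=1 and K="H10_inner \<Omega> u u"])
    fix v assume v: "v \<in> H10 \<Omega>"
    have "(dirichlet_form \<Omega> E u v)\<^sup>2 \<le> dirichlet_form \<Omega> E u u * dirichlet_form \<Omega> E v v"
      by (rule sym_form_Cauchy_Schwarz[OF b bounds(1) u v])
    also have "\<dots> \<le> H10_inner \<Omega> u u * H10_inner \<Omega> v v"
      using bounds u v ip_nonneg by (intro mult_mono) auto
    finally show "(dirichlet_form \<Omega> E u v)\<^sup>2 \<le> H10_inner \<Omega> u u * H10_inner \<Omega> v v" .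
  qed (use sym_form_right[OF b] u in auto)
  then have "\<exists>w. w \<in> H10 \<Omega> \<and> (\<forall>v\<in>H10 \<Omega>. H10_inner \<Omega> w v = dirichlet_form \<Omega> E u v)" by blast
  from someI_ex[OF this, folded poincare_op_def]
  show "poincare_op \<Omega> E u \<in> H10 \<Omega>"
    and "v \<in> H10 \<Omega> \<Longrightarrow> H10_inner \<Omega> (poincare_op \<Omega> E u) v = dirichlet_form \<Omega> E u v" by auto
qed

lemma positive_contraction_poincare_op:
  assumes E: "E \<in> sets lebesgue" "E \<subseteq> \<Omega>"
  shows "positive_contraction (H10 \<Omega>) (H10_inner \<Omega>) (poincare_op \<Omega> E) (dirichlet_form \<Omega> E)"
  by unfold_locales (use sym_form_dirichlet_form[OF E] dirichlet_form_bounds[OF E H10_imp_H1] poincare_op[OF E] in auto)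

lemma spectrum_poincare_op_subset:
  assumes E: "E \<in> sets lebesgue" "E \<subseteq> \<Omega>"
  shows "spectrum \<Omega> (poincare_op \<Omega> E) \<subseteq> {0..1}"
proof
  interpret P: positive_contraction "H10 \<Omega>" "H10_inner \<Omega>" "poincare_op \<Omega> E" "dirichlet_form \<Omega> E"
    by (rule positive_contraction_poincare_op[OF E])
  fix \<beta> assume \<beta>: "\<beta> \<in> spectrum \<Omega> (poincare_op \<Omega> E)"
  show "\<beta> \<in> {0..1}"
  proof (rule ccontr)
    assume "\<beta> \<notin> {0..1}"
    then have out: "\<beta> < 0 \<or> 1 < \<beta>" by auto
    let ?n = "\<lambda>u. H10_inner \<Omega> u u"
    have A: "(\<lambda>u x. poincare_op \<Omega> E u x - \<beta> * u x) = P.R \<beta>"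
      by (simp add: lincomb_def)
    obtain c where c: "c > 0" "\<And>u. u \<in> H10 \<Omega> \<Longrightarrow> c * ?n u \<le> ?n (P.R \<beta> u)"
      using P.resolvent_outside_unit_interval(1)[OF out] by blast
    have "boundedly_invertible \<Omega> (P.R \<beta>)"
      unfolding boundedly_invertible_def
    proof (intro conjI ballI impI)
      fix u v assume uv: "u \<in> H10 \<Omega>" "v \<in> H10 \<Omega>" and eq: "ae_eq \<Omega> (P.R \<beta> u) (P.R \<beta> v)"
      let ?w = "lincomb 1 u (-1) v" and ?d = "lincomb 1 (P.R \<beta> u) (-1) (P.R \<beta> v)"
      have w: "?w \<in> H10 \<Omega>" and d: "?d \<in> H10 \<Omega>" using uv H10_lincomb P.R_V by auto
      have "H10_inner \<Omega> (P.R \<beta> ?w) z = H10_inner \<Omega> ?d z" if z: "z \<in> H10 \<Omega>" for z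
        using P.ip_R[OF w z, of \<beta>] P.ip_R[OF uv(1) z, of \<beta>] P.ip_R[OF uv(2) z, of \<beta>]
          ip_lin[OF P.R_V[OF uv(1)] P.R_V[OF uv(2)] z, of 1 \<beta> "-1" \<beta>] ip_lin[OF uv z, of 1 "-1"]
          sym_form_left[OF P.d uv z, of 1 "-1"]
        by (simp add: algebra_simps)
      then have "?n (P.R \<beta> ?w) = ?n ?d" using P.R_V[OF w] d ip_sym by metis
      also have "\<dots> = 0" using eq ae_eq_iff[OF P.R_V[OF uv(1)] P.R_V[OF uv(2)]] by blast
      finally have "c * ?n ?w \<le> 0" using c(2)[OF w] by simp
      then have "?n ?w = 0" using c(1) ip_nonneg[OF w] by (simp add: mult_le_0_iff)
      then show "ae_eq \<Omega> u v" using ae_eq_iff uv by blast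
    next
      fix f assume f: "f \<in> H10 \<Omega>"
      obtain u where "u \<in> H10 \<Omega>" "?n (lincomb 1 (P.R \<beta> u) (-1) f) = 0"
        using P.resolvent_outside_unit_interval(2)[OF out f] by blast
      then show "\<exists>u\<in>H10 \<Omega>. ae_eq \<Omega> (P.R \<beta> u) f" using ae_eq_iff[OF P.R_V f] by blast
    next
      show "\<exists>C. \<forall>u\<in>H10 \<Omega>. H10_norm \<Omega> u \<le> C * H10_norm \<Omega> (P.R \<beta> u)"
      proof (intro exI ballI)
        fix u assume u: "u \<in> H10 \<Omega>"
        have "?n u \<le> (1 / c) * ?n (P.R \<beta> u)" using c(1) c(2)[OF u] by (simp add: field_simps)
        then have "sqrt (?n u) \<le> sqrt ((1 / c) * ?n (P.R \<beta> u))" by (rule real_sqrt_le_mono)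
        then show "H10_norm \<Omega> u \<le> sqrt (1 / c) * H10_norm \<Omega> (P.R \<beta> u)"
          by (simp only: H10_norm_def real_sqrt_mult)
      qed
    qed
    then show False using \<beta> A by (simp add: spectrum_def)
  qed
qed

text \<open>Moving the derivatives of \<open>v\<close> to \<open>f\<close> leaves the commutator of second derivatives of \<open>f\<close>.
  It vanishes by the weak symmetry of second derivatives and the fundamental lemma.\<close>

lemma integral_rot_grad_eq_0:
  assumes f: "f \<in> test_functions \<Omega>" and v: "v \<in> H1 \<Omega>"
  shows "(LINT x|M. rot (grad f x) \<bullet> wg v x) = 0"
proof -
  let ?d = "\<lambda>i. partial_deriv i f" and ?d2 = "\<lambda>i j. partial_deriv i (partial_deriv j f)"
  have d: "?d i \<in> test_functions \<Omega>" and d2: "?d2 i j \<in> test_functions \<Omega>" for i j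
    using f test_functions_partial_deriv by blast+
  note D = H1_D[OF v]
  have "AE x in M. ?d2 2 1 x - ?d2 1 2 x = 0"
  proof (rule AE_eq_0_if_orthogonal_to_test_functions)
    show "integrable M (\<lambda>x. ?d2 2 1 x - ?d2 1 2 x)"
      using d2 L2_test_function L2_integrable by (intro Bochner_Integration.integrable_diff) blast+
    fix \<phi> assume \<phi>: "\<phi> \<in> test_functions \<Omega>"
    have int: "integrable M (\<lambda>x. ?d2 i j x * \<phi> x)" for i j
      using integral_mult_test_function(2) continuous_test_function d2 \<phi> by blast
    have "(LINT x|M. ?d2 i j x * \<phi> x) = - (LINT x|lborel. ?d j x * partial_deriv i \<phi> x)" for i j
      using integration_by_parts[OF test_functions_smooth[OF d] \<phi>, of j i]
        integral_mult_test_function(1)[OF continuous_test_function[OF d2] \<phi>, of i j] by simp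
    then show "(LINT x|M. (?d2 2 1 x - ?d2 1 2 x) * \<phi> x) = 0"
      using integral_partial_deriv_swap[OF f \<phi>, of 1 2] int by (simp add: left_diff_distrib)
  qed
  then have "(LINT x|M. v x * ?d2 2 1 x) = (LINT x|M. v x * ?d2 1 2 x)"
    by (intro integral_cong_AE) (use L2_D(1)[OF D(1)] L2_D(1)[OF L2_test_function[OF d2]] in auto)
  moreover have "(LINT x|M. v x * ?d2 i j x) = - (LINT x|M. wg v x $ i * ?d j x)" for i j
    using D(3) d unfolding has_weak_gradient_def by blast
  moreover have "integrable M (\<lambda>x. wg v x $ i * ?d j x)" for i j
    by (intro L2_mult_integrable L2_component D L2_test_function d)
  moreover have "rot (grad f x) \<bullet> wg v x = wg v x $ 2 * ?d 1 x - wg v x $ 1 * ?d 2 x" for x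
    by (simp add: inner_vec_def sum_2 grad_def)
  ultimately show ?thesis by simp
qed

lemma flux_defect_L2:
  assumes E: "E \<in> sets lebesgue" and u: "u \<in> test_functions \<Omega>" "f \<in> test_functions \<Omega>"
  shows "flux_defect E \<beta> u f \<in> L2 \<Omega>" "(\<lambda>x. rot (grad f x)) \<in> L2 \<Omega>"
    "(\<lambda>x. indicator E x *\<^sub>R grad u x) \<in> L2 \<Omega>"
proof -
  note G = test_function_weak_gradient(1)[OF u(1)] test_function_weak_gradient(1)[OF u(2)]
  have "continuous_on UNIV (\<lambda>x. if i = 1 then - grad f x $ 2 else grad f x $ 1)" for i :: 2
    using continuous_grad[OF u(2)] by (cases "i = 1") (auto intro!: continuous_intros)
  then have "continuous_on UNIV (\<lambda>x. rot (grad f x))"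
    unfolding rot_def by (rule continuous_on_vec_lambda)
  then have "(\<lambda>x. rot (grad f x)) \<in> borel_measurable M"
    by (intro measurable_restrict_space1 measurable_completion) (auto intro!: borel_measurable_continuous_onI)
  then show 1: "(\<lambda>x. rot (grad f x)) \<in> L2 \<Omega>" using L2_D(2)[OF G(2)] by (simp add: L2_def)
  have "indicat_real E \<in> borel_measurable M"
    using E by (intro measurable_restrict_space1) auto
  then have m: "(\<lambda>x. indicat_real E x *\<^sub>R grad u x) \<in> borel_measurable M"
    using L2_D(1)[OF G(1)] by (rule borel_measurable_scaleR)
  have "integrable M (\<lambda>x. (norm (indicat_real E x *\<^sub>R grad u x))\<^sup>2)"
  proof (rule Bochner_Integration.integrable_bound[OF L2_D(2)[OF G(1)]])
    show "(\<lambda>x. (norm (indicat_real E x *\<^sub>R grad u x))\<^sup>2) \<in> borel_measurable M"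
      using measurable_compose[OF m, of norm borel] by (intro borel_measurable_power) simp
  qed (auto simp: indicator_def)
  then show 2: "(\<lambda>x. indicator E x *\<^sub>R grad u x) \<in> L2 \<Omega>" using m by (simp add: L2_def)
  have "flux_defect E \<beta> u f = (\<lambda>x. (indicator E x *\<^sub>R grad u x - \<beta> *\<^sub>R grad u x) - rot (grad f x))"
    by (auto simp: flux_defect_def scaleR_diff_left)
  then show "flux_defect E \<beta> u f \<in> L2 \<Omega>" using L2_diff(1)[OF L2_diff(1)[OF 2 L2_scale[OF G(1), of \<beta>]] 1] by simp
qed

lemma in_spectrum_if_not_bounded_below:
  assumes E: "E \<in> sets lebesgue" "E \<subseteq> \<Omega>"
    and nb: "\<not> (\<exists>c>0. \<forall>v\<in>H10 \<Omega>. c * H10_inner \<Omega> v v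
      \<le> H10_inner \<Omega> (lincomb 1 (poincare_op \<Omega> E v) (- \<beta>) v) (lincomb 1 (poincare_op \<Omega> E v) (- \<beta>) v))"
  shows "\<beta> \<in> spectrum \<Omega> (poincare_op \<Omega> E)"
proof -
  interpret P: positive_contraction "H10 \<Omega>" "H10_inner \<Omega>" "poincare_op \<Omega> E" "dirichlet_form \<Omega> E"
    by (rule positive_contraction_poincare_op[OF E])
  let ?n = "\<lambda>u. H10_inner \<Omega> u u"
  have "\<not> boundedly_invertible \<Omega> (P.R \<beta>)"
  proof
    assume "boundedly_invertible \<Omega> (P.R \<beta>)"
    then obtain C where C: "\<And>v. v \<in> H10 \<Omega> \<Longrightarrow> H10_norm \<Omega> v \<le> C * H10_norm \<Omega> (P.R \<beta> v)"
      unfolding boundedly_invertible_def by blast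
    have "1 / (C\<^sup>2 + 1) * ?n v \<le> ?n (P.R \<beta> v)" if v: "v \<in> H10 \<Omega>" for v
    proof -
      have nn: "0 \<le> ?n v" "0 \<le> ?n (P.R \<beta> v)" using ip_nonneg v P.R_V by auto
      have "?n v = (H10_norm \<Omega> v)\<^sup>2" using nn by (simp add: H10_norm_def)
      also have "\<dots> \<le> (C * H10_norm \<Omega> (P.R \<beta> v))\<^sup>2"
        using C[OF v] nn by (intro power_mono) (auto simp: H10_norm_def)
      also have "\<dots> = C\<^sup>2 * ?n (P.R \<beta> v)" using nn by (simp add: H10_norm_def power_mult_distrib)
      also have "\<dots> \<le> (C\<^sup>2 + 1) * ?n (P.R \<beta> v)" using nn by (intro mult_right_mono) auto
      finally show ?thesis by (simp add: add_nonneg_pos pos_divide_le_eq mult.commute)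
    qed
    moreover have "1 / (C\<^sup>2 + 1) > 0" by (simp add: add_nonneg_pos)
    ultimately show False using nb by blast
  qed
  moreover have "(\<lambda>u x. poincare_op \<Omega> E u x - \<beta> * u x) = P.R \<beta>" by (simp add: lincomb_def)
  ultimately show ?thesis by (simp add: spectrum_def)
qed

text \<open>Tested against \<open>v\<close>, the residual is the integral of \<open>a \<nabla>u \<bullet> \<nabla>v\<close>. The rotated gradient
  drops out, and the flux defect remains.\<close>

lemma quasimode_residual:
  assumes E: "E \<in> sets lebesgue" "E \<subseteq> \<Omega>" and u: "u \<in> test_functions \<Omega>" and f: "f \<in> test_functions \<Omega>"
    and le: "(LINT x|M. (norm (flux_defect E \<beta> u f x))\<^sup>2) \<le> \<epsilon>\<^sup>2 * (LINT x|M. (norm (grad u x))\<^sup>2)"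
  shows "H10_inner \<Omega> (lincomb 1 (poincare_op \<Omega> E u) (- \<beta>) u) (lincomb 1 (poincare_op \<Omega> E u) (- \<beta>) u)
      \<le> \<epsilon>\<^sup>2 * H10_inner \<Omega> u u"
    and "H10_inner \<Omega> u u = (LINT x|M. (norm (grad u x))\<^sup>2)"
proof -
  interpret P: positive_contraction "H10 \<Omega>" "H10_inner \<Omega>" "poincare_op \<Omega> E" "dirichlet_form \<Omega> E"
    by (rule positive_contraction_poincare_op[OF E])
  let ?n = "\<lambda>u. H10_inner \<Omega> u u" and ?F = "flux_defect E \<beta> u f"
  note F = flux_defect_L2(1)[OF E(1) u f, of \<beta>]
  have uH: "u \<in> H10 \<Omega>" using test_functions_subset_H10 u .
  show n_u: "?n u = (LINT x|M. (norm (grad u x))\<^sup>2)"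
    unfolding H10_inner_self
    by (intro integral_L2_cong_AE test_function_weak_gradient u H1_D(2)) 
  have form: "dirichlet_form \<Omega> E u v - \<beta> * H10_inner \<Omega> u v = (LINT x|M. ?F x \<bullet> wg v x)" if v: "v \<in> H10 \<Omega>" for v
  proof -
    note D = H1_D[OF H10_imp_H1[OF v]] and Du = H1_D[OF H10_imp_H1[OF uH]]
    have "dirichlet_form \<Omega> E u v - \<beta> * H10_inner \<Omega> u v
        = (LINT x|M. indicator E x * (wg u x \<bullet> wg v x) - \<beta> * (wg u x \<bullet> wg v x))"
      unfolding dirichlet_form_eq[OF E] H10_inner_eq
      using L2_indicator_inner_integrable[OF Du(2) D(2) E(1)] L2_inner_integrable[OF Du(2) D(2)] by simp
    also have "\<dots> = (LINT x|M. ?F x \<bullet> wg v x + rot (grad f x) \<bullet> wg v x)"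
    proof (rule integral_cong_AE)
      show "AE x in M. indicator E x * (wg u x \<bullet> wg v x) - \<beta> * (wg u x \<bullet> wg v x)
          = ?F x \<bullet> wg v x + rot (grad f x) \<bullet> wg v x"
        using test_function_weak_gradient(3)[OF u]
        by eventually_elim (simp add: flux_defect_def inner_diff_left algebra_simps)
    qed (use L2_indicator_inner_integrable[OF Du(2) D(2) E(1)] L2_inner_integrable[OF Du(2) D(2)]
         L2_inner_integrable[OF F D(2)] L2_inner_integrable[OF flux_defect_L2(2)[OF E(1) u f] D(2)] in auto)
    also have "\<dots> = (LINT x|M. ?F x \<bullet> wg v x)"
      using L2_inner_integrable[OF F D(2)] L2_inner_integrable[OF flux_defect_L2(2)[OF E(1) u f] D(2)]
        integral_rot_grad_eq_0[OF f H10_imp_H1[OF v]] by simp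
    finally show ?thesis .
  qed
  show "?n (P.R \<beta> u) \<le> \<epsilon>\<^sup>2 * ?n u"
  proof -
    let ?w = "P.R \<beta> u"
    have w: "?w \<in> H10 \<Omega>" using P.R_V uH .
    have "(?n ?w)\<^sup>2 = (LINT x|M. ?F x \<bullet> wg ?w x)\<^sup>2"
      using P.ip_R[OF uH w] form[OF w] by simp
    also have "\<dots> \<le> (LINT x|M. (norm (?F x))\<^sup>2) * ?n ?w"
      unfolding H10_inner_self by (intro L2_Cauchy_Schwarz F H1_D(2) H10_imp_H1 w)
    finally have "?n ?w * ?n ?w \<le> (LINT x|M. (norm (?F x))\<^sup>2) * ?n ?w" by (simp add: power2_eq_square)
    then have "?n ?w \<le> (LINT x|M. (norm (?F x))\<^sup>2)"
      using ip_nonneg[OF w] by (cases "?n ?w = 0") (auto simp: mult_le_cancel_right)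
    then show ?thesis using le n_u by simp
  qed
qed

lemma spectrum_near_quasimode:
  assumes E: "E \<in> sets lebesgue" "E \<subseteq> \<Omega>" and u: "u \<in> test_functions \<Omega>" and f: "f \<in> test_functions \<Omega>"
    and pos: "(LINT x|M. (norm (grad u x))\<^sup>2) > 0" and \<epsilon>: "0 \<le> \<epsilon>"
    and le: "(LINT x|M. (norm (flux_defect E \<beta> u f x))\<^sup>2) \<le> \<epsilon>\<^sup>2 * (LINT x|M. (norm (grad u x))\<^sup>2)"
  shows "\<exists>\<beta>'\<in>spectrum \<Omega> (poincare_op \<Omega> E). \<bar>\<beta>' - \<beta>\<bar> \<le> \<epsilon>"
proof -
  interpret P: positive_contraction "H10 \<Omega>" "H10_inner \<Omega>" "poincare_op \<Omega> E" "dirichlet_form \<Omega> E"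
    by (rule positive_contraction_poincare_op[OF E])
  note res = quasimode_residual[OF E u f le]
  have p: "0 < H10_inner \<Omega> u u" using pos res(2) by simp
  show ?thesis
    using P.spectrum_near_approximate_eigenvalue[OF test_functions_subset_H10[OF u] p res(1) \<epsilon>]
      in_spectrum_if_not_bounded_below[OF E] by blast
qed

end

section \<open>Quasi-modes at the corner\<close>

abbreviation has_grad :: "(real^2 \<Rightarrow> real) \<Rightarrow> real^2 \<Rightarrow> real^2 \<Rightarrow> bool" where
  "has_grad f v p \<equiv> (f has_derivative (\<lambda>h. v \<bullet> h)) (at p)"

lemma grad_eqI:
  assumes "has_grad f v p" shows "grad f p = v"
proof -
  have "(f has_derivative (\<lambda>h. \<Sum>i\<in>UNIV. v $ i * h $ i)) (at p)" using assms by (simp add: inner_vec_def)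
  from partial_deriv_eqI[OF this] show ?thesis by (simp add: grad_def vec_eq_iff)
qed

lemma has_grad_mult:
  assumes "has_grad f v p" "has_grad g w p"
  shows "has_grad (\<lambda>p. f p * g p) (f p *\<^sub>R w + g p *\<^sub>R v) p"
  by (rule has_derivative_eq_rhs[OF has_derivative_mult[OF assms]])
    (auto simp: inner_add_left mult.commute)

lemma has_grad_add:
  assumes "has_grad f v p" "has_grad g w p"
  shows "has_grad (\<lambda>p. f p + g p) (v + w) p"
  by (rule has_derivative_eq_rhs[OF has_derivative_add[OF assms]]) (auto simp: inner_add_left)

lemma has_grad_compose:
  assumes "has_grad f v p" "(h has_real_derivative h') (at (f p))"
  shows "has_grad (\<lambda>p. h (f p)) (h' *\<^sub>R v) p"
proof -
  have "(h has_derivative (\<lambda>y. h' * y)) (at (f p))" using assms(2) by (simp add: has_field_derivative_def)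
  from has_derivative_compose[OF assms(1) this] show ?thesis by simp
qed

lemma has_grad_const: "has_grad (\<lambda>p. c) 0 p"
  by simp

lemma has_grad_transform:
  assumes "has_grad f v p" "open S" "p \<in> S" "\<And>q. q \<in> S \<Longrightarrow> f q = g q"
  shows "has_grad g v p"
  using has_derivative_transform_within_open[OF assms(1-3)] assms(4) by blast

lemma has_grad_component: "has_grad (\<lambda>p. p $ i) (axis i 1) p"
  by (rule has_derivative_eq_rhs[OF bounded_linear_imp_has_derivative[OF bounded_linear_vec_nth]])
    (auto simp: inner_axis')

lemma has_derivative_step: "(step has_real_derivative deriv step x) (at x)"
  and deriv_step_eq_0: "x \<le> 0 \<or> 1 \<le> x \<Longrightarrow> deriv step x = 0"
  and bounded_deriv_step: "\<exists>K. \<forall>x. \<bar>deriv step x\<bar> \<le> K"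
proof -
  obtain step' K where s: "\<And>x. (step has_real_derivative step' x) (at x)" "\<And>x. \<bar>step' x\<bar> \<le> K"
    "\<And>x. x \<le> 0 \<Longrightarrow> step' x = 0" "\<And>x. x \<ge> 1 \<Longrightarrow> step' x = 0"
    using step_derivative by metis
  have "deriv step = step'" using DERIV_imp_deriv[OF s(1)] by blast
  then show "(step has_real_derivative deriv step x) (at x)" "x \<le> 0 \<or> 1 \<le> x \<Longrightarrow> deriv step x = 0"
    "\<exists>K. \<forall>x. \<bar>deriv step x\<bar> \<le> K" using s by auto
qed

lemma abs_step_le: "\<bar>step x\<bar> \<le> 1"
  using step_nonneg[of x] step_le_1[of x] by simp

subsection \<open>Polar coordinates\<close>

lemma rot_scaleR: "rot (c *\<^sub>R v) = c *\<^sub>R rot v" and rot_add: "rot (v + w) = rot v + rot w"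
  and rot_rot: "rot (rot v) = - v" and rot_0: "rot 0 = 0"
  by (simp_all add: vec_eq_iff forall_2)

lemma norm_sq_cart2: "(norm (p :: real^2))\<^sup>2 = (p $ 1)\<^sup>2 + (p $ 2)\<^sup>2"
  unfolding power2_norm_eq_inner by (simp add: inner_vec_def sum_2 power2_eq_square)

text \<open>The gradients of \<open>ln r\<close> and of the polar angle.\<close>

definition radial :: "real^2 \<Rightarrow> real^2" where "radial p = (1 / (norm p)\<^sup>2) *\<^sub>R p"
definition angular :: "real^2 \<Rightarrow> real^2" where "angular p = (1 / (norm p)\<^sup>2) *\<^sub>R rot p"

lemma rot_radial [simp]: "rot (radial p) = angular p" and rot_angular [simp]: "rot (angular p) = - radial p"
  by (simp_all add: radial_def angular_def rot_scaleR rot_rot)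

lemma norm_radial: "norm (radial p) = 1 / norm p" and norm_angular: "norm (angular p) = 1 / norm p"
  by (simp_all add: radial_def angular_def power2_eq_square)

lemma inner_radial_angular: "radial p \<bullet> angular p = 0"
  by (simp add: radial_def angular_def inner_vec_def sum_2)

lemma norm_polar_le: "norm (a *\<^sub>R radial p + b *\<^sub>R angular p) \<le> (\<bar>a\<bar> + \<bar>b\<bar>) / norm p"
  using norm_triangle_ineq[of "a *\<^sub>R radial p" "b *\<^sub>R angular p"]
  by (simp add: norm_radial norm_angular add_divide_distrib)

lemma norm_polar_ge: "p \<noteq> 0 \<Longrightarrow> a\<^sup>2 / (norm p)\<^sup>2 \<le> (norm (a *\<^sub>R radial p + b *\<^sub>R angular p))\<^sup>2"
proof -
  have "(norm (a *\<^sub>R radial p + b *\<^sub>R angular p))\<^sup>2 = a\<^sup>2 * (norm (radial p))\<^sup>2 + b\<^sup>2 * (norm (angular p))\<^sup>2"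
    unfolding power2_norm_eq_inner
    by (simp add: inner_add_left inner_add_right inner_radial_angular inner_commute[of "angular p" "radial p"] power2_eq_square)
  then show ?thesis by (simp add: norm_radial norm_angular power_divide)
qed

lemma has_grad_ln_norm:
  assumes "p \<noteq> 0" shows "has_grad (\<lambda>p. ln (norm p)) (radial p) p"
proof -
  have n: "(norm has_derivative (\<lambda>h. sgn p \<bullet> h)) (at p)"
    using has_derivative_norm[OF assms] by (simp add: inner_commute)
  from has_grad_compose[OF n DERIV_ln, of] assms
  show ?thesis by (simp add: radial_def sgn_div_norm power2_eq_square divide_inverse)
qed

lemma smooth_on_ln_norm:
  assumes "open S" "0 \<notin> S" shows "smooth_on (\<lambda>p. ln (norm p)) S"
proof -
  have 1: "smooth_on (\<lambda>p. (1/2) * ln (p $ 1 * p $ 1 + p $ 2 * p $ 2)) S"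
  proof (intro smooth_on_mult smooth_on_const smooth_on_ln smooth_on_add smooth_on_component assms(1))
    fix p :: "real^2" assume "p \<in> S"
    then have "0 < (norm p)\<^sup>2" using assms(2) by auto
    then show "0 < p $ 1 * p $ 1 + p $ 2 * p $ 2" unfolding norm_sq_cart2 unfolding power2_eq_square .
  qed
  have 2: "(1/2) * ln (p $ 1 * p $ 1 + p $ 2 * p $ 2) = ln (norm p)" if "p \<in> S" for p
  proof -
    have "norm p > 0" using that assms(2) by auto
    moreover have "p $ 1 * p $ 1 + p $ 2 * p $ 2 = norm p ^ 2"
      unfolding norm_sq_cart2 unfolding power2_eq_square ..
    ultimately show ?thesis by (simp add: ln_realpow)
  qed
  show ?thesis
    by (rule iffD1[OF smooth_on_cong[OF 2 assms(1)] 1])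
qed

lemma has_grad_arctan_quotient:
  assumes "p $ 1 \<noteq> 0"
  shows "has_grad (\<lambda>p. arctan (p $ 2 / p $ 1)) (angular p) p"
proof -
  have "((\<lambda>p. p $ 2 / p $ 1) has_derivative
      (\<lambda>h. (axis 2 1 \<bullet> h * p $ 1 - p $ 2 * (axis 1 1 \<bullet> h)) / (p $ 1 * p $ 1))) (at p)"
    by (rule has_derivative_divide'[OF has_grad_component has_grad_component assms])
  moreover have "(axis 2 1 \<bullet> h * p $ 1 - p $ 2 * (axis 1 1 \<bullet> h)) / (p $ 1 * p $ 1) = ((1 / (p $ 1)\<^sup>2) *\<^sub>R rot p) \<bullet> h" for h
    using assms by (simp add: inner_axis' inner_vec_def[of "rot p"] sum_2 power2_eq_square field_simps)
  ultimately have "has_grad (\<lambda>p. p $ 2 / p $ 1) ((1 / (p $ 1)\<^sup>2) *\<^sub>R rot p) p" by simp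
  from has_grad_compose[OF this DERIV_arctan]
  have "has_grad (\<lambda>p. arctan (p $ 2 / p $ 1)) (inverse (1 + (p $ 2 / p $ 1)\<^sup>2) *\<^sub>R (1 / (p $ 1)\<^sup>2) *\<^sub>R rot p) p" .
  moreover have "inverse (1 + (p $ 2 / p $ 1)\<^sup>2) * (1 / (p $ 1)\<^sup>2) = 1 / (norm p)\<^sup>2"
    unfolding norm_sq_cart2 using assms by (simp add: field_simps)
  ultimately show ?thesis by (simp only: scaleR_scaleR scaleR_minus_right angular_def)
qed

lemma has_grad_arctan_quotient':
  assumes "p $ 2 \<noteq> 0"
  shows "has_grad (\<lambda>p. arctan (p $ 1 / p $ 2)) (- angular p) p"
proof -
  have "((\<lambda>p. p $ 1 / p $ 2) has_derivative
      (\<lambda>h. (axis 1 1 \<bullet> h * p $ 2 - p $ 1 * (axis 2 1 \<bullet> h)) / (p $ 2 * p $ 2))) (at p)"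
    by (rule has_derivative_divide'[OF has_grad_component has_grad_component assms])
  moreover have "(axis 1 1 \<bullet> h * p $ 2 - p $ 1 * (axis 2 1 \<bullet> h)) / (p $ 2 * p $ 2) = ((1 / (p $ 2)\<^sup>2) *\<^sub>R - rot p) \<bullet> h" for h
    using assms by (simp add: inner_axis' inner_vec_def[of "rot p"] sum_2 power2_eq_square field_simps)
  ultimately have "has_grad (\<lambda>p. p $ 1 / p $ 2) ((1 / (p $ 2)\<^sup>2) *\<^sub>R - rot p) p" by simp
  from has_grad_compose[OF this DERIV_arctan]
  have "has_grad (\<lambda>p. arctan (p $ 1 / p $ 2)) (inverse (1 + (p $ 1 / p $ 2)\<^sup>2) *\<^sub>R (1 / (p $ 2)\<^sup>2) *\<^sub>R - rot p) p" .
  moreover have "inverse (1 + (p $ 1 / p $ 2)\<^sup>2) * (1 / (p $ 2)\<^sup>2) = 1 / (norm p)\<^sup>2"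
    unfolding norm_sq_cart2 using assms by (simp add: field_simps)
  ultimately show ?thesis by (simp only: scaleR_scaleR scaleR_minus_right angular_def)
qed

lemma open_component_ne: "open {p :: real^2. p $ i \<noteq> 0}"
  by (intro open_Collect_neq continuous_intros)

lemma has_grad_sgn_mult:
  assumes "has_grad f v p" "p $ i \<noteq> 0"
  shows "has_grad (\<lambda>p. sgn (p $ i) * f p) (sgn (p $ i) *\<^sub>R v) p"
proof -
  have "has_grad (\<lambda>q. sgn (p $ i) * f q) (sgn (p $ i) *\<^sub>R v) p"
    using has_grad_mult[OF has_grad_const assms(1), of "sgn (p $ i)"] by simp
  then show ?thesis
  proof (rule has_grad_transform[where S="{q. 0 < p $ i * q $ i}"])
    show "open {q :: real^2. 0 < p $ i * q $ i}" by (intro open_Collect_less continuous_intros)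
    show "p \<in> {q. 0 < p $ i * q $ i}" using assms(2) by (auto simp: zero_less_mult_iff)
    show "sgn (p $ i) * f q = sgn (q $ i) * f q" if "q \<in> {q. 0 < p $ i * q $ i}" for q
      using that by (auto simp: zero_less_mult_iff)
  qed
qed

lemma smooth_on_sgn: "smooth_on (\<lambda>p. sgn (p $ i)) {p. p $ i \<noteq> 0}"
proof -
  have o: "open {p :: real^2. p $ i > 0}" "open {p :: real^2. p $ i < 0}"
    by (intro open_Collect_less continuous_intros)+
  have "smooth_on (\<lambda>p. sgn (p $ i)) ({p. p $ i > 0} \<union> {p. p $ i < 0})"
    using smooth_on_cong[OF _ o(1), of "\<lambda>p. sgn (p $ i)" "\<lambda>p. 1"] smooth_on_cong[OF _ o(2), of "\<lambda>p. sgn (p $ i)" "\<lambda>p. -1"]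
    by (intro smooth_on_Un o) (simp_all add: smooth_on_const o)
  moreover have "{p :: real^2. p $ i > 0} \<union> {p. p $ i < 0} = {p. p $ i \<noteq> 0}" by auto
  ultimately show ?thesis by simp
qed

subsection \<open>Singular solutions of the transmission problem\<close>

locale corner =
  fixes \<xi> \<alpha> :: real
  assumes \<xi>: "0 < \<xi>" and \<alpha>: "0 < \<alpha>" "\<alpha> < pi"
begin

abbreviation "s0 \<equiv> sin (\<alpha> / 2)"
abbreviation "c0 \<equiv> cos (\<alpha> / 2)"
abbreviation "A \<equiv> \<xi> * (\<alpha> / 2)"
abbreviation "B \<equiv> \<xi> * (pi / 2 - \<alpha> / 2)"

text \<open>The spectral parameter and the ratio of the outer to the inner amplitude for which the
  transmission conditions below hold.\<close>

definition \<beta> :: real where "\<beta> = sinh A * sinh B / (sinh A * sinh B + cosh A * cosh B)"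
definition k :: real where "k = cosh A / sinh B"

text \<open>In polar coordinates this is \<open>sin (\<alpha> / 2 - \<theta>) sin (\<alpha> / 2 + \<theta>)\<close>: a smooth function off the
  origin that is positive exactly on the two opposite sectors of opening \<open>\<alpha>\<close>.\<close>

definition wedge :: "real^2 \<Rightarrow> real" where
  "wedge p = ((s0 * p $ 1)\<^sup>2 - (c0 * p $ 2)\<^sup>2) / (norm p)\<^sup>2"

text \<open>The angular profiles of the mode (\<open>\<phi>\<close>) and of its stream function (\<open>\<psi>\<close>) inside and outside
  of the sectors. The quotients in the arcus tangens yield the angle to the nearest half-axis, in all
  four quadrants, and the signs make \<open>\<phi>\<close> odd under reflection of the first coordinate and \<open>\<psi>\<close>
  odd under reflection of the second one.\<close>

definition \<phi>i :: "real^2 \<Rightarrow> real" where "\<phi>i p = sgn (p $ 1) * cosh (\<xi> * arctan (p $ 2 / p $ 1))"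
definition \<phi>o :: "real^2 \<Rightarrow> real" where "\<phi>o p = sgn (p $ 2) * (k * sinh (\<xi> * arctan (p $ 1 / p $ 2)))"
definition \<psi>i :: "real^2 \<Rightarrow> real" where "\<psi>i p = sgn (p $ 1) * ((1 - \<beta>) * sinh (\<xi> * arctan (p $ 2 / p $ 1)))"
definition \<psi>o :: "real^2 \<Rightarrow> real" where "\<psi>o p = sgn (p $ 2) * (\<beta> * k * cosh (\<xi> * arctan (p $ 1 / p $ 2)))"

text \<open>The passage from the outer to the inner profile takes place inside of the sectors, in the
  layer where \<open>0 < wedge p < \<epsilon>\<close>.\<close>

definition glue :: "real \<Rightarrow> (real^2 \<Rightarrow> real) \<Rightarrow> (real^2 \<Rightarrow> real) \<Rightarrow> real^2 \<Rightarrow> real" where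
  "glue \<epsilon> gi go p = step (wedge p / \<epsilon>) * gi p + (1 - step (wedge p / \<epsilon>)) * go p"

lemma s0: "0 < s0" "s0 < 1" and c0: "0 < c0"
proof -
  show "0 < s0" using \<alpha> by (intro sin_gt_zero) auto
  show c: "0 < c0" using \<alpha> by (intro cos_gt_zero) auto
  have "s0\<^sup>2 + c0\<^sup>2 = 1" by simp
  then have "s0\<^sup>2 < 1\<^sup>2" using c by (smt (verit) one_power2 zero_less_power)
  then show "s0 < 1" by (rule power_less_imp_less_base) simp
qed

lemma sinh_AB: "0 < sinh A" "0 < sinh B"
  using \<xi> \<alpha> by auto

lemma \<beta>: "0 < \<beta>" "\<beta> < 1" "1 - \<beta> = cosh A * cosh B / (sinh A * sinh B + cosh A * cosh B)"
proof -
  have p: "0 < sinh A * sinh B" "0 < cosh A * cosh B" using sinh_AB by auto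
  have gen: "0 < sinh A * sinh B / (sinh A * sinh B + cosh A * cosh B)"
    "sinh A * sinh B / (sinh A * sinh B + cosh A * cosh B) < 1"
    "1 - sinh A * sinh B / (sinh A * sinh B + cosh A * cosh B) = cosh A * cosh B / (sinh A * sinh B + cosh A * cosh B)"
  proof -
    have "0 < a / (a + b)" "a / (a + b) < 1" "1 - a / (a + b) = b / (a + b)" if "0 < a" "0 < b" for a b :: real
      using that by (auto simp: field_simps)
    from this[OF p] show "0 < sinh A * sinh B / (sinh A * sinh B + cosh A * cosh B)"
      "sinh A * sinh B / (sinh A * sinh B + cosh A * cosh B) < 1"
      "1 - sinh A * sinh B / (sinh A * sinh B + cosh A * cosh B) = cosh A * cosh B / (sinh A * sinh B + cosh A * cosh B)" .
  qed
  show "0 < \<beta>" "\<beta> < 1" "1 - \<beta> = cosh A * cosh B / (sinh A * sinh B + cosh A * cosh B)"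
    unfolding \<beta>_def by (rule gen)+
qed

lemma k: "0 < k" using sinh_AB by (simp add: k_def)

text \<open>The transmission conditions at the interface: continuity of the function and of its flux.\<close>

lemma transmission: "cosh A = k * sinh B" "(1 - \<beta>) * sinh A = \<beta> * k * cosh B"
  using sinh_AB unfolding \<beta>(3) by (auto simp: k_def \<beta>_def)

text \<open>With \<open>a\<close> the coefficient inside or outside of the sectors, these are the equations
  \<open>\<phi>' = \<xi> \<psi> / a\<close> and \<open>\<psi>' = \<xi> a \<phi>\<close>, by which the mode and its stream function are conjugate.\<close>

lemma has_grad_inner_profiles:
  assumes "p $ 1 \<noteq> 0"
  shows "has_grad \<phi>i ((\<xi> / (1 - \<beta>) * \<psi>i p) *\<^sub>R angular p) p"
    and "has_grad \<psi>i ((\<xi> * (1 - \<beta>) * \<phi>i p) *\<^sub>R angular p) p"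
proof -
  have 1: "has_grad (\<lambda>p. \<xi> * arctan (p $ 2 / p $ 1)) (\<xi> *\<^sub>R angular p) p"
    using has_grad_mult[OF has_grad_const has_grad_arctan_quotient[OF assms], of \<xi>] by simp
  have 2: "has_grad (\<lambda>p. cosh (\<xi> * arctan (p $ 2 / p $ 1))) (sinh (\<xi> * arctan (p $ 2 / p $ 1)) *\<^sub>R \<xi> *\<^sub>R angular p) p"
    by (rule has_grad_compose[OF 1]) (auto intro!: derivative_eq_intros)
  have 3: "has_grad (\<lambda>p. (1 - \<beta>) * sinh (\<xi> * arctan (p $ 2 / p $ 1)))
      (((1 - \<beta>) * cosh (\<xi> * arctan (p $ 2 / p $ 1))) *\<^sub>R \<xi> *\<^sub>R angular p) p"
    by (rule has_grad_compose[OF 1]) (auto intro!: derivative_eq_intros)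
  show "has_grad \<phi>i ((\<xi> / (1 - \<beta>) * \<psi>i p) *\<^sub>R angular p) p"
    using has_grad_sgn_mult[OF 2 assms] \<beta>(2) by (simp add: \<phi>i_def[abs_def] \<psi>i_def mult_ac)
  show "has_grad \<psi>i ((\<xi> * (1 - \<beta>) * \<phi>i p) *\<^sub>R angular p) p"
    using has_grad_sgn_mult[OF 3 assms] by (simp add: \<phi>i_def \<psi>i_def[abs_def] mult_ac)
qed

lemma has_grad_outer_profiles:
  assumes "p $ 2 \<noteq> 0"
  shows "has_grad \<phi>o ((\<xi> / (- \<beta>) * \<psi>o p) *\<^sub>R angular p) p"
    and "has_grad \<psi>o ((\<xi> * (- \<beta>) * \<phi>o p) *\<^sub>R angular p) p"
proof -
  have 1: "has_grad (\<lambda>p. \<xi> * arctan (p $ 1 / p $ 2)) (\<xi> *\<^sub>R (- angular p)) p"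
    using has_grad_mult[OF has_grad_const has_grad_arctan_quotient'[OF assms], of \<xi>] by simp
  have 2: "has_grad (\<lambda>p. k * sinh (\<xi> * arctan (p $ 1 / p $ 2)))
      ((k * cosh (\<xi> * arctan (p $ 1 / p $ 2))) *\<^sub>R \<xi> *\<^sub>R (- angular p)) p"
    by (rule has_grad_compose[OF 1]) (auto intro!: derivative_eq_intros)
  have 3: "has_grad (\<lambda>p. \<beta> * k * cosh (\<xi> * arctan (p $ 1 / p $ 2)))
      ((\<beta> * k * sinh (\<xi> * arctan (p $ 1 / p $ 2))) *\<^sub>R \<xi> *\<^sub>R (- angular p)) p"
    by (rule has_grad_compose[OF 1]) (auto intro!: derivative_eq_intros)
  show "has_grad \<phi>o ((\<xi> / (- \<beta>) * \<psi>o p) *\<^sub>R angular p) p"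
    using has_grad_sgn_mult[OF 2 assms] \<beta>(1) by (simp add: \<phi>o_def[abs_def] \<psi>o_def mult_ac)
  show "has_grad \<psi>o ((\<xi> * (- \<beta>) * \<phi>o p) *\<^sub>R angular p) p"
    using has_grad_sgn_mult[OF 3 assms] by (simp add: \<phi>o_def \<psi>o_def[abs_def] mult_ac)
qed

lemma smooth_on_profiles:
  "smooth_on \<phi>i {p. p $ 1 \<noteq> 0}" "smooth_on \<psi>i {p. p $ 1 \<noteq> 0}"
  "smooth_on \<phi>o {p. p $ 2 \<noteq> 0}" "smooth_on \<psi>o {p. p $ 2 \<noteq> 0}"
  unfolding \<phi>i_def[abs_def] \<psi>i_def[abs_def] \<phi>o_def[abs_def] \<psi>o_def[abs_def]
  by (intro smooth_on_mult smooth_on_sgn smooth_on_sinh smooth_on_cosh smooth_on_const smooth_on_arctan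
      smooth_on_divide smooth_on_component open_component_ne; simp)+

lemma wedge_axes:
  assumes "p \<noteq> 0"
  shows "p $ 1 = 0 \<Longrightarrow> wedge p < 0" "p $ 2 = 0 \<Longrightarrow> wedge p = s0\<^sup>2"
proof -
  have n: "(norm p)\<^sup>2 > 0" using assms by simp
  show "wedge p < 0" if "p $ 1 = 0"
    using that n c0 unfolding wedge_def norm_sq_cart2 by (auto simp: divide_less_0_iff)
  show "wedge p = s0\<^sup>2" if "p $ 2 = 0"
    using that n unfolding wedge_def norm_sq_cart2 by (auto simp: power_mult_distrib)
qed

lemma smooth_on_wedge: "smooth_on wedge (- {0})"
proof -
  have "smooth_on (\<lambda>p. ((s0 * p $ 1) * (s0 * p $ 1) - (c0 * p $ 2) * (c0 * p $ 2)) / (p $ 1 * p $ 1 + p $ 2 * p $ 2)) (- {0})"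
  proof (intro smooth_on_divide smooth_on_diff smooth_on_add smooth_on_mult smooth_on_const smooth_on_component)
    fix p :: "real^2" assume "p \<in> - {0}"
    then have "(norm p)\<^sup>2 \<noteq> 0" by simp
    then show "p $ 1 * p $ 1 + p $ 2 * p $ 2 \<noteq> 0" unfolding norm_sq_cart2 unfolding power2_eq_square .
  qed auto
  then show ?thesis unfolding wedge_def[abs_def] norm_sq_cart2 unfolding power2_eq_square .
qed

lemma has_grad_wedge:
  assumes "p \<noteq> 0"
  shows "\<exists>c. \<bar>c\<bar> \<le> 1 \<and> has_grad wedge (c *\<^sub>R angular p) p"
proof -
  let ?N = "\<lambda>p :: real^2. (s0 * p $ 1)\<^sup>2 - (c0 * p $ 2)\<^sup>2" and ?n = "\<lambda>p :: real^2. (p $ 1)\<^sup>2 + (p $ 2)\<^sup>2"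
  have n: "?n p > 0" using assms norm_sq_cart2[of p] by (metis norm_eq_zero power2_less_eq_zero_iff zero_le_power2 linorder_not_le order_le_less)
  have c: "((\<lambda>p. p $ i) has_derivative (\<lambda>h. h $ i)) (at p)" for i
    by (rule bounded_linear_imp_has_derivative[OF bounded_linear_vec_nth])
  have N: "(?N has_derivative (\<lambda>h. 2 * s0\<^sup>2 * p $ 1 * h $ 1 - 2 * c0\<^sup>2 * p $ 2 * h $ 2)) (at p)"
    by (auto intro!: derivative_eq_intros c simp: fun_eq_iff power2_eq_square algebra_simps)
  have d: "(?n has_derivative (\<lambda>h. 2 * p $ 1 * h $ 1 + 2 * p $ 2 * h $ 2)) (at p)"
    by (auto intro!: derivative_eq_intros c simp: fun_eq_iff power2_eq_square algebra_simps)
  have "((\<lambda>p. ?N p / ?n p) has_derivative (\<lambda>h. ((2 * s0\<^sup>2 * p $ 1 * h $ 1 - 2 * c0\<^sup>2 * p $ 2 * h $ 2) * ?n p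
      - ?N p * (2 * p $ 1 * h $ 1 + 2 * p $ 2 * h $ 2)) / (?n p * ?n p))) (at p)"
    by (rule has_derivative_divide'[OF N d]) (use n in auto)
  moreover have "((2 * s0\<^sup>2 * p $ 1 * h $ 1 - 2 * c0\<^sup>2 * p $ 2 * h $ 2) * ?n p
      - ?N p * (2 * p $ 1 * h $ 1 + 2 * p $ 2 * h $ 2)) / (?n p * ?n p)
     = ((- 2 * p $ 1 * p $ 2 / ?n p) *\<^sub>R angular p) \<bullet> h" for h
  proof -
    have "(2 * s0\<^sup>2 * p $ 1 * h $ 1 - 2 * c0\<^sup>2 * p $ 2 * h $ 2) * ?n p
      - ?N p * (2 * p $ 1 * h $ 1 + 2 * p $ 2 * h $ 2)
      = - 2 * p $ 1 * p $ 2 * (p $ 1 * h $ 2 - p $ 2 * h $ 1) * (s0\<^sup>2 + c0\<^sup>2)"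
      by (simp only: power_mult_distrib) (simp only: power2_eq_square, algebra)
    also have "\<dots> = - 2 * p $ 1 * p $ 2 * (p $ 1 * h $ 2 - p $ 2 * h $ 1)" by simp
    finally have e: "(2 * s0\<^sup>2 * p $ 1 * h $ 1 - 2 * c0\<^sup>2 * p $ 2 * h $ 2) * ?n p
      - ?N p * (2 * p $ 1 * h $ 1 + 2 * p $ 2 * h $ 2) = - 2 * p $ 1 * p $ 2 * (p $ 1 * h $ 2 - p $ 2 * h $ 1)" .
    show ?thesis
      unfolding e angular_def norm_sq_cart2
      by (simp add: inner_vec_def sum_2 algebra_simps diff_divide_distrib)
  qed
  ultimately have "has_grad wedge ((- 2 * p $ 1 * p $ 2 / ?n p) *\<^sub>R angular p) p"
    unfolding wedge_def[abs_def] norm_sq_cart2 by simp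
  moreover have "\<bar>- 2 * p $ 1 * p $ 2 / ?n p\<bar> \<le> 1"
  proof -
    have "\<bar>2 * p $ 1 * p $ 2\<bar> \<le> ?n p"
      using sum_squares_bound[of "p $ 1" "p $ 2"] sum_squares_bound[of "p $ 1" "- p $ 2"] by (simp add: abs_if)
    then show ?thesis using n by (simp add: abs_mult)
  qed
  ultimately show ?thesis by blast
qed

lemma open_wedge: "open {p. p \<noteq> 0 \<and> wedge p < 0}" "open {p. p \<noteq> 0 \<and> wedge p > \<epsilon>}"
proof -
  have c: "continuous_on (- {0}) wedge" by (rule smooth_on_continuous_on[OF smooth_on_wedge])
  have "open (wedge -` {..<0} \<inter> - {0})" "open (wedge -` {\<epsilon><..} \<inter> - {0})"
    by (auto intro!: continuous_open_vimage continuous_on_open_vimage[THEN iffD1, rule_format] c)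
  moreover have "wedge -` {..<0} \<inter> - {0} = {p. p \<noteq> 0 \<and> wedge p < 0}"
    "wedge -` {\<epsilon><..} \<inter> - {0} = {p. p \<noteq> 0 \<and> wedge p > \<epsilon>}" by auto
  ultimately show "open {p. p \<noteq> 0 \<and> wedge p < 0}" "open {p. p \<noteq> 0 \<and> wedge p > \<epsilon>}" by auto
qed

lemma glue_eq:
  assumes "0 < \<epsilon>"
  shows "wedge p \<le> 0 \<Longrightarrow> glue \<epsilon> gi go p = go p" "wedge p \<ge> \<epsilon> \<Longrightarrow> glue \<epsilon> gi go p = gi p"
  using assms by (auto simp: glue_def divide_nonpos_pos)

text \<open>On the coordinate axes one of the two profiles is singular, but there the glued function
  coincides with the other one.\<close>

lemma smooth_on_glue:
  assumes gi: "smooth_on gi {p. p $ 1 \<noteq> 0}" and go: "smooth_on go {p. p $ 2 \<noteq> 0}" and \<epsilon>: "0 < \<epsilon>" "\<epsilon> < s0\<^sup>2"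
  shows "smooth_on (glue \<epsilon> gi go) (- {0})"
proof -
  let ?U = "{p :: real^2. p $ 1 \<noteq> 0} \<inter> {p. p $ 2 \<noteq> 0}"
  let ?V = "{p. p \<noteq> 0 \<and> wedge p < 0}" and ?W = "{p. p \<noteq> 0 \<and> wedge p > \<epsilon>}"
  have oU: "open ?U" by (intro open_Int open_component_ne)
  have sub: "?U \<subseteq> - {0}" "?U \<subseteq> {p. p $ 1 \<noteq> 0}" "?U \<subseteq> {p. p $ 2 \<noteq> 0}" by auto
  have "?V \<subseteq> {p. p $ 2 \<noteq> 0}" using wedge_axes(2) s0 by fastforce
  then have V: "smooth_on (glue \<epsilon> gi go) ?V"
    using smooth_on_cong[OF _ open_wedge(1), of "glue \<epsilon> gi go" go] glue_eq(1)[OF \<epsilon>(1)] smooth_on_subset[OF go] by auto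
  have "?W \<subseteq> {p. p $ 1 \<noteq> 0}" using wedge_axes(1) \<epsilon> by fastforce
  then have W: "smooth_on (glue \<epsilon> gi go) ?W"
    using smooth_on_cong[OF _ open_wedge(2), of \<epsilon> "glue \<epsilon> gi go" gi] glue_eq(2)[OF \<epsilon>(1)] smooth_on_subset[OF gi] by auto
  have h: "smooth_on (\<lambda>p. step (wedge p / \<epsilon>)) ?U"
    using \<epsilon> by (intro smooth_on_step smooth_on_divide smooth_on_const oU smooth_on_subset[OF smooth_on_wedge sub(1)]) auto
  have U: "smooth_on (glue \<epsilon> gi go) ?U" unfolding glue_def[abs_def]
    by (intro smooth_on_add smooth_on_mult smooth_on_diff smooth_on_const oU h
        smooth_on_subset[OF gi sub(2)] smooth_on_subset[OF go sub(3)])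
  have "p \<in> (?U \<union> ?V) \<union> ?W" if "p \<noteq> 0" for p
    using wedge_axes[OF that] \<epsilon> that by auto
  then have "- {0} \<subseteq> (?U \<union> ?V) \<union> ?W" by blast
  moreover have "smooth_on (glue \<epsilon> gi go) ((?U \<union> ?V) \<union> ?W)"
    by (intro smooth_on_Un U V W oU open_wedge open_Un)
  ultimately show ?thesis using smooth_on_subset by blast
qed

text \<open>The gradient of a glued function is angular. The third term, which comes from the gluing,
  is supported in the layer where \<open>0 < wedge p < \<epsilon>\<close>.\<close>

lemma has_grad_glue:
  assumes gi: "\<And>p. p $ 1 \<noteq> 0 \<Longrightarrow> has_grad gi (ci p *\<^sub>R angular p) p"
    and go: "\<And>p. p $ 2 \<noteq> 0 \<Longrightarrow> has_grad go (co p *\<^sub>R angular p) p"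
    and \<epsilon>: "0 < \<epsilon>" "\<epsilon> < s0\<^sup>2" and p: "p \<noteq> 0"
  shows "\<exists>c. \<bar>c\<bar> \<le> 1 \<and> has_grad (glue \<epsilon> gi go)
    ((step (wedge p / \<epsilon>) * ci p + (1 - step (wedge p / \<epsilon>)) * co p
      + deriv step (wedge p / \<epsilon>) * c / \<epsilon> * (gi p - go p)) *\<^sub>R angular p) p"
proof -
  consider "p $ 1 \<noteq> 0" "p $ 2 \<noteq> 0" | "p $ 1 = 0" "p $ 2 \<noteq> 0" | "p $ 1 \<noteq> 0" "p $ 2 = 0"
    using p by (auto simp: vec_eq_iff forall_2)
  then show ?thesis
  proof cases
    case 1
    obtain c where c: "\<bar>c\<bar> \<le> 1" "has_grad wedge (c *\<^sub>R angular p) p" using has_grad_wedge[OF p] by blast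
    have "has_grad (\<lambda>p. wedge p * (1 / \<epsilon>)) ((c / \<epsilon>) *\<^sub>R angular p) p"
      using has_grad_mult[OF c(2) has_grad_const, of "1 / \<epsilon>"] by simp
    then have "has_grad (\<lambda>p. wedge p / \<epsilon>) ((c / \<epsilon>) *\<^sub>R angular p) p" by simp
    from has_grad_compose[OF this has_derivative_step]
    have h: "has_grad (\<lambda>p. step (wedge p / \<epsilon>)) ((deriv step (wedge p / \<epsilon>) * c / \<epsilon>) *\<^sub>R angular p) p" by simp
    have "has_grad (\<lambda>p. 1 + (- 1) * step (wedge p / \<epsilon>)) (- (deriv step (wedge p / \<epsilon>) * c / \<epsilon>) *\<^sub>R angular p) p"
      using has_grad_add[OF has_grad_const has_grad_mult[OF has_grad_const h, of "- 1"], of 1] by simp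
    then have h': "has_grad (\<lambda>p. 1 - step (wedge p / \<epsilon>)) (- (deriv step (wedge p / \<epsilon>) * c / \<epsilon>) *\<^sub>R angular p) p" by simp
    from has_grad_add[OF has_grad_mult[OF h gi[OF 1(1)]] has_grad_mult[OF h' go[OF 1(2)]]]
    have "has_grad (glue \<epsilon> gi go)
      ((step (wedge p / \<epsilon>) * ci p + (1 - step (wedge p / \<epsilon>)) * co p
        + deriv step (wedge p / \<epsilon>) * c / \<epsilon> * (gi p - go p)) *\<^sub>R angular p) p"
      unfolding glue_def[abs_def] by (rule has_derivative_eq_rhs) (auto simp: algebra_simps diff_divide_distrib)
    then show ?thesis using c(1) by blast
  next
    case 2
    have w: "wedge p < 0" using wedge_axes[OF p] 2 by blast
    have z: "step (wedge p / \<epsilon>) = 0" "deriv step (wedge p / \<epsilon>) = 0"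
      using w \<epsilon> by (auto intro!: deriv_step_eq_0 simp: divide_nonpos_pos)
    have "has_grad (glue \<epsilon> gi go) (co p *\<^sub>R angular p) p"
      by (rule has_grad_transform[OF go[OF 2(2)] open_wedge(1)]) (use w p glue_eq(1)[OF \<epsilon>(1)] in auto)
    then show ?thesis using z by (intro exI[of _ 0]) simp
  next
    case 3
    have w: "wedge p > \<epsilon>" using wedge_axes[OF p] 3 \<epsilon> by simp
    have z: "step (wedge p / \<epsilon>) = 1" "deriv step (wedge p / \<epsilon>) = 0"
      using w \<epsilon> by (auto intro!: deriv_step_eq_0)
    have "has_grad (glue \<epsilon> gi go) (ci p *\<^sub>R angular p) p"
      by (rule has_grad_transform[OF gi[OF 3(1)] open_wedge(2)]) (use w p glue_eq(2)[OF \<epsilon>(1)] in auto)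
    then show ?thesis using z by (intro exI[of _ 0]) simp
  qed
qed

end

context corner
begin

text \<open>A common bound of the four profiles.\<close>

definition Cb :: real where "Cb = (1 + k) * cosh (\<xi> * (pi / 2))"

lemma cosh_arctan_le: "cosh (\<xi> * arctan z) \<le> cosh (\<xi> * (pi / 2))"
proof -
  have "\<bar>arctan z\<bar> \<le> pi / 2" using arctan_lbound[of z] arctan_ubound[of z] by auto
  then have "\<bar>\<xi> * arctan z\<bar> \<le> \<xi> * (pi / 2)" using \<xi> by (simp add: abs_mult)
  then have "cosh \<bar>\<xi> * arctan z\<bar> \<le> cosh (\<xi> * (pi / 2))" by (subst cosh_real_nonneg_le_iff) auto
  then show ?thesis by simp
qed

lemma abs_sinh_le_cosh: "\<bar>sinh x\<bar> \<le> cosh (x :: real)"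
proof -
  have "(sinh x)\<^sup>2 \<le> (cosh x)\<^sup>2" using cosh_square_eq[of x] by simp
  then show ?thesis using abs_le_square_iff[of "sinh x" "cosh x"] by simp
qed

lemma Cb_ge: "0 \<le> Cb" "cosh (\<xi> * arctan z) \<le> Cb" "k * cosh (\<xi> * arctan z) \<le> Cb"
proof -
  have 1: "0 \<le> cosh (\<xi> * (pi / 2))" "0 \<le> k * cosh (\<xi> * (pi / 2))" using k by simp_all
  have 2: "k * cosh (\<xi> * arctan z) \<le> k * cosh (\<xi> * (pi / 2))"
    using k by (intro mult_left_mono cosh_arctan_le) auto
  show "0 \<le> Cb" "cosh (\<xi> * arctan z) \<le> Cb" "k * cosh (\<xi> * arctan z) \<le> Cb"
    unfolding Cb_def distrib_right using 1 2 cosh_arctan_le[of z] by linarith+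
qed

lemma profiles_le: "\<bar>\<phi>i p\<bar> \<le> Cb" "\<bar>\<psi>i p\<bar> \<le> Cb" "\<bar>\<phi>o p\<bar> \<le> Cb" "\<bar>\<psi>o p\<bar> \<le> Cb"
proof -
  have sgn: "\<bar>sgn (x :: real) * y\<bar> \<le> \<bar>y\<bar>" for x y by (simp add: abs_mult sgn_if)
  let ?s = "arctan (p $ 2 / p $ 1)" and ?t = "arctan (p $ 1 / p $ 2)"
  show "\<bar>\<phi>i p\<bar> \<le> Cb" unfolding \<phi>i_def using sgn[of "p $ 1" "cosh (\<xi> * ?s)"] Cb_ge(2)[of "p $ 2 / p $ 1"] by simp
  have "\<bar>(1 - \<beta>) * sinh (\<xi> * ?s)\<bar> \<le> 1 * cosh (\<xi> * ?s)"
    using \<beta>(1,2) abs_sinh_le_cosh unfolding abs_mult by (intro mult_mono) auto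
  then show "\<bar>\<psi>i p\<bar> \<le> Cb" unfolding \<psi>i_def
    using sgn[of "p $ 1" "(1 - \<beta>) * sinh (\<xi> * ?s)"] Cb_ge(2)[of "p $ 2 / p $ 1"] by linarith
  have "\<bar>k * sinh (\<xi> * ?t)\<bar> \<le> k * cosh (\<xi> * ?t)"
    using k abs_sinh_le_cosh unfolding abs_mult by (intro mult_mono) auto
  then show "\<bar>\<phi>o p\<bar> \<le> Cb" unfolding \<phi>o_def
    using sgn[of "p $ 2" "k * sinh (\<xi> * ?t)"] Cb_ge(3)[of "p $ 1 / p $ 2"] by linarith
  have "\<bar>\<beta> * (k * cosh (\<xi> * ?t))\<bar> \<le> 1 * (k * cosh (\<xi> * ?t))"
    using \<beta>(1,2) k unfolding abs_mult by (intro mult_mono) auto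
  then show "\<bar>\<psi>o p\<bar> \<le> Cb" unfolding \<psi>o_def
    using sgn[of "p $ 2" "\<beta> * (k * cosh (\<xi> * ?t))"] Cb_ge(3)[of "p $ 1 / p $ 2"] by (simp add: mult.assoc)
qed

lemma wedge_angle:
  assumes "p $ 1 \<noteq> 0" "p $ 2 \<noteq> 0" and \<theta>: "\<theta> = arctan \<bar>p $ 2 / p $ 1\<bar>"
  shows "wedge p = sin (\<alpha> / 2 - \<theta>) * sin (\<alpha> / 2 + \<theta>)"
proof -
  let ?z = "\<bar>p $ 2 / p $ 1\<bar>"
  have pos: "(p $ 1)\<^sup>2 + (p $ 2)\<^sup>2 > 0" using assms by (simp add: sum_power2_gt_zero_iff)
  have z: "1 + ?z\<^sup>2 = ((p $ 1)\<^sup>2 + (p $ 2)\<^sup>2) / (p $ 1)\<^sup>2" using assms(1) by (simp add: field_simps)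
  have "(cos \<theta>)\<^sup>2 = 1 / (1 + ?z\<^sup>2)"
    unfolding \<theta> cos_arctan by (simp add: power_divide add_nonneg_nonneg)
  then have c: "(cos \<theta>)\<^sup>2 = (p $ 1)\<^sup>2 / ((p $ 1)\<^sup>2 + (p $ 2)\<^sup>2)" unfolding z by simp
  have quot: "1 - x / (x + y) = y / (x + y)" if "x + y > 0" for x y :: real using that by (simp add: field_simps)
  have "(sin \<theta>)\<^sup>2 = 1 - (cos \<theta>)\<^sup>2" by (simp add: sin_squared_eq)
  then have s: "(sin \<theta>)\<^sup>2 = (p $ 2)\<^sup>2 / ((p $ 1)\<^sup>2 + (p $ 2)\<^sup>2)" unfolding c using quot[OF pos] by simp
  have "sin (\<alpha> / 2 - \<theta>) * sin (\<alpha> / 2 + \<theta>) = s0\<^sup>2 * (cos \<theta>)\<^sup>2 - c0\<^sup>2 * (sin \<theta>)\<^sup>2"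
    by (simp add: sin_diff sin_add algebra_simps power2_eq_square)
  also have "\<dots> = wedge p"
    unfolding wedge_def c s norm_sq_cart2 by (simp add: power_mult_distrib diff_divide_distrib)
  finally show ?thesis ..
qed

lemma sin_ge_linear:
  assumes "0 \<le> x" "x \<le> \<alpha> / 2" shows "x * c0 \<le> sin x"
proof (cases "x = 0")
  case False
  then obtain z where z: "0 < z" "z < x" "sin x - sin 0 = (x - 0) * cos z"
    using MVT2[of 0 x sin cos] assms by (auto intro: DERIV_sin)
  have "c0 \<le> cos z" using z assms \<alpha> by (intro cos_monotone_0_pi_le) auto
  then show ?thesis using z(3) assms(1) mult_left_mono by fastforce
qed simp

text \<open>Inner and outer profiles agree on the interface, hence differ by at most a multiple of
  \<open>wedge p\<close> near it. This bounds the gradient in the layer uniformly in \<open>\<epsilon>\<close>.\<close>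

lemma profile_gap:
  assumes p: "p $ 1 \<noteq> 0" "p $ 2 \<noteq> 0" and w: "0 \<le> wedge p"
  shows "\<bar>\<phi>i p - \<phi>o p\<bar> * (s0 * c0\<^sup>2) \<le> \<xi> * Cb * wedge p"
    and "\<bar>\<psi>i p - \<psi>o p\<bar> * (s0 * c0\<^sup>2) \<le> \<xi> * Cb * wedge p"
proof -
  let ?z = "p $ 2 / p $ 1"
  define \<theta> where "\<theta> = arctan \<bar>?z\<bar>"
  have \<theta>: "0 \<le> \<theta>" "\<theta> < pi / 2" using arctan_ubound by (auto simp: \<theta>_def)
  have W: "wedge p = sin (\<alpha> / 2 - \<theta>) * sin (\<alpha> / 2 + \<theta>)" using wedge_angle[OF p \<theta>_def] .
  have \<theta>_le: "\<theta> \<le> \<alpha> / 2"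
  proof (rule ccontr)
    assume "\<not> \<theta> \<le> \<alpha> / 2"
    then have "sin (\<theta> - \<alpha> / 2) > 0" "sin (\<alpha> / 2 + \<theta>) > 0" using \<theta> \<alpha> by (auto intro!: sin_gt_zero)
    moreover have "sin (\<alpha> / 2 - \<theta>) = - sin (\<theta> - \<alpha> / 2)" by (simp add: sin_diff)
    ultimately have "wedge p < 0" unfolding W by simp
    then show False using w by simp
  qed
  have lower: "(\<alpha> / 2 - \<theta>) * (s0 * c0\<^sup>2) \<le> wedge p"
  proof -
    have 1: "(\<alpha> / 2 - \<theta>) * c0 \<le> sin (\<alpha> / 2 - \<theta>)" using \<theta> \<theta>_le by (intro sin_ge_linear) auto
    have "c0 \<le> cos \<theta>" using \<theta> \<theta>_le \<alpha> by (intro cos_monotone_0_pi_le) auto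
    then have "s0 * c0 \<le> s0 * cos \<theta>" using s0 by (intro mult_left_mono) auto
    also have "\<dots> \<le> sin (\<alpha> / 2 + \<theta>)" using c0 \<theta> sin_ge_zero[of \<theta>] by (simp add: sin_add)
    finally have 2: "s0 * c0 \<le> sin (\<alpha> / 2 + \<theta>)" .
    have "((\<alpha> / 2 - \<theta>) * c0) * (s0 * c0) \<le> sin (\<alpha> / 2 - \<theta>) * sin (\<alpha> / 2 + \<theta>)"
      using 1 2 \<theta>_le s0 c0 by (intro mult_mono order_trans[OF _ 1]) auto
    then show ?thesis unfolding W by (simp add: power2_eq_square mult_ac)
  qed
  have lip: "\<bar>g \<theta>\<bar> \<le> \<xi> * Cb * (\<alpha> / 2 - \<theta>)"
    if d: "\<And>x. (g has_real_derivative g' x) (at x)" and g': "\<And>x. 0 \<le> x \<Longrightarrow> x \<le> pi / 2 \<Longrightarrow> \<bar>g' x\<bar> \<le> \<xi> * Cb"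
      and 0: "g (\<alpha> / 2) = 0" for g g' :: "real \<Rightarrow> real"
  proof -
    have "norm (g \<theta> - g (\<alpha> / 2)) \<le> \<xi> * Cb * norm (\<theta> - \<alpha> / 2)"
    proof (rule field_differentiable_bound[where S="{0..pi/2}" and f'=g'])
      show "(g has_field_derivative g' x) (at x within {0..pi / 2})" for x
        using d has_field_derivative_at_within by blast
    qed (use \<theta> \<theta>_le \<alpha> g' in auto)
    then show ?thesis using 0 \<theta>_le by simp
  qed
  have co: "0 \<le> cosh (\<xi> * x) \<and> cosh (\<xi> * x) \<le> cosh (\<xi> * (pi / 2)) \<and> \<bar>sinh (\<xi> * x)\<bar> \<le> cosh (\<xi> * (pi / 2))" if "0 \<le> x" "x \<le> pi / 2" for x
  proof -
    have "cosh (\<xi> * x) \<le> cosh (\<xi> * (pi / 2))"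
      using that \<xi> by (subst cosh_real_nonneg_le_iff) (auto intro: mult_left_mono)
    then show ?thesis using abs_sinh_le_cosh[of "\<xi> * x"] by (simp add: less_imp_le)
  qed
  have bound: "\<bar>\<xi> * (a * x + b * y)\<bar> \<le> \<xi> * Cb"
    if "\<bar>x\<bar> \<le> cosh (\<xi> * (pi / 2))" "\<bar>y\<bar> \<le> cosh (\<xi> * (pi / 2))" "\<bar>a\<bar> \<le> 1" "\<bar>b\<bar> \<le> k" for a b x y
  proof -
    have "\<bar>a * x\<bar> \<le> 1 * cosh (\<xi> * (pi / 2))" "\<bar>b * y\<bar> \<le> k * cosh (\<xi> * (pi / 2))"
      unfolding abs_mult by (intro mult_mono; use that k in simp)+
    then have "\<bar>a * x + b * y\<bar> \<le> Cb" unfolding Cb_def by (simp add: distrib_right) 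
    then show ?thesis using \<xi> by (simp add: abs_mult)
  qed
  let ?g1 = "\<lambda>x. cosh (\<xi> * x) - k * sinh (\<xi> * (pi / 2 - x))"
  let ?g2 = "\<lambda>x. (1 - \<beta>) * sinh (\<xi> * x) - \<beta> * k * cosh (\<xi> * (pi / 2 - x))"
  have g1: "\<bar>?g1 \<theta>\<bar> \<le> \<xi> * Cb * (\<alpha> / 2 - \<theta>)"
  proof (rule lip)
    show "(?g1 has_real_derivative \<xi> * (1 * sinh (\<xi> * x) + k * cosh (\<xi> * (pi / 2 - x)))) (at x)" for x
      by (auto intro!: derivative_eq_intros simp: algebra_simps)
    show "\<bar>\<xi> * (1 * sinh (\<xi> * x) + k * cosh (\<xi> * (pi / 2 - x)))\<bar> \<le> \<xi> * Cb" if "0 \<le> x" "x \<le> pi / 2" for x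
      using co[OF that] co[of "pi / 2 - x"] that k by (intro bound) auto
    show "?g1 (\<alpha> / 2) = 0" using transmission(1) by simp
  qed
  have g2: "\<bar>?g2 \<theta>\<bar> \<le> \<xi> * Cb * (\<alpha> / 2 - \<theta>)"
  proof (rule lip)
    show "(?g2 has_real_derivative \<xi> * ((1 - \<beta>) * cosh (\<xi> * x) + (\<beta> * k) * sinh (\<xi> * (pi / 2 - x)))) (at x)" for x
      by (auto intro!: derivative_eq_intros simp: algebra_simps)
    show "\<bar>\<xi> * ((1 - \<beta>) * cosh (\<xi> * x) + (\<beta> * k) * sinh (\<xi> * (pi / 2 - x)))\<bar> \<le> \<xi> * Cb" if "0 \<le> x" "x \<le> pi / 2" for x
      using co[OF that] co[of "pi / 2 - x"] that k \<beta>(1,2) by (intro bound) (auto simp: abs_mult)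
    show "?g2 (\<alpha> / 2) = 0" using transmission(2) by simp
  qed
  have z: "arctan ?z = sgn ?z * \<theta>" "arctan (p $ 1 / p $ 2) = sgn ?z * (pi / 2 - \<theta>)"
  proof -
    show 1: "arctan ?z = sgn ?z * \<theta>"
      using p unfolding \<theta>_def by (cases "?z > 0") (auto simp: arctan_minus abs_if sgn_if)
    have nz: "?z \<noteq> 0" using p by simp
    have "arctan (p $ 1 / p $ 2) = sgn ?z * pi / 2 - arctan ?z"
      using Transcendental.arctan_inverse[OF nz] by simp
    then show "arctan (p $ 1 / p $ 2) = sgn ?z * (pi / 2 - \<theta>)" unfolding 1 by (simp add: algebra_simps)
  qed
  have sg: "sgn ?z = 1 \<or> sgn ?z = - 1" "sgn (p $ 2) * sgn ?z = sgn (p $ 1)" "sgn (p $ 1) * sgn ?z = sgn (p $ 2)"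
    "\<bar>sgn (p $ 1)\<bar> = 1" "\<bar>sgn (p $ 2)\<bar> = 1"
    using p by (auto simp: sgn_if zero_less_divide_iff divide_less_0_iff)
  have even_odd: "cosh (\<xi> * (sgn ?z * x)) = cosh (\<xi> * x)" "sinh (\<xi> * (sgn ?z * x)) = sgn ?z * sinh (\<xi> * x)" for x
    using sg(1) by auto
  have e1: "\<phi>i p - \<phi>o p = sgn (p $ 1) * ?g1 \<theta>"
    unfolding \<phi>i_def \<phi>o_def z even_odd sg(2)[symmetric] by (simp add: algebra_simps)
  have e2: "\<psi>i p - \<psi>o p = sgn (p $ 2) * ?g2 \<theta>"
    unfolding \<psi>i_def \<psi>o_def z even_odd sg(3)[symmetric] by (simp add: algebra_simps)
  have fin: "x * (s0 * c0\<^sup>2) \<le> \<xi> * Cb * wedge p" if "x \<le> \<xi> * Cb * (\<alpha> / 2 - \<theta>)" for x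
  proof -
    have "x * (s0 * c0\<^sup>2) \<le> (\<xi> * Cb * (\<alpha> / 2 - \<theta>)) * (s0 * c0\<^sup>2)" using that s0 by (intro mult_right_mono) auto
    also have "\<dots> = \<xi> * Cb * ((\<alpha> / 2 - \<theta>) * (s0 * c0\<^sup>2))" by (simp add: mult_ac)
    also have "\<dots> \<le> \<xi> * Cb * wedge p" using lower Cb_ge(1) \<xi> by (intro mult_left_mono) auto
    finally show ?thesis .
  qed
  show "\<bar>\<phi>i p - \<phi>o p\<bar> * (s0 * c0\<^sup>2) \<le> \<xi> * Cb * wedge p" unfolding e1 abs_mult sg(4) using fin[OF g1] by simp
  show "\<bar>\<psi>i p - \<psi>o p\<bar> * (s0 * c0\<^sup>2) \<le> \<xi> * Cb * wedge p" unfolding e2 abs_mult sg(5) using fin[OF g2] by simp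
qed

definition cut :: "real \<Rightarrow> real \<Rightarrow> real \<Rightarrow> real" where
  "cut t0 t1 t = step (t - t0) * step (t1 - t)"

definition cut' :: "real \<Rightarrow> real \<Rightarrow> real \<Rightarrow> real" where
  "cut' t0 t1 t = deriv step (t - t0) * step (t1 - t) - step (t - t0) * deriv step (t1 - t)"

lemma has_derivative_cut: "(cut t0 t1 has_real_derivative cut' t0 t1 t) (at t)"
proof -
  have "((\<lambda>t. step (t - t0)) has_real_derivative deriv step (t - t0)) (at t)"
    by (rule DERIV_cong[OF DERIV_chain2[OF has_derivative_step]]) (auto intro!: derivative_eq_intros)
  moreover have "((\<lambda>t. step (t1 - t)) has_real_derivative - deriv step (t1 - t)) (at t)"
    by (rule DERIV_cong[OF DERIV_chain2[OF has_derivative_step]]) (auto intro!: derivative_eq_intros)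
  ultimately show ?thesis
    unfolding cut_def[abs_def] cut'_def by (rule DERIV_cong[OF DERIV_mult]) (simp add: algebra_simps)
qed

lemma cut_outside: "t \<le> t0 \<or> t1 \<le> t \<Longrightarrow> cut t0 t1 t = 0 \<and> cut' t0 t1 t = 0"
  by (auto simp: cut_def cut'_def deriv_step_eq_0)

lemma cut_plateau: "t0 + 1 \<le> t \<Longrightarrow> t \<le> t1 - 1 \<Longrightarrow> cut t0 t1 t = 1 \<and> cut' t0 t1 t = 0"
  by (auto simp: cut_def cut'_def deriv_step_eq_0)

lemma abs_cut_le: "\<bar>cut t0 t1 t\<bar> \<le> 1"
  unfolding cut_def abs_mult using abs_step_le[of "t - t0"] abs_step_le[of "t1 - t"] by (simp add: mult_le_one)

lemma abs_cut'_le: "\<bar>cut' t0 t1 t\<bar> \<le> 2 * K" if "\<And>x. \<bar>deriv step x\<bar> \<le> K"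
proof -
  have "\<bar>deriv step (t - t0) * step (t1 - t)\<bar> \<le> K * 1" "\<bar>step (t - t0) * deriv step (t1 - t)\<bar> \<le> 1 * K"
    unfolding abs_mult using that[of 0] by (intro mult_mono that abs_step_le; simp)+
  then show ?thesis unfolding cut'_def by linarith
qed

text \<open>For \<open>t1 \<le> 0\<close> this vanishes at the origin as well, where \<open>ln (norm p) = 0\<close>.\<close>

definition mode :: "real \<Rightarrow> real \<Rightarrow> (real \<Rightarrow> real) \<Rightarrow> (real^2 \<Rightarrow> real) \<Rightarrow> real^2 \<Rightarrow> real" where
  "mode t0 t1 osc G p = cut t0 t1 (ln (norm p)) * osc (\<xi> * ln (norm p)) * G p"

lemma ln_norm_iff: "p \<noteq> 0 \<Longrightarrow> ln (norm p) \<le> t \<longleftrightarrow> norm p \<le> exp t" "p \<noteq> 0 \<Longrightarrow> t \<le> ln (norm p) \<longleftrightarrow> exp t \<le> norm p"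
  by (auto simp: ln_ge_iff) (metis exp_le_cancel_iff exp_ln zero_less_norm_iff)+

lemma mode_eq_0:
  assumes "t1 \<le> 0" "norm p \<le> exp t0 \<or> exp t1 \<le> norm p"
  shows "mode t0 t1 osc G p = 0"
proof (cases "p = 0")
  case True
  then show ?thesis using cut_outside[of 0 t0 t1] assms(1) by (simp add: mode_def)
next
  case False
  then show ?thesis using cut_outside[of "ln (norm p)" t0 t1] assms(2) ln_norm_iff[OF False] by (simp add: mode_def)
qed

lemma smooth_on_mode:
  assumes t1: "t1 \<le> 0" and G: "smooth_on G (- {0})"
    and osc: "\<And>f S. smooth_on f S \<Longrightarrow> open S \<Longrightarrow> smooth_on (\<lambda>p. osc (f p)) S"
  shows "smooth_on (mode t0 t1 osc G) UNIV"
proof -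
  have ln: "smooth_on (\<lambda>p. ln (norm p)) (- {0})" by (rule smooth_on_ln_norm) auto
  have 1: "smooth_on (mode t0 t1 osc G) (- {0})"
    unfolding mode_def[abs_def] cut_def
    by (intro smooth_on_mult smooth_on_step smooth_on_diff smooth_on_const osc ln G) auto
  have 2: "smooth_on (mode t0 t1 osc G) (ball 0 (exp t0))"
    using smooth_on_cong[of "ball 0 (exp t0)" "mode t0 t1 osc G" "\<lambda>p. 0"] mode_eq_0[OF t1] smooth_on_const by auto
  have "- {0} \<union> ball 0 (exp t0) = (UNIV :: (real^2) set)" by auto
  then show ?thesis using smooth_on_Un[OF 1 2] by auto
qed

lemma mode_test_function:
  assumes "t1 \<le> 0" "smooth_on G (- {0})" "\<And>f S. smooth_on f S \<Longrightarrow> open S \<Longrightarrow> smooth_on (\<lambda>p. osc (f p)) S"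
    and "cball 0 (exp t1) \<subseteq> \<Omega>"
  shows "mode t0 t1 osc G \<in> test_functions \<Omega>"
  by (rule test_functionsI[OF smooth_on_mode[OF assms(1-3)] compact_cball assms(4)])
    (use mode_eq_0[OF assms(1)] in auto)

lemma has_grad_mode:
  assumes p: "p \<noteq> 0" and G: "has_grad G (b *\<^sub>R angular p) p"
    and osc: "\<And>x. (osc has_real_derivative osc' x) (at x)"
  defines "t \<equiv> ln (norm p)"
  shows "grad (mode t0 t1 osc G) p
    = ((cut' t0 t1 t * osc (\<xi> * t) + cut t0 t1 t * \<xi> * osc' (\<xi> * t)) * G p) *\<^sub>R radial p
      + (cut t0 t1 t * osc (\<xi> * t) * b) *\<^sub>R angular p"
proof (rule grad_eqI)
  have d: "((\<lambda>t. cut t0 t1 t * osc (\<xi> * t)) has_real_derivative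
      cut' t0 t1 t * osc (\<xi> * t) + cut t0 t1 t * \<xi> * osc' (\<xi> * t)) (at t)"
    by (rule DERIV_cong[OF DERIV_mult[OF has_derivative_cut DERIV_chain2[OF osc]]])
      (auto intro!: derivative_eq_intros)
  have "has_grad (\<lambda>p. cut t0 t1 (ln (norm p)) * osc (\<xi> * ln (norm p)))
    ((cut' t0 t1 t * osc (\<xi> * t) + cut t0 t1 t * \<xi> * osc' (\<xi> * t)) *\<^sub>R radial p) p"
    using has_grad_compose[OF has_grad_ln_norm[OF p] d[unfolded t_def]] by (simp add: t_def)
  from has_grad_mult[OF this G]
  show "has_grad (mode t0 t1 osc G) (((cut' t0 t1 t * osc (\<xi> * t) + cut t0 t1 t * \<xi> * osc' (\<xi> * t)) * G p) *\<^sub>R radial p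
      + (cut t0 t1 t * osc (\<xi> * t) * b) *\<^sub>R angular p) p"
    unfolding mode_def[abs_def] t_def by (rule has_derivative_eq_rhs) (simp add: inner_add_left algebra_simps)
qed

abbreviation "u_mode t0 t1 \<epsilon> \<equiv> mode t0 t1 cos (glue \<epsilon> \<phi>i \<phi>o)"
abbreviation "f_mode t0 t1 \<epsilon> \<equiv> mode t0 t1 sin (glue \<epsilon> \<psi>i \<psi>o)"

lemma mode_test_functions:
  assumes "t1 \<le> 0" "0 < \<epsilon>" "\<epsilon> < s0\<^sup>2" "cball 0 (exp t1) \<subseteq> \<Omega>"
  shows "u_mode t0 t1 \<epsilon> \<in> test_functions \<Omega>" "f_mode t0 t1 \<epsilon> \<in> test_functions \<Omega>"
  using assms by (auto intro!: mode_test_function smooth_on_glue smooth_on_profiles smooth_on_sin smooth_on_cos)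

text \<open>Away from the cut-offs and from the layer the two modes are conjugate to each other, and the
  flux defect vanishes. In the remaining regions it is of the order of \<open>1 / norm p\<close>.\<close>

lemma flux_defect_bound:
  obtains C where "C \<ge> 0"
    "\<And>t0 t1 \<epsilon> E p. \<lbrakk>0 < \<epsilon>; \<epsilon> < s0\<^sup>2; p \<noteq> 0; norm p < exp t1 \<Longrightarrow> p \<in> E \<longleftrightarrow> 0 < wedge p\<rbrakk> \<Longrightarrow>
      norm (flux_defect E \<beta> (u_mode t0 t1 \<epsilon>) (f_mode t0 t1 \<epsilon>) p)
      \<le> C * (indicator {p. exp t0 \<le> norm p \<and> norm p \<le> exp t1 \<and> 0 < wedge p \<and> wedge p < \<epsilon>} p
           + indicator {p. exp t0 \<le> norm p \<and> norm p \<le> exp (t0 + 1) \<or> exp (t1 - 1) \<le> norm p \<and> norm p \<le> exp t1} p) / norm p"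
proof -
  obtain K where K: "\<And>x. \<bar>deriv step x\<bar> \<le> K" using bounded_deriv_step by blast
  have K0: "0 \<le> K" using K[of 0] by linarith
  define L where "L = \<xi> * Cb / (s0 * c0\<^sup>2)"
  define N where "N = \<xi> * Cb / (1 - \<beta>) + \<xi> * Cb / \<beta> + 2 * (\<xi> * Cb) + K * L"
  define C where "C = 2 * ((2 * K + \<xi>) * Cb + N) + 2 * (2 * K * Cb)"
  note pos = Cb_ge(1) \<xi> \<beta>(1,2) K0 s0(1) c0
  have L0: "0 \<le> L" using pos by (simp add: L_def)
  have N0: "0 \<le> N" "0 \<le> \<xi> * Cb / (1 - \<beta>)" "0 \<le> \<xi> * Cb / \<beta>" "0 \<le> \<xi> * Cb" "0 \<le> K * L"
    using pos L0 by (auto simp: N_def)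
  have C0: "0 \<le> C" "2 * (2 * K * Cb) \<le> C" "2 * ((2 * K + \<xi>) * Cb + N) \<le> C" using pos N0 by (auto simp: C_def)
  show ?thesis
  proof (rule that[OF C0(1)])
    fix t0 t1 \<epsilon> :: real and E and p :: "real^2"
    assume \<epsilon>: "0 < \<epsilon>" "\<epsilon> < s0\<^sup>2" and p: "p \<noteq> 0" and E: "norm p < exp t1 \<Longrightarrow> p \<in> E \<longleftrightarrow> 0 < wedge p"
    let ?S = "{p. exp t0 \<le> norm p \<and> norm p \<le> exp t1 \<and> 0 < wedge p \<and> wedge p < \<epsilon>}"
    let ?T = "{p :: real^2. exp t0 \<le> norm p \<and> norm p \<le> exp (t0 + 1) \<or> exp (t1 - 1) \<le> norm p \<and> norm p \<le> exp t1}"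
    define F where "F = flux_defect E \<beta> (u_mode t0 t1 \<epsilon>) (f_mode t0 t1 \<epsilon>) p"
    define t where "t = ln (norm p)"
    define a where "a = indicator E p - \<beta>"
    define X where "X = cut t0 t1 t"
    define X' where "X' = cut' t0 t1 t"
    define \<Phi> where "\<Phi> = glue \<epsilon> \<phi>i \<phi>o p"
    define \<Psi> where "\<Psi> = glue \<epsilon> \<psi>i \<psi>o p"
    let ?h = "step (wedge p / \<epsilon>)" and ?h' = "deriv step (wedge p / \<epsilon>)"
    obtain c where c: "\<bar>c\<bar> \<le> 1" "has_grad (glue \<epsilon> \<phi>i \<phi>o)
      ((?h * (\<xi> / (1 - \<beta>) * \<psi>i p) + (1 - ?h) * (\<xi> / (- \<beta>) * \<psi>o p) + ?h' * c / \<epsilon> * (\<phi>i p - \<phi>o p)) *\<^sub>R angular p) p"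
      using has_grad_glue[where gi=\<phi>i and go=\<phi>o and ci="\<lambda>p. \<xi> / (1 - \<beta>) * \<psi>i p" and co="\<lambda>p. \<xi> / (- \<beta>) * \<psi>o p",
          OF has_grad_inner_profiles(1) has_grad_outer_profiles(1) \<epsilon> p] by blast
    obtain d where d: "\<bar>d\<bar> \<le> 1" "has_grad (glue \<epsilon> \<psi>i \<psi>o)
      ((?h * (\<xi> * (1 - \<beta>) * \<phi>i p) + (1 - ?h) * (\<xi> * (- \<beta>) * \<phi>o p) + ?h' * d / \<epsilon> * (\<psi>i p - \<psi>o p)) *\<^sub>R angular p) p"
      using has_grad_glue[where gi=\<psi>i and go=\<psi>o and ci="\<lambda>p. \<xi> * (1 - \<beta>) * \<phi>i p" and co="\<lambda>p. \<xi> * (- \<beta>) * \<phi>o p",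
          OF has_grad_inner_profiles(2) has_grad_outer_profiles(2) \<epsilon> p] by blast
    define b\<Phi> where "b\<Phi> = ?h * (\<xi> / (1 - \<beta>) * \<psi>i p) + (1 - ?h) * (\<xi> / (- \<beta>) * \<psi>o p) + ?h' * c / \<epsilon> * (\<phi>i p - \<phi>o p)"
    define b\<Psi> where "b\<Psi> = ?h * (\<xi> * (1 - \<beta>) * \<phi>i p) + (1 - ?h) * (\<xi> * (- \<beta>) * \<phi>o p) + ?h' * d / \<epsilon> * (\<psi>i p - \<psi>o p)"
    define R where "R = a * (X' * cos (\<xi> * t) + X * \<xi> * (- sin (\<xi> * t))) * \<Phi> + X * sin (\<xi> * t) * b\<Psi>"
    define Q where "Q = a * (X * cos (\<xi> * t)) * b\<Phi> - (X' * sin (\<xi> * t) + X * \<xi> * cos (\<xi> * t)) * \<Psi>"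
    have gu: "grad (u_mode t0 t1 \<epsilon>) p = ((X' * cos (\<xi> * t) + X * \<xi> * (- sin (\<xi> * t))) * \<Phi>) *\<^sub>R radial p
        + (X * cos (\<xi> * t) * b\<Phi>) *\<^sub>R angular p"
      using has_grad_mode[OF p c(2) DERIV_cos] by (simp only: t_def X_def X'_def \<Phi>_def b\<Phi>_def)
    have gf: "grad (f_mode t0 t1 \<epsilon>) p = ((X' * sin (\<xi> * t) + X * \<xi> * cos (\<xi> * t)) * \<Psi>) *\<^sub>R radial p
        + (X * sin (\<xi> * t) * b\<Psi>) *\<^sub>R angular p"
      using has_grad_mode[OF p d(2) DERIV_sin] by (simp only: t_def X_def X'_def \<Psi>_def b\<Psi>_def)
    have "F = R *\<^sub>R radial p + Q *\<^sub>R angular p"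
      unfolding F_def flux_defect_def gu gf R_def Q_def a_def[symmetric]
      by (simp add: rot_add rot_scaleR algebra_simps)
    then have F: "norm F \<le> (\<bar>R\<bar> + \<bar>Q\<bar>) / norm p" using norm_polar_le by metis
    have X: "\<bar>X\<bar> \<le> 1" unfolding X_def by (rule abs_cut_le)
    have X': "\<bar>X'\<bar> \<le> 2 * K * indicator ?T p"
    proof (cases "p \<in> ?T")
      case True
      then show ?thesis using abs_cut'_le[OF K] by (simp add: X'_def)
    next
      case False
      then have "t \<le> t0 \<or> t1 \<le> t \<or> (t0 + 1 \<le> t \<and> t \<le> t1 - 1)"
        using ln_norm_iff[OF p] unfolding t_def by auto
      then have "X' = 0" using cut_outside cut_plateau unfolding X'_def by blast
      then show ?thesis using K0 by simp
    qed
    have h: "0 \<le> ?h" "?h \<le> 1" using step_nonneg step_le_1 by auto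
    have convex: "\<bar>?h * x + (1 - ?h) * y\<bar> \<le> z" if "\<bar>x\<bar> \<le> z" "\<bar>y\<bar> \<le> z" for x y z
    proof -
      have "\<bar>?h * x + (1 - ?h) * y\<bar> \<le> ?h * \<bar>x\<bar> + (1 - ?h) * \<bar>y\<bar>"
        using h abs_triangle_ineq[of "?h * x" "(1 - ?h) * y"] by (simp add: abs_mult)
      also have "\<dots> \<le> ?h * z + (1 - ?h) * z" using h that by (intro add_mono mult_left_mono) auto
      finally show ?thesis by (simp add: algebra_simps)
    qed
    have \<Phi>: "\<bar>\<Phi>\<bar> \<le> Cb" and \<Psi>: "\<bar>\<Psi>\<bar> \<le> Cb"
      unfolding \<Phi>_def \<Psi>_def glue_def by (intro convex profiles_le)+
    have a: "\<bar>a\<bar> \<le> 1" using \<beta>(1,2) by (auto simp: a_def indicator_def)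
    have RQ: "\<bar>R\<bar> + \<bar>Q\<bar> \<le> C * (indicator ?S p + indicator ?T p)"
    proof (cases "t \<le> t0 \<or> t1 \<le> t")
      case True
      then have "X = 0" "X' = 0" using cut_outside unfolding X_def X'_def by blast+
      then have "R = 0" "Q = 0" by (auto simp: R_def Q_def)
      then show ?thesis using C0 by simp
    next
      case inside: False
      then have norm_p: "exp t0 < norm p" "norm p < exp t1" using ln_norm_iff[OF p] unfolding t_def by (simp_all add: not_le[symmetric])
      have aval: "a = (if 0 < wedge p then 1 - \<beta> else - \<beta>)" using E[OF norm_p(2)] by (auto simp: a_def indicator_def)
      show ?thesis
      proof (cases "0 < wedge p \<and> wedge p < \<epsilon>")
        case False
        have conj: "b\<Phi> = \<xi> / a * \<Psi> \<and> b\<Psi> = \<xi> * a * \<Phi>"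
        proof (cases "wedge p \<le> 0")
          case True
          then have "?h = 0" "?h' = 0" using \<epsilon> by (auto intro!: deriv_step_eq_0 simp: divide_nonpos_pos)
          then show ?thesis using True aval by (simp add: b\<Phi>_def b\<Psi>_def \<Phi>_def \<Psi>_def glue_eq(1)[OF \<epsilon>(1)])
        next
          case w: False
          then have "?h = 1" "?h' = 0" using \<epsilon> False by (auto intro!: deriv_step_eq_0)
          then show ?thesis using w False aval by (simp add: b\<Phi>_def b\<Psi>_def \<Phi>_def \<Psi>_def glue_eq(2)[OF \<epsilon>(1)])
        qed
        have a0: "a \<noteq> 0" using aval \<beta>(1,2) by auto
        have R: "R = X' * (a * cos (\<xi> * t) * \<Phi>)" and Q: "Q = X' * (- sin (\<xi> * t) * \<Psi>)"
          unfolding R_def Q_def using conj a0 by (auto simp: field_simps)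
        have "\<bar>a * cos (\<xi> * t) * \<Phi>\<bar> \<le> 1 * 1 * Cb" "\<bar>- sin (\<xi> * t) * \<Psi>\<bar> \<le> 1 * Cb"
          unfolding abs_mult using a \<Phi> \<Psi> by (intro mult_mono; simp add: mult_le_one)+
        then have "\<bar>R\<bar> \<le> 2 * K * indicator ?T p * Cb" "\<bar>Q\<bar> \<le> 2 * K * indicator ?T p * Cb"
          unfolding R Q abs_mult[of X'] using X' K0 by (auto intro!: mult_mono)
        then have "\<bar>R\<bar> + \<bar>Q\<bar> \<le> 2 * (2 * K * Cb) * indicator ?T p" by (simp add: algebra_simps)
        also have "\<dots> \<le> C * indicator ?T p" using C0 by (intro mult_right_mono) auto
        also have "\<dots> \<le> C * (indicator ?S p + indicator ?T p)" using C0 by (intro mult_left_mono) auto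
        finally show ?thesis .
      next
        case True
        have nz: "p $ 1 \<noteq> 0" "p $ 2 \<noteq> 0" using wedge_axes[OF p] True \<epsilon> by auto
        have gap: "\<bar>\<phi>i p - \<phi>o p\<bar> \<le> L * \<epsilon>" "\<bar>\<psi>i p - \<psi>o p\<bar> \<le> L * \<epsilon>"
        proof -
          have sc: "s0 * c0\<^sup>2 > 0" using s0 c0 by simp
          have "\<xi> * Cb * wedge p \<le> \<xi> * Cb * \<epsilon>" using True N0 by (intro mult_left_mono) auto
          then have "\<bar>\<phi>i p - \<phi>o p\<bar> * (s0 * c0\<^sup>2) \<le> \<xi> * Cb * \<epsilon>" "\<bar>\<psi>i p - \<psi>o p\<bar> * (s0 * c0\<^sup>2) \<le> \<xi> * Cb * \<epsilon>"
            using profile_gap[OF nz] True by auto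
          then show "\<bar>\<phi>i p - \<phi>o p\<bar> \<le> L * \<epsilon>" "\<bar>\<psi>i p - \<psi>o p\<bar> \<le> L * \<epsilon>"
            unfolding L_def using sc by (auto simp: pos_le_divide_eq)
        qed
        have layer: "\<bar>?h' * e / \<epsilon> * g\<bar> \<le> K * L" if "\<bar>e\<bar> \<le> 1" "\<bar>g\<bar> \<le> L * \<epsilon>" for e g
        proof -
          have "\<bar>?h'\<bar> * \<bar>e\<bar> * \<bar>g\<bar> \<le> K * 1 * (L * \<epsilon>)" using that K K0 L0 \<epsilon> by (intro mult_mono) auto
          then show ?thesis using \<epsilon> by (simp add: abs_mult field_simps)
        qed
        have b\<Phi>: "\<bar>b\<Phi>\<bar> \<le> N"
        proof -
          have "\<bar>\<xi> / (1 - \<beta>) * \<psi>i p\<bar> \<le> \<xi> / (1 - \<beta>) * Cb" "\<bar>\<xi> / (- \<beta>) * \<psi>o p\<bar> \<le> \<xi> / \<beta> * Cb"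
            using \<xi> \<beta>(1,2) profiles_le(2,4)[of p] unfolding abs_mult
            by (auto intro!: divide_right_mono mult_left_mono)
          then have "\<bar>?h * (\<xi> / (1 - \<beta>) * \<psi>i p) + (1 - ?h) * (\<xi> / (- \<beta>) * \<psi>o p)\<bar> \<le> \<xi> * Cb / (1 - \<beta>) + \<xi> * Cb / \<beta>"
            using N0 by (intro convex) auto
          then show ?thesis using layer[OF c(1) gap(1)] N0(4) unfolding b\<Phi>_def N_def by linarith
        qed
        have b\<Psi>: "\<bar>b\<Psi>\<bar> \<le> N"
        proof -
          have "\<bar>\<xi> * (1 - \<beta>) * \<phi>i p\<bar> \<le> \<xi> * 1 * Cb" "\<bar>\<xi> * (- \<beta>) * \<phi>o p\<bar> \<le> \<xi> * 1 * Cb"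
            using \<xi> \<beta>(1,2) profiles_le(1,3)[of p] unfolding abs_mult by (intro mult_mono; simp)+
          then have "\<bar>?h * (\<xi> * (1 - \<beta>) * \<phi>i p) + (1 - ?h) * (\<xi> * (- \<beta>) * \<phi>o p)\<bar> \<le> \<xi> * Cb"
            by (intro convex) auto
          then show ?thesis using layer[OF d(1) gap(2)] N0 unfolding b\<Psi>_def N_def by linarith
        qed
        have X'2: "\<bar>X'\<bar> \<le> 2 * K" using abs_cut'_le[OF K] by (simp add: X'_def)
        have osc: "\<bar>X' * x + X * \<xi> * y\<bar> \<le> 2 * K + \<xi>" if "\<bar>x\<bar> \<le> 1" "\<bar>y\<bar> \<le> 1" for x y
        proof -
          have "\<bar>X' * x\<bar> \<le> (2 * K) * 1" "\<bar>X * \<xi> * y\<bar> \<le> 1 * \<xi> * 1"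
            unfolding abs_mult using that X X'2 K0 \<xi> by (intro mult_mono; simp)+
          then show ?thesis by linarith
        qed
        have "\<bar>a * (X' * cos (\<xi> * t) + X * \<xi> * (- sin (\<xi> * t))) * \<Phi>\<bar> \<le> 1 * (2 * K + \<xi>) * Cb"
          unfolding abs_mult[of _ \<Phi>] abs_mult[of a] using a \<Phi> K0 \<xi> by (intro mult_mono osc) auto
        moreover have "\<bar>X * sin (\<xi> * t) * b\<Psi>\<bar> \<le> 1 * 1 * N"
          unfolding abs_mult using X b\<Psi> by (intro mult_mono) auto
        moreover have "\<bar>a * (X * cos (\<xi> * t)) * b\<Phi>\<bar> \<le> 1 * (1 * 1) * N"
          unfolding abs_mult using X a b\<Phi> by (intro mult_mono) auto
        moreover have "\<bar>(X' * sin (\<xi> * t) + X * \<xi> * cos (\<xi> * t)) * \<Psi>\<bar> \<le> (2 * K + \<xi>) * Cb"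
          unfolding abs_mult[of _ \<Psi>] using \<Psi> K0 \<xi> by (intro mult_mono osc) auto
        moreover have "\<bar>x1 + x2\<bar> + \<bar>y1 - y2\<bar> \<le> 2 * (m + n)"
          if "\<bar>x1\<bar> \<le> m" "\<bar>x2\<bar> \<le> n" "\<bar>y1\<bar> \<le> n" "\<bar>y2\<bar> \<le> m" for x1 x2 y1 y2 m n :: real
          using abs_triangle_ineq[of x1 x2] abs_triangle_ineq4[of y1 y2] that by simp
        ultimately have "\<bar>R\<bar> + \<bar>Q\<bar> \<le> 2 * ((2 * K + \<xi>) * Cb + N)"
          unfolding R_def Q_def mult_1 by blast
        also have "\<dots> \<le> C * 1" using C0 by simp
        also have "\<dots> \<le> C * (indicator ?S p + indicator ?T p)"
          using C0 True norm_p by (intro mult_left_mono) auto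
        finally show ?thesis .
      qed
    qed
    have "(\<bar>R\<bar> + \<bar>Q\<bar>) / norm p \<le> C * (indicator ?S p + indicator ?T p) / norm p"
      using RQ by (intro divide_right_mono) auto
    then show "norm (flux_defect E \<beta> (u_mode t0 t1 \<epsilon>) (f_mode t0 t1 \<epsilon>) p)
      \<le> C * (indicator ?S p + indicator ?T p) / norm p" using F unfolding F_def by linarith
  qed
qed

lemma grad_u_mode_lower_bound:
  assumes \<epsilon>: "0 < \<epsilon>" "\<epsilon> < s0\<^sup>2" and p: "\<epsilon> < wedge p" "p \<noteq> 0" and t: "exp (t0 + 1) \<le> norm p" "norm p \<le> exp (t1 - 1)"
  shows "(\<xi> * sin (\<xi> * ln (norm p)))\<^sup>2 / (norm p)\<^sup>2 \<le> (norm (grad (u_mode t0 t1 \<epsilon>) p))\<^sup>2"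
proof -
  have x: "p $ 1 \<noteq> 0" using wedge_axes[OF p(2)] p(1) \<epsilon> by auto
  let ?t = "ln (norm p)" and ?b = "\<xi> / (1 - \<beta>) * \<psi>i p"
  have "has_grad (glue \<epsilon> \<phi>i \<phi>o) (?b *\<^sub>R angular p) p"
    by (rule has_grad_transform[OF has_grad_inner_profiles(1)[OF x] open_wedge(2)]) (use p glue_eq(2)[OF \<epsilon>(1)] in auto)
  from has_grad_mode[OF p(2) this DERIV_cos, of t0 t1]
  have "grad (u_mode t0 t1 \<epsilon>) p = ((- \<xi> * sin (\<xi> * ?t)) * glue \<epsilon> \<phi>i \<phi>o p) *\<^sub>R radial p + (cos (\<xi> * ?t) * ?b) *\<^sub>R angular p"
    using cut_plateau[of t0 ?t t1] t ln_norm_iff[OF p(2)] by simp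
  then have "((- \<xi> * sin (\<xi> * ?t)) * glue \<epsilon> \<phi>i \<phi>o p)\<^sup>2 / (norm p)\<^sup>2 \<le> (norm (grad (u_mode t0 t1 \<epsilon>) p))\<^sup>2"
    using norm_polar_ge[OF p(2)] by metis
  moreover have "(\<xi> * sin (\<xi> * ?t))\<^sup>2 \<le> ((- \<xi> * sin (\<xi> * ?t)) * glue \<epsilon> \<phi>i \<phi>o p)\<^sup>2"
  proof -
    have "1 \<le> \<bar>\<phi>i p\<bar>" unfolding \<phi>i_def abs_mult using x cosh_real_ge_1 by (simp add: sgn_if)
    then have "1\<^sup>2 \<le> (\<phi>i p)\<^sup>2" by (metis abs_le_square_iff abs_one)
    then have "(\<xi> * sin (\<xi> * ?t))\<^sup>2 * 1 \<le> (\<xi> * sin (\<xi> * ?t))\<^sup>2 * (\<phi>i p)\<^sup>2" by (intro mult_left_mono) auto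
    then show ?thesis using glue_eq(2)[OF \<epsilon>(1)] p by (simp add: power_mult_distrib)
  qed
  ultimately show ?thesis by (meson divide_right_mono order_trans zero_le_power2)
qed

end

lemma (in corner) grad_mode_0:
  assumes "t1 \<le> 0" shows "grad (mode t0 t1 osc G) 0 = 0"
proof (rule grad_eqI)
  show "has_grad (mode t0 t1 osc G) 0 0"
    by (rule has_grad_transform[where S="ball 0 (exp t0)", OF has_grad_const[of 0]]) (use mode_eq_0[OF assms] in auto)
qed

lemma (in corner) measurable_wedge: "wedge \<in> borel_measurable borel"
  unfolding wedge_def[abs_def]
  by (intro borel_measurable_divide borel_measurable_diff borel_measurable_power borel_measurable_continuous_onI continuous_intros)

context corner
begin

text \<open>The balls around the points \<open>(exp (\<tau> j), 0)\<close>, at which the oscillation \<open>cos (\<xi> ln r)\<close> has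
  maximal slope. They are dilates of each other, and each carries the same amount of energy of the
  mode.\<close>

definition \<tau> :: "nat \<Rightarrow> real" where "\<tau> j = - (real j * pi + pi / 2) / \<xi>"
definition \<kappa> :: real where "\<kappa> = min (1 / 2) (min (1 / (4 * \<xi>)) (s0 / 4))"
definition tip_disc :: "nat \<Rightarrow> (real^2) set" where
  "tip_disc j = ball (exp (\<tau> j) *\<^sub>R axis 1 1) (\<kappa> * exp (\<tau> j))"

lemma \<kappa>: "0 < \<kappa>" "\<kappa> \<le> 1 / 2" "\<kappa> \<le> 1 / (4 * \<xi>)" "\<kappa> \<le> s0 / 4"
  using \<xi> s0 by (auto simp: \<kappa>_def)

lemma tip_disc_bounds:
  assumes "p \<in> tip_disc j"
  shows "p \<noteq> 0 \<and> norm p \<le> 2 * exp (\<tau> j) \<and> \<bar>ln (norm p) - \<tau> j\<bar> \<le> 1 / (2 * \<xi>) \<and> s0\<^sup>2 / 12 \<le> wedge p"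
proof -
  let ?r = "exp (\<tau> j)"
  let ?c = "?r *\<^sub>R axis 1 1 :: real^2"
  have d: "norm (p - ?c) < \<kappa> * ?r" using assms by (simp add: tip_disc_def dist_norm norm_minus_commute)
  have nc: "norm ?c = ?r" by (simp add: norm_axis_1)
  have up: "norm p \<le> (1 + \<kappa>) * ?r" using norm_triangle_sub[of p ?c] d nc by (simp add: algebra_simps)
  have lo: "(1 - \<kappa>) * ?r \<le> norm p" using norm_triangle_sub[of ?c p] d nc by (simp add: algebra_simps norm_minus_commute)
  have "(1 - \<kappa>) * ?r > 0" using \<kappa> by simp
  then have p0: "norm p > 0" using lo by linarith
  have "\<kappa> * ?r \<le> 1 * ?r" using \<kappa> by (intro mult_right_mono) auto
  then have up2: "norm p \<le> 2 * ?r" using up unfolding distrib_right by linarith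
  have "ln (norm p) \<le> ln ((1 + \<kappa>) * ?r)" using up p0 \<kappa> by (subst ln_le_cancel_iff) auto
  also have "\<dots> = ln (1 + \<kappa>) + \<tau> j" using \<kappa> by (simp add: ln_mult)
  also have "\<dots> \<le> \<kappa> + \<tau> j" using ln_add_one_self_le_self[of \<kappa>] \<kappa> by simp
  finally have l1: "ln (norm p) - \<tau> j \<le> 2 * \<kappa>" using \<kappa> by simp
  have "2 * \<kappa>\<^sup>2 \<le> \<kappa>" using \<kappa> by (simp add: power2_eq_square)
  then have "- (2 * \<kappa>) \<le> ln (1 - \<kappa>)" using ln_one_minus_pos_lower_bound[of \<kappa>] \<kappa> by simp
  then have "- (2 * \<kappa>) + \<tau> j \<le> ln ((1 - \<kappa>) * ?r)" using \<kappa> by (simp add: ln_mult)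
  also have "\<dots> \<le> ln (norm p)" using lo p0 \<kappa> by (subst ln_le_cancel_iff) auto
  finally have l2: "- (2 * \<kappa>) \<le> ln (norm p) - \<tau> j" by simp
  have "2 * \<kappa> \<le> 1 / (2 * \<xi>)" using \<kappa>(3) \<xi> by (simp add: field_simps)
  then have l: "\<bar>ln (norm p) - \<tau> j\<bar> \<le> 1 / (2 * \<xi>)" using l1 l2 by linarith
  have x: "p $ 1 \<ge> ?r / 2" and y: "\<bar>p $ 2\<bar> \<le> s0 / 4 * ?r"
  proof -
    have "\<bar>(p - ?c) $ 1\<bar> \<le> \<kappa> * ?r" "\<bar>(p - ?c) $ 2\<bar> \<le> \<kappa> * ?r"
      using d component_le_norm_cart[of "p - ?c" 1] component_le_norm_cart[of "p - ?c" 2] by linarith+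
    then have a: "\<bar>p $ 1 - ?r\<bar> \<le> \<kappa> * ?r" "\<bar>p $ 2\<bar> \<le> \<kappa> * ?r" by (simp_all add: axis_def)
    have "\<kappa> * ?r \<le> 1 / 2 * ?r" "\<kappa> * ?r \<le> s0 / 4 * ?r" using \<kappa> by (intro mult_right_mono; simp)+
    then show "p $ 1 \<ge> ?r / 2" "\<bar>p $ 2\<bar> \<le> s0 / 4 * ?r" using a by linarith+
  qed
  have "(?r / 2)\<^sup>2 \<le> (p $ 1)\<^sup>2" using x by (intro power_mono) auto
  then have x2: "s0\<^sup>2 * (?r\<^sup>2 / 4) \<le> (s0 * p $ 1)\<^sup>2"
    unfolding power_mult_distrib power_divide by (intro mult_left_mono) auto
  have "\<bar>p $ 2\<bar>\<^sup>2 \<le> (s0 / 4 * ?r)\<^sup>2" using y by (intro power_mono) auto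
  moreover have "(c0 * p $ 2)\<^sup>2 \<le> 1 * (p $ 2)\<^sup>2"
    unfolding power_mult_distrib using c0 cos_le_one[of "\<alpha>/2"] by (intro mult_right_mono) (auto simp: power_le_one)
  ultimately have y2: "(c0 * p $ 2)\<^sup>2 \<le> s0\<^sup>2 * (?r\<^sup>2 / 16)" by (simp add: power_mult_distrib power_divide)
  have "(1 + \<kappa>) * ?r \<le> 3 / 2 * ?r" using \<kappa> by (intro mult_right_mono) auto
  then have "norm p \<le> 3 / 2 * ?r" using up by linarith
  then have "(norm p)\<^sup>2 \<le> (3 / 2 * ?r)\<^sup>2" by (intro power_mono) auto
  then have n2: "(norm p)\<^sup>2 \<le> 9 / 4 * ?r\<^sup>2" by (simp add: power_mult_distrib power_divide)
  have "s0\<^sup>2 / 12 * (norm p)\<^sup>2 \<le> s0\<^sup>2 / 12 * (9 / 4 * ?r\<^sup>2)" using n2 by (intro mult_left_mono) auto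
  also have "\<dots> = s0\<^sup>2 * (?r\<^sup>2 / 4) - s0\<^sup>2 * (?r\<^sup>2 / 16)" by simp
  also have "\<dots> \<le> (s0 * p $ 1)\<^sup>2 - (c0 * p $ 2)\<^sup>2" using x2 y2 by linarith
  finally have "s0\<^sup>2 / 12 \<le> wedge p" unfolding wedge_def using p0 by (simp add: pos_le_divide_eq)
  then show ?thesis using p0 up2 l by auto
qed

lemma sin_sq_near_\<tau>:
  assumes "\<bar>l - \<tau> j\<bar> \<le> 1 / (2 * \<xi>)"
  shows "1 / 4 \<le> (sin (\<xi> * l))\<^sup>2"
proof -
  define y where "y = real j * pi + pi / 2"
  define \<delta> where "\<delta> = \<xi> * (l - \<tau> j)"
  have "\<bar>\<delta>\<bar> \<le> \<xi> * (1 / (2 * \<xi>))" unfolding \<delta>_def abs_mult using assms \<xi> by (intro mult_mono) auto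
  then have \<delta>: "\<bar>\<delta>\<bar> \<le> 1 / 2" using \<xi> by simp
  have "\<xi> * l = \<delta> - y" unfolding \<delta>_def y_def \<tau>_def using \<xi> by (simp add: field_simps)
  moreover have "cos y = 0" unfolding y_def by (simp add: cos_add)
  moreover have "(sin y)\<^sup>2 = 1" using sin_squared_eq[of y] \<open>cos y = 0\<close> by simp
  ultimately have "(sin (\<xi> * l))\<^sup>2 = (cos \<delta>)\<^sup>2" by (simp add: sin_diff power_mult_distrib)
  moreover have "1 / 2 \<le> cos \<bar>\<delta>\<bar>"
  proof -
    have "cos (pi / 3) \<le> cos \<bar>\<delta>\<bar>" using \<delta> pi_ge_two by (intro cos_monotone_0_pi_le) auto
    then show ?thesis by (simp add: cos_60)
  qed
  then have "(1 / 2)\<^sup>2 \<le> (cos \<delta>)\<^sup>2" by (intro power_mono) auto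
  ultimately show ?thesis by (simp add: power2_eq_square)
qed

lemma tip_disc_disjoint:
  assumes "p \<in> tip_disc i" "p \<in> tip_disc j"
  shows "i = j"
proof (rule ccontr)
  assume "i \<noteq> j"
  then have "1 \<le> \<bar>real i - real j\<bar>" by linarith
  then have "pi / \<xi> * 1 \<le> pi / \<xi> * \<bar>real i - real j\<bar>" using \<xi> by (intro mult_left_mono) auto
  also have "\<dots> = \<bar>\<tau> i - \<tau> j\<bar>"
  proof -
    have "\<tau> i - \<tau> j = - (pi / \<xi> * (real i - real j))" unfolding \<tau>_def using \<xi> by (simp add: field_simps)
    then show ?thesis using \<xi> by (simp add: abs_mult)
  qed
  also have "\<dots> \<le> 1 / (2 * \<xi>) + 1 / (2 * \<xi>)" using tip_disc_bounds[OF assms(1)] tip_disc_bounds[OF assms(2)] by linarith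
  also have "\<dots> = 1 / \<xi>" by simp
  finally show False using \<xi> pi_ge_two by (simp add: field_simps)
qed

end

context bounded_domain
begin

section \<open>Existence of quasi-modes\<close>

definition has_quasimodes :: "(real^2) set \<Rightarrow> real \<Rightarrow> bool" where
  "has_quasimodes E \<beta> \<longleftrightarrow> (\<forall>\<eta>>0. \<exists>u\<in>test_functions \<Omega>. \<exists>f\<in>test_functions \<Omega>.
     0 < (LINT x|M. (norm (grad u x))\<^sup>2) \<and>
     (LINT x|M. (norm (flux_defect E \<beta> u f x))\<^sup>2) \<le> \<eta> * (LINT x|M. (norm (grad u x))\<^sup>2))"

text \<open>Changing \<open>\<beta>\<close> by a small amount changes the flux defect by a small multiple of the gradient.\<close>

lemma has_quasimodes_closed:
  assumes E: "E \<in> sets lebesgue" and near: "\<And>e. e > 0 \<Longrightarrow> \<exists>\<beta>'. \<bar>\<beta>' - \<beta>\<bar> < e \<and> has_quasimodes E \<beta>'"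
  shows "has_quasimodes E \<beta>"
  unfolding has_quasimodes_def
proof (intro allI impI)
  fix \<eta> :: real assume \<eta>: "\<eta> > 0"
  obtain \<beta>' where \<beta>': "\<bar>\<beta>' - \<beta>\<bar> < sqrt (\<eta> / 4)" "has_quasimodes E \<beta>'" using near[of "sqrt (\<eta> / 4)"] \<eta> by auto
  then obtain u f where uf: "u \<in> test_functions \<Omega>" "f \<in> test_functions \<Omega>" "0 < (LINT x|M. (norm (grad u x))\<^sup>2)"
     "(LINT x|M. (norm (flux_defect E \<beta>' u f x))\<^sup>2) \<le> \<eta> / 4 * (LINT x|M. (norm (grad u x))\<^sup>2)"
    unfolding has_quasimodes_def using \<eta> by (meson divide_pos_pos zero_less_numeral)
  have "\<bar>\<beta>' - \<beta>\<bar>\<^sup>2 \<le> (sqrt (\<eta> / 4))\<^sup>2" using \<beta>'(1) by (intro power_mono) auto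
  then have sq: "(\<beta>' - \<beta>)\<^sup>2 \<le> \<eta> / 4" using \<eta> by simp
  have eq: "flux_defect E \<beta> u f = (\<lambda>x. 1 *\<^sub>R flux_defect E \<beta>' u f x + (\<beta>' - \<beta>) *\<^sub>R grad u x)"
    by (auto simp: flux_defect_def algebra_simps)
  have "(LINT x|M. (norm (flux_defect E \<beta> u f x))\<^sup>2)
      \<le> 2 * 1\<^sup>2 * (LINT x|M. (norm (flux_defect E \<beta>' u f x))\<^sup>2) + 2 * (\<beta>' - \<beta>)\<^sup>2 * (LINT x|M. (norm (grad u x))\<^sup>2)"
    unfolding eq by (rule L2_lincomb(2)[OF flux_defect_L2(1)[OF E uf(1,2)] test_function_weak_gradient(1)[OF uf(1)]])
  also have "\<dots> \<le> 2 * 1\<^sup>2 * (\<eta> / 4 * (LINT x|M. (norm (grad u x))\<^sup>2)) + 2 * (\<eta> / 4) * (LINT x|M. (norm (grad u x))\<^sup>2)"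
    using uf(3,4) sq by (intro add_mono mult_left_mono mult_right_mono) auto
  finally have "(LINT x|M. (norm (flux_defect E \<beta> u f x))\<^sup>2) \<le> \<eta> * (LINT x|M. (norm (grad u x))\<^sup>2)" by simp
  then show "\<exists>u\<in>test_functions \<Omega>. \<exists>f\<in>test_functions \<Omega>. 0 < (LINT x|M. (norm (grad u x))\<^sup>2) \<and>
     (LINT x|M. (norm (flux_defect E \<beta> u f x))\<^sup>2) \<le> \<eta> * (LINT x|M. (norm (grad u x))\<^sup>2)"
    using uf by blast
qed

text \<open>Duality: the coefficients \<open>a = \<one>\<^sub>E - \<beta>\<close> and \<open>a' = \<one>\<^sub>E - (1 - \<beta>)\<close> satisfy
  \<open>a a' = \<beta> (1 - \<beta>)\<close>. Hence \<open>a \<nabla>u \<approx> rot (\<nabla>f)\<close> implies \<open>a' \<nabla>f \<approx> rot (\<nabla>(- \<beta> (1 - \<beta>) u))\<close>.\<close>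

lemma has_quasimodes_dual:
  assumes E: "E \<in> sets lebesgue" and \<beta>: "0 < \<beta>" "\<beta> < 1" and q: "has_quasimodes E \<beta>"
  shows "has_quasimodes E (1 - \<beta>)"
  unfolding has_quasimodes_def
proof (intro allI impI)
  fix \<eta> :: real assume \<eta>: "\<eta> > 0"
  define m0 where "m0 = min \<beta> (1 - \<beta>)"
  have m0: "m0 > 0" using \<beta> by (simp add: m0_def)
  define \<eta>' where "\<eta>' = min (m0\<^sup>2 / 4) (\<eta> * m0\<^sup>2 / 4)"
  have \<eta>': "\<eta>' > 0" "\<eta>' \<le> m0\<^sup>2 / 4" "\<eta>' \<le> \<eta> * m0\<^sup>2 / 4" using m0 \<eta> by (auto simp: \<eta>'_def)
  obtain u f where uf: "u \<in> test_functions \<Omega>" "f \<in> test_functions \<Omega>" and X: "0 < (LINT x|M. (norm (grad u x))\<^sup>2)"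
     and F: "(LINT x|M. (norm (flux_defect E \<beta> u f x))\<^sup>2) \<le> \<eta>' * (LINT x|M. (norm (grad u x))\<^sup>2)"
    using q \<eta>'(1) unfolding has_quasimodes_def by blast
  define v where "v = (\<lambda>x. - (\<beta> * (1 - \<beta>)) * u x + 0 * u x)"
  have v: "v \<in> test_functions \<Omega>" unfolding v_def by (rule test_functions_lincomb[OF uf(1,1)])
  have gv: "grad v x = - (\<beta> * (1 - \<beta>)) *\<^sub>R grad u x" for x
    unfolding v_def grad_def
    by (simp only: partial_deriv_lincomb[OF test_functions_differentiable[OF uf(1)] test_functions_differentiable[OF uf(1)]])
      (simp add: vec_eq_iff)
  let ?F = "flux_defect E \<beta> u f" and ?F' = "flux_defect E (1 - \<beta>) f v"
  note FL = flux_defect_L2(1)[OF E uf, of \<beta>] and FL' = flux_defect_L2(1)[OF E uf(2) v, of "1 - \<beta>"]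
  note Gu = test_function_weak_gradient(1)[OF uf(1)] and Gf = test_function_weak_gradient(1)[OF uf(2)]
  have F'_eq: "?F' x = (indicator E x - (1 - \<beta>)) *\<^sub>R rot (?F x)" for x
    by (cases "x \<in> E") (auto simp: flux_defect_def gv vec_eq_iff forall_2 algebra_simps)
  have F'_le: "(LINT x|M. (norm (?F' x))\<^sup>2) \<le> (LINT x|M. (norm (?F x))\<^sup>2)"
  proof (intro integral_mono L2_D(2) FL FL')
    fix x
    have "\<bar>indicator E x - (1 - \<beta>)\<bar> \<le> 1" using \<beta> by (auto simp: indicator_def)
    then have "\<bar>indicator E x - (1 - \<beta>)\<bar> * norm (?F x) \<le> 1 * norm (?F x)" by (intro mult_right_mono) auto
    then show "(norm (?F' x))\<^sup>2 \<le> (norm (?F x))\<^sup>2" unfolding F'_eq by (intro power_mono) auto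
  qed
  have lower: "m0\<^sup>2 * (LINT x|M. (norm (grad u x))\<^sup>2)
      \<le> 2 * (LINT x|M. (norm (?F x))\<^sup>2) + 2 * (LINT x|M. (norm (grad f x))\<^sup>2)"
  proof -
    have "(LINT x|M. m0\<^sup>2 * (norm (grad u x))\<^sup>2) \<le> (LINT x|M. 2 * (norm (?F x))\<^sup>2 + 2 * (norm (grad f x))\<^sup>2)"
    proof (rule integral_mono)
      fix x
      have eq: "(indicator E x - \<beta>) *\<^sub>R grad u x = 1 *\<^sub>R ?F x + 1 *\<^sub>R rot (grad f x)" by (simp add: flux_defect_def)
      have "m0 \<le> \<bar>indicator E x - \<beta>\<bar>" using \<beta> by (auto simp: indicator_def m0_def)
      then have "m0 * norm (grad u x) \<le> norm ((indicator E x - \<beta>) *\<^sub>R grad u x)" by (simp add: mult_right_mono)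
      then have "(m0 * norm (grad u x))\<^sup>2 \<le> (norm (1 *\<^sub>R ?F x + 1 *\<^sub>R rot (grad f x)))\<^sup>2"
        unfolding eq using m0 by (intro power_mono) auto
      also have "\<dots> \<le> 2 * 1\<^sup>2 * (norm (?F x))\<^sup>2 + 2 * 1\<^sup>2 * (norm (rot (grad f x)))\<^sup>2" by (rule norm_lincomb_sq_le)
      finally show "m0\<^sup>2 * (norm (grad u x))\<^sup>2 \<le> 2 * (norm (?F x))\<^sup>2 + 2 * (norm (grad f x))\<^sup>2"
        by (simp add: power_mult_distrib)
    qed (use L2_D(2)[OF FL] L2_D(2)[OF Gu] L2_D(2)[OF Gf] in auto)
    then show ?thesis using L2_D(2)[OF FL] L2_D(2)[OF Gf] by simp
  qed
  show "\<exists>u\<in>test_functions \<Omega>. \<exists>f\<in>test_functions \<Omega>. 0 < (LINT x|M. (norm (grad u x))\<^sup>2) \<and>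
     (LINT x|M. (norm (flux_defect E (1 - \<beta>) u f x))\<^sup>2) \<le> \<eta> * (LINT x|M. (norm (grad u x))\<^sup>2)"
  proof (rule bexI[OF _ uf(2)], rule bexI[OF _ v], rule conjI)
    let ?X = "LINT x|M. (norm (grad u x))\<^sup>2" and ?Y = "LINT x|M. (norm (grad f x))\<^sup>2"
    have "\<eta>' * ?X \<le> m0\<^sup>2 / 4 * ?X" using X \<eta>' by (intro mult_right_mono) auto
    then have Y: "m0\<^sup>2 / 4 * ?X \<le> ?Y" using lower F by (simp add: field_simps)
    have "0 < m0\<^sup>2 / 4 * ?X" using m0 X by simp
    then show "0 < ?Y" using Y by linarith
    have "(LINT x|M. (norm (?F' x))\<^sup>2) \<le> (LINT x|M. (norm (?F x))\<^sup>2)" by (rule F'_le)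
    also have "\<dots> \<le> \<eta>' * ?X" by (rule F)
    also have "\<dots> \<le> \<eta> * m0\<^sup>2 / 4 * ?X" using X \<eta>' by (intro mult_right_mono) auto
    also have "\<dots> = \<eta> * (m0\<^sup>2 / 4 * ?X)" by simp
    also have "\<dots> \<le> \<eta> * ?Y" using Y \<eta> by (intro mult_left_mono) auto
    finally show "(LINT x|M. (norm (?F' x))\<^sup>2) \<le> \<eta> * ?Y" .
  qed
qed

lemma integral_indicator_domain:
  assumes "S \<in> sets borel"
  shows "integrable M (indicat_real S)" "(LINT x|M. indicat_real S x) = measure lebesgue (S \<inter> \<Omega>)"
proof -
  have S: "S \<in> sets lebesgue" using assms by auto
  have m: "S \<inter> \<Omega> \<in> sets M" using S by (auto simp: sets_restrict_space)
  have eq: "(LINT x|M. indicat_real S x) = (LINT x|M. indicat_real (S \<inter> \<Omega>) x)"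
    by (intro Bochner_Integration.integral_cong) (auto simp: space_restrict_space indicator_def)
  show "integrable M (indicat_real S)"
    using m by (subst Bochner_Integration.integrable_cong[OF refl, where g="indicator (S \<inter> \<Omega>)"])
      (auto simp: space_restrict_space indicator_def integrable_indicator_iff emeasure_finite less_top[symmetric])
  show "(LINT x|M. indicat_real S x) = measure lebesgue (S \<inter> \<Omega>)"
    unfolding eq using m S by (simp add: measure_restrict_space space_restrict_space Int_absorb2)
qed

lemma integral_indicator_cball_le:
  assumes "r \<ge> 0" shows "(LINT x|M. indicat_real (cball 0 r) x) \<le> pi * r\<^sup>2"
proof -
  have "(LINT x|M. indicat_real (cball 0 r) x) = measure lebesgue (cball 0 r \<inter> \<Omega>)"
    by (rule integral_indicator_domain(2)) auto
  also have "\<dots> \<le> measure lebesgue (cball 0 r :: (real^2) set)"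
    by (intro measure_mono_fmeasurable) (auto intro: lmeasurable_cball)
  also have "\<dots> = pi * r\<^sup>2" using content_cball[OF assms, of "0 :: real^2"] by (simp add: unit_ball_vol_2)
  finally show ?thesis .
qed

text \<open>The defect at the two cut-offs is bounded by \<open>C3\<close> independently of the inner radius
  \<open>exp t0\<close>, since the integral of \<open>r\<^sup>-\<^sup>2\<close> over an annulus depends on the ratio of its radii only. The
  energy is at least proportional to the number \<open>n\<close> of discs between the cut-offs. So \<open>n\<close> is chosen
  first, and then the layer so thin that its contribution is bounded too.\<close>

lemma corner_has_quasimodes:
  assumes "corner \<xi> \<alpha>" and E: "E \<in> sets lebesgue" and \<rho>: "0 < \<rho>" "cball 0 \<rho> \<subseteq> \<Omega>"
    and mem: "\<And>q. norm q < \<rho> \<Longrightarrow> q \<in> E \<longleftrightarrow> 0 < corner.wedge \<alpha> q"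
  shows "has_quasimodes E (corner.\<beta> \<xi> \<alpha>)"
  unfolding has_quasimodes_def
proof (intro allI impI)
  interpret corner \<xi> \<alpha> by fact
  fix \<eta> :: real assume \<eta>: "\<eta> > 0"
  define t1 where "t1 = min 0 (ln \<rho>)"
  have "exp t1 \<le> exp (ln \<rho>)" by (simp add: t1_def)
  then have t1: "t1 \<le> 0" "exp t1 \<le> \<rho>" using \<rho>(1) by (auto simp: t1_def)
  have sub: "cball 0 (exp t1) \<subseteq> \<Omega>" using t1 \<rho>(2) by (meson order_trans subset_cball)
  obtain C where C: "C \<ge> 0"
    "\<And>t0 t1 \<epsilon> E p. \<lbrakk>0 < \<epsilon>; \<epsilon> < s0\<^sup>2; p \<noteq> 0; norm p < exp t1 \<Longrightarrow> p \<in> E \<longleftrightarrow> 0 < wedge p\<rbrakk> \<Longrightarrow>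
      norm (flux_defect E \<beta> (u_mode t0 t1 \<epsilon>) (f_mode t0 t1 \<epsilon>) p)
      \<le> C * (indicator {p. exp t0 \<le> norm p \<and> norm p \<le> exp t1 \<and> 0 < wedge p \<and> wedge p < \<epsilon>} p
           + indicator {p. exp t0 \<le> norm p \<and> norm p \<le> exp (t0 + 1) \<or> exp (t1 - 1) \<le> norm p \<and> norm p \<le> exp t1} p) / norm p"
    using flux_defect_bound by blast
  define C3 where "C3 = 2 * C\<^sup>2 * (1 + 2 * (pi * (exp 1)\<^sup>2))"
  obtain m :: nat where m: "\<tau> j + 1 / (2 * \<xi>) \<le> t1 - 1" if "j \<ge> m" for j
  proof -
    obtain m :: nat where m: "\<xi> * (1 - t1 + 1 / (2 * \<xi>)) < real m" using reals_Archimedean2 by blast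
    have "\<tau> j + 1 / (2 * \<xi>) \<le> t1 - 1" if "j \<ge> m" for j
    proof -
      have "real m \<le> real j * 1" using that by simp
      also have "\<dots> \<le> real j * pi" using pi_ge_two by (intro mult_left_mono) auto
      also have "\<dots> \<le> real j * pi + pi / 2" using pi_gt_zero by simp
      finally have "\<xi> * (1 - t1 + 1 / (2 * \<xi>)) \<le> real j * pi + pi / 2" using m by linarith
      then have "1 - t1 + 1 / (2 * \<xi>) \<le> (real j * pi + pi / 2) / \<xi>" using \<xi> by (simp add: pos_le_divide_eq mult.commute)
      then show ?thesis unfolding \<tau>_def minus_divide_left[symmetric] by linarith
    qed
    then show ?thesis using that by blast
  qed
  define g where "g = \<xi>\<^sup>2 * \<kappa>\<^sup>2 * pi / 16"
  have g: "g > 0" using \<xi> \<kappa> by (simp add: g_def)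
  obtain n :: nat where n: "(C3 + 1) / (\<eta> * g) < real n" using reals_Archimedean2 by blast
  have C3: "C3 \<ge> 0" by (simp add: C3_def)
  have n1: "C3 \<le> \<eta> * (real n * g)" "0 < real n * g"
  proof -
    have eg: "\<eta> * g > 0" using \<eta> g by simp
    have "C3 + 1 < real n * (\<eta> * g)" using n eg by (simp add: pos_divide_less_eq)
    then show "C3 \<le> \<eta> * (real n * g)" by (simp add: mult_ac)
    have "0 < (C3 + 1) / (\<eta> * g)" using eg C3 by simp
    then show "0 < real n * g" using n g by (intro mult_pos_pos) linarith+
  qed
  define t0 where "t0 = \<tau> (m + n) - 1 / (2 * \<xi>) - 1"
  have \<tau>_mono: "\<tau> (m + n) \<le> \<tau> j" if "j < m + n" for j
  proof -
    have "real j * pi \<le> real (m + n) * pi" using that by (intro mult_right_mono) auto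
    then have "(real j * pi + pi / 2) / \<xi> \<le> (real (m + n) * pi + pi / 2) / \<xi>" using \<xi> by (intro divide_right_mono) auto
    then show ?thesis unfolding \<tau>_def minus_divide_left[symmetric] by linarith
  qed
  let ?S = "\<lambda>\<epsilon>. {p. exp t0 \<le> norm p \<and> norm p \<le> exp t1 \<and> 0 < wedge p \<and> wedge p < \<epsilon>}"
  have S_meas: "?S \<epsilon> \<in> sets borel" for \<epsilon>
  proof -
    have [measurable]: "wedge \<in> borel_measurable borel" by (rule measurable_wedge)
    show ?thesis by measurable
  qed
  \<comment> \<open>The layer shrinks to the empty set.\<close>
  have "(\<lambda>k. LINT x|M. indicat_real (?S (1 / real (Suc k))) x) \<longlonglongrightarrow> (LINT x|M. 0)"
  proof (rule integral_dominated_convergence[where w="\<lambda>x. 1"])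
    show "AE x in M. (\<lambda>k. indicat_real (?S (1 / real (Suc k))) x) \<longlonglongrightarrow> 0"
    proof (rule AE_I2)
      fix x
      show "(\<lambda>k. indicat_real (?S (1 / real (Suc k))) x) \<longlonglongrightarrow> 0"
      proof (cases "0 < wedge x")
        case True
        have "(\<lambda>k. 1 / real (Suc k)) \<longlonglongrightarrow> 0" using LIMSEQ_inverse_real_of_nat by (simp add: inverse_eq_divide)
        then have "eventually (\<lambda>k. 1 / real (Suc k) < wedge x) sequentially" using True by (rule order_tendstoD)
        then have "eventually (\<lambda>k. indicat_real (?S (1 / real (Suc k))) x = 0) sequentially"
          by eventually_elim (auto simp: indicator_def)
        then show ?thesis by (rule tendsto_eventually)
      qed simp
    qed
    show "indicat_real (?S (1 / real (Suc k))) \<in> borel_measurable M" for k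
      using integral_indicator_domain(1)[OF S_meas] by blast
  qed (auto simp: indicator_def)
  then have lim: "(\<lambda>k. LINT x|M. indicat_real (?S (1 / real (Suc k))) x) \<longlonglongrightarrow> 0" by simp
  have "eventually (\<lambda>k. (LINT x|M. indicat_real (?S (1 / real (Suc k))) x) < exp (2 * t0)) sequentially"
    by (rule order_tendstoD(2)[OF lim]) simp
  moreover have "(\<lambda>k. 1 / real (Suc k)) \<longlonglongrightarrow> 0" using LIMSEQ_inverse_real_of_nat by (simp add: inverse_eq_divide)
  then have "eventually (\<lambda>k. 1 / real (Suc k) < s0\<^sup>2 / 12) sequentially" using s0 by (intro order_tendstoD(2)) auto
  ultimately have "eventually (\<lambda>k. (LINT x|M. indicat_real (?S (1 / real (Suc k))) x) < exp (2 * t0) \<and> 1 / real (Suc k) < s0\<^sup>2 / 12) sequentially"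
    by (rule eventually_conj)
  then obtain k where k: "(LINT x|M. indicat_real (?S (1 / real (Suc k))) x) < exp (2 * t0)" "1 / real (Suc k) < s0\<^sup>2 / 12"
    using eventually_happens'[OF sequentially_bot] by blast
  define \<epsilon> where "\<epsilon> = 1 / real (Suc k)"
  have \<epsilon>: "0 < \<epsilon>" "\<epsilon> < s0\<^sup>2 / 12" "(LINT x|M. indicat_real (?S \<epsilon>) x) \<le> exp (2 * t0)"
    using k by (auto simp: \<epsilon>_def)
  then have \<epsilon>': "\<epsilon> < s0\<^sup>2" by simp
  note uf = mode_test_functions[OF t1(1) \<epsilon>(1) \<epsilon>' sub, of t0]
  let ?u = "u_mode t0 t1 \<epsilon>" and ?f = "f_mode t0 t1 \<epsilon>"
  let ?F = "flux_defect E \<beta> ?u ?f"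
  have upper: "(LINT x|M. (norm (?F x))\<^sup>2) \<le> C3"
  proof -
    let ?I = "\<lambda>S. LINT x|M. indicat_real S x"
    let ?b = "\<lambda>x. 2 * C\<^sup>2 * (exp (- 2 * t0) * indicat_real (?S \<epsilon>) x + exp (- 2 * t0) * indicat_real (cball 0 (exp (t0 + 1))) x
        + exp (- 2 * (t1 - 1)) * indicat_real (cball 0 (exp t1)) x)"
    note int = integral_indicator_domain(1)[OF S_meas, of \<epsilon>] integral_indicator_domain(1)[of "cball 0 (exp (t0 + 1))"]
      integral_indicator_domain(1)[of "cball 0 (exp t1)"]
    have "(LINT x|M. (norm (?F x))\<^sup>2) \<le> (LINT x|M. ?b x)"
    proof (rule integral_mono)
      show "integrable M (\<lambda>x. (norm (?F x))\<^sup>2)" using L2_D(2)[OF flux_defect_L2(1)[OF E uf]] .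
      show "integrable M ?b" using int by auto
      fix x :: "real^2"
      show "(norm (?F x))\<^sup>2 \<le> ?b x"
      proof (cases "x = 0")
        case True
        then have "?F x = 0" by (simp add: flux_defect_def grad_mode_0[OF t1(1)] rot_0)
        then show ?thesis by (auto intro!: add_nonneg_nonneg mult_nonneg_nonneg)
      next
        case False
        let ?T = "{p :: real^2. exp t0 \<le> norm p \<and> norm p \<le> exp (t0 + 1) \<or> exp (t1 - 1) \<le> norm p \<and> norm p \<le> exp t1}"
        have inv: "1 / (norm x)\<^sup>2 \<le> exp (- 2 * t)" if "exp t \<le> norm x" for t
        proof -
          have "(exp t)\<^sup>2 \<le> (norm x)\<^sup>2" using that by (intro power_mono) auto
          then have "1 / (norm x)\<^sup>2 \<le> 1 / (exp t)\<^sup>2" using False by (intro divide_left_mono) auto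
          also have "1 / (exp t)\<^sup>2 = exp (- 2 * t)" by (simp add: exp_minus exp_double inverse_eq_divide)
          finally show ?thesis .
        qed
        have "x \<in> E \<longleftrightarrow> 0 < wedge x" if "norm x < exp t1" using mem[of x] that t1(2) by simp
        from C(2)[OF \<epsilon>(1) \<epsilon>' False this]
        have "(norm (?F x))\<^sup>2 \<le> (C * (indicator (?S \<epsilon>) x + indicator ?T x) / norm x)\<^sup>2"
          by (intro power_mono) auto
        also have "\<dots> = C\<^sup>2 * (indicator (?S \<epsilon>) x + indicator ?T x)\<^sup>2 * (1 / (norm x)\<^sup>2)"
          by (simp add: power_mult_distrib power_divide)
        also have "\<dots> \<le> C\<^sup>2 * (2 * (indicator (?S \<epsilon>) x + indicator ?T x)) * (1 / (norm x)\<^sup>2)"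
          by (intro mult_right_mono mult_left_mono) (auto simp: indicator_def)
        also have "\<dots> = 2 * C\<^sup>2 * (indicator (?S \<epsilon>) x * (1 / (norm x)\<^sup>2) + indicator ?T x * (1 / (norm x)\<^sup>2))"
          by (simp add: algebra_simps add_divide_distrib)
        also have "\<dots> \<le> ?b x"
        proof (rule mult_left_mono)
          have 1: "indicator (?S \<epsilon>) x * (1 / (norm x)\<^sup>2) \<le> exp (- 2 * t0) * indicat_real (?S \<epsilon>) x"
            using inv[of t0] by (auto simp: indicator_def)
          have 2: "indicator ?T x * (1 / (norm x)\<^sup>2) \<le> exp (- 2 * t0) * indicat_real (cball 0 (exp (t0 + 1))) x
            + exp (- 2 * (t1 - 1)) * indicat_real (cball 0 (exp t1)) x"
          proof (cases "x \<in> ?T")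
            case True
            then consider "exp t0 \<le> norm x" "x \<in> cball 0 (exp (t0 + 1))" | "exp (t1 - 1) \<le> norm x" "x \<in> cball 0 (exp t1)" by auto
            then show ?thesis
            proof cases
              case 1
              have "1 / (norm x)\<^sup>2 \<le> exp (- 2 * t0) * 1 + 0" using inv[OF 1(1)] by simp
              also have "\<dots> \<le> exp (- 2 * t0) * indicat_real (cball 0 (exp (t0 + 1))) x + exp (- 2 * (t1 - 1)) * indicat_real (cball 0 (exp t1)) x"
                using 1(2) by (intro add_mono mult_left_mono mult_nonneg_nonneg) auto
              finally show ?thesis using True by simp
            next
              case 2
              have "1 / (norm x)\<^sup>2 \<le> 0 + exp (- 2 * (t1 - 1)) * 1" using inv[OF 2(1)] by simp
              also have "\<dots> \<le> exp (- 2 * t0) * indicat_real (cball 0 (exp (t0 + 1))) x + exp (- 2 * (t1 - 1)) * indicat_real (cball 0 (exp t1)) x"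
                using 2(2) by (intro add_mono mult_left_mono mult_nonneg_nonneg) auto
              finally show ?thesis using True by simp
            qed
          next
            case notT: False
            then show ?thesis by (simp add: add_nonneg_nonneg)
          qed
          show "indicator (?S \<epsilon>) x * (1 / (norm x)\<^sup>2) + indicator ?T x * (1 / (norm x)\<^sup>2)
            \<le> exp (- 2 * t0) * indicat_real (?S \<epsilon>) x + exp (- 2 * t0) * indicat_real (cball 0 (exp (t0 + 1))) x
              + exp (- 2 * (t1 - 1)) * indicat_real (cball 0 (exp t1)) x" using 1 2 by linarith
        qed simp
        finally show ?thesis .
      qed
    qed
    also have "\<dots> = 2 * C\<^sup>2 * (exp (- 2 * t0) * ?I (?S \<epsilon>) + exp (- 2 * t0) * ?I (cball 0 (exp (t0 + 1)))
        + exp (- 2 * (t1 - 1)) * ?I (cball 0 (exp t1)))"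
      using int by simp
    also have "\<dots> \<le> 2 * C\<^sup>2 * (exp (- 2 * t0) * exp (2 * t0) + exp (- 2 * t0) * (pi * (exp (t0 + 1))\<^sup>2)
        + exp (- 2 * (t1 - 1)) * (pi * (exp t1)\<^sup>2))"
      using \<epsilon>(3) by (intro mult_left_mono add_mono integral_indicator_cball_le) auto
    also have "\<dots> = C3"
    proof -
      have "exp (- 2 * t0) * exp (2 * t0) = 1" by (simp add: exp_add[symmetric])
      moreover have "exp (- 2 * t0) * (pi * (exp (t0 + 1))\<^sup>2) = pi * (exp 1)\<^sup>2"
        by (simp add: exp_double[symmetric] mult.left_commute[of _ pi] exp_add[symmetric])
      moreover have "exp (- 2 * (t1 - 1)) * (pi * (exp t1)\<^sup>2) = pi * (exp 1)\<^sup>2"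
        by (simp add: exp_double[symmetric] mult.left_commute[of _ pi] exp_add[symmetric])
      ultimately show ?thesis by (simp only: C3_def mult_2 add.assoc)
    qed
    finally show ?thesis .
  qed
  have lower: "real n * g \<le> (LINT x|M. (norm (grad ?u x))\<^sup>2)"
  proof -
    let ?J = "{m..<m + n}"
    have Dinner: "tip_disc j \<subseteq> \<Omega>" and Dgrad: "\<And>p. p \<in> tip_disc j \<Longrightarrow> \<xi>\<^sup>2 / (16 * (exp (\<tau> j))\<^sup>2) \<le> (norm (grad ?u p))\<^sup>2" if j: "j \<in> ?J" for j
    proof -
      have *: "exp (t0 + 1) \<le> norm p \<and> norm p \<le> exp (t1 - 1)" if p: "p \<in> tip_disc j" for p
      proof -
        have "\<bar>ln (norm p) - \<tau> j\<bar> \<le> 1 / (2 * \<xi>)" "p \<noteq> 0" using tip_disc_bounds[OF p] by auto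
        then have "t0 + 1 \<le> ln (norm p)" "ln (norm p) \<le> t1 - 1"
          using m[of j] \<tau>_mono[of j] j by (auto simp: t0_def abs_le_iff)
        then show ?thesis using ln_norm_iff[OF \<open>p \<noteq> 0\<close>] by blast
      qed
      show "tip_disc j \<subseteq> \<Omega>"
      proof
        fix p assume p: "p \<in> tip_disc j"
        have "exp (t1 - 1) \<le> exp t1" by simp
        then have "p \<in> cball 0 (exp t1)" using *[OF p] by (auto intro: order_trans)
        then show "p \<in> \<Omega>" using sub by blast
      qed
      fix p assume p: "p \<in> tip_disc j"
      have p0: "p \<noteq> 0" and w: "\<epsilon> < wedge p" and n2: "norm p \<le> 2 * exp (\<tau> j)" using tip_disc_bounds[OF p] \<epsilon> by auto
      have "1 / 4 \<le> (sin (\<xi> * ln (norm p)))\<^sup>2" using sin_sq_near_\<tau> tip_disc_bounds[OF p] by blast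
      then have s: "\<xi>\<^sup>2 * (1 / 4) \<le> (\<xi> * sin (\<xi> * ln (norm p)))\<^sup>2" unfolding power_mult_distrib by (intro mult_left_mono) auto
      have "(norm p)\<^sup>2 \<le> (2 * exp (\<tau> j))\<^sup>2" using n2 by (intro power_mono) auto
      then have n4: "(norm p)\<^sup>2 \<le> 4 * (exp (\<tau> j))\<^sup>2" by (simp add: power_mult_distrib)
      have "\<xi>\<^sup>2 / (16 * (exp (\<tau> j))\<^sup>2) = \<xi>\<^sup>2 * (1 / 4) / (4 * (exp (\<tau> j))\<^sup>2)" by simp
      also have "\<dots> \<le> (\<xi> * sin (\<xi> * ln (norm p)))\<^sup>2 / (norm p)\<^sup>2" using s n4 p0 by (intro frac_le) auto
      also have "\<dots> \<le> (norm (grad ?u p))\<^sup>2" using grad_u_mode_lower_bound[OF \<epsilon>(1) \<epsilon>' w p0] *[OF p] by blast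
      finally show "\<xi>\<^sup>2 / (16 * (exp (\<tau> j))\<^sup>2) \<le> (norm (grad ?u p))\<^sup>2" .
    qed
    have Dint: "integrable M (indicat_real (tip_disc j))" for j by (rule integral_indicator_domain(1)) (simp add: tip_disc_def)
    have IB: "(LINT x|M. indicat_real (tip_disc j) x) = (\<kappa> * exp (\<tau> j))\<^sup>2 * pi" if "j \<in> ?J" for j
    proof -
      have "(LINT x|M. indicat_real (tip_disc j) x) = measure lebesgue (tip_disc j)"
        using integral_indicator_domain(2)[of "tip_disc j"] Dinner[OF that] by (simp add: tip_disc_def Int_absorb2)
      also have "\<dots> = (\<kappa> * exp (\<tau> j))\<^sup>2 * pi"
        unfolding tip_disc_def using circle_area[of "\<kappa> * exp (\<tau> j)"] \<kappa>(1) by simp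
      finally show ?thesis .
    qed
    have "real n * g = (\<Sum>j\<in>?J. \<xi>\<^sup>2 / (16 * (exp (\<tau> j))\<^sup>2) * ((\<kappa> * exp (\<tau> j))\<^sup>2 * pi))"
      by (simp add: g_def power_mult_distrib)
    also have "\<dots> = (\<Sum>j\<in>?J. \<xi>\<^sup>2 / (16 * (exp (\<tau> j))\<^sup>2) * (LINT x|M. indicat_real (tip_disc j) x))"
      by (rule sum.cong) (simp_all only: IB)
    also have "\<dots> = (LINT x|M. (\<Sum>j\<in>?J. \<xi>\<^sup>2 / (16 * (exp (\<tau> j))\<^sup>2) * indicat_real (tip_disc j) x))"
      using Dint by simp
    also have "\<dots> \<le> (LINT x|M. (norm (grad ?u x))\<^sup>2)"
    proof (rule integral_mono)
      show "integrable M (\<lambda>x. \<Sum>j\<in>?J. \<xi>\<^sup>2 / (16 * (exp (\<tau> j))\<^sup>2) * indicat_real (tip_disc j) x)"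
        using Dint by simp
      show "integrable M (\<lambda>x. (norm (grad ?u x))\<^sup>2)" using L2_D(2)[OF test_function_weak_gradient(1)[OF uf(1)]] .
      fix x :: "real^2"
      show "(\<Sum>j\<in>?J. \<xi>\<^sup>2 / (16 * (exp (\<tau> j))\<^sup>2) * indicat_real (tip_disc j) x) \<le> (norm (grad ?u x))\<^sup>2"
      proof (cases "\<exists>i\<in>?J. x \<in> tip_disc i")
        case True
        then obtain i where i: "i \<in> ?J" "x \<in> tip_disc i" by blast
        have ind: "indicat_real (tip_disc j) x = (if j = i then 1 else 0)" for j
        proof (cases "x \<in> tip_disc j")
          case True
          then have "j = i" using tip_disc_disjoint[OF i(2) True] by simp
          then show ?thesis using True by simp
        next
          case False
          then have "j \<noteq> i" using i(2) by blast
          then show ?thesis using False by simp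
        qed
        have "(\<Sum>j\<in>?J. \<xi>\<^sup>2 / (16 * (exp (\<tau> j))\<^sup>2) * indicat_real (tip_disc j) x)
            = (\<Sum>j\<in>?J. if i = j then \<xi>\<^sup>2 / (16 * (exp (\<tau> j))\<^sup>2) else 0)"
          by (rule sum.cong) (auto simp only: ind split: if_splits)
        also have "\<dots> = \<xi>\<^sup>2 / (16 * (exp (\<tau> i))\<^sup>2)" using i(1) by (simp add: sum.delta')
        finally show ?thesis using Dgrad[OF i] by simp
      next
        case False
        then have "(\<Sum>j\<in>?J. \<xi>\<^sup>2 / (16 * (exp (\<tau> j))\<^sup>2) * indicat_real (tip_disc j) x) = 0" by (intro sum.neutral) auto
        then show ?thesis by simp
      qed
    qed
    finally show ?thesis .
  qed
  show "\<exists>u\<in>test_functions \<Omega>. \<exists>f\<in>test_functions \<Omega>. 0 < (LINT x|M. (norm (grad u x))\<^sup>2) \<and>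
     (LINT x|M. (norm (flux_defect E \<beta> u f x))\<^sup>2) \<le> \<eta> * (LINT x|M. (norm (grad u x))\<^sup>2)"
  proof (rule bexI[OF _ uf(1)], rule bexI[OF _ uf(2)], rule conjI)
    show "0 < (LINT x|M. (norm (grad ?u x))\<^sup>2)" using lower n1 by linarith
    have "\<eta> * (real n * g) \<le> \<eta> * (LINT x|M. (norm (grad ?u x))\<^sup>2)" using lower \<eta> by (intro mult_left_mono) auto
    then show "(LINT x|M. (norm (?F x))\<^sup>2) \<le> \<eta> * (LINT x|M. (norm (grad ?u x))\<^sup>2)" using upper n1 by linarith
  qed
qed

end

context bounded_domain
begin

lemma in_spectrum_if_has_quasimodes:
  assumes E: "E \<in> sets lebesgue" "E \<subseteq> \<Omega>" and q: "has_quasimodes E \<beta>"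
  shows "\<beta> \<in> spectrum \<Omega> (poincare_op \<Omega> E)"
proof (rule in_spectrum_if_not_bounded_below[OF E], rule notI)
  assume "\<exists>c>0. \<forall>v\<in>H10 \<Omega>. c * H10_inner \<Omega> v v
      \<le> H10_inner \<Omega> (lincomb 1 (poincare_op \<Omega> E v) (- \<beta>) v) (lincomb 1 (poincare_op \<Omega> E v) (- \<beta>) v)"
  then obtain c where c: "c > 0" "\<And>v. v \<in> H10 \<Omega> \<Longrightarrow> c * H10_inner \<Omega> v v
      \<le> H10_inner \<Omega> (lincomb 1 (poincare_op \<Omega> E v) (- \<beta>) v) (lincomb 1 (poincare_op \<Omega> E v) (- \<beta>) v)" by blast
  obtain u f where u: "u \<in> test_functions \<Omega>" "f \<in> test_functions \<Omega>" "0 < (LINT x|M. (norm (grad u x))\<^sup>2)"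
    "(LINT x|M. (norm (flux_defect E \<beta> u f x))\<^sup>2) \<le> c / 2 * (LINT x|M. (norm (grad u x))\<^sup>2)"
    using q c(1) unfolding has_quasimodes_def by (meson half_gt_zero)
  have le: "(LINT x|M. (norm (flux_defect E \<beta> u f x))\<^sup>2) \<le> (sqrt (c / 2))\<^sup>2 * (LINT x|M. (norm (grad u x))\<^sup>2)"
    using u(4) c(1) by simp
  have "c * H10_inner \<Omega> u u \<le> (sqrt (c / 2))\<^sup>2 * H10_inner \<Omega> u u"
    using c(2)[OF test_functions_subset_H10[OF u(1)]] quasimode_residual(1)[OF E u(1,2) le] by linarith
  moreover have "H10_inner \<Omega> u u > 0" using quasimode_residual(2)[OF E u(1,2) le] u(3) by simp
  ultimately show False using c(1) by simp
qed

text \<open>A quasi-mode of \<open>E\<close> is a quasi-mode of every set that differs from \<open>E\<close> by a set of small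
  measure, because the gradients of test functions are bounded.\<close>

lemma spectrum_stability:
  assumes E: "E \<in> sets lebesgue" and q: "has_quasimodes E \<beta>" and \<eta>: "\<eta> > 0"
  obtains \<theta> where "\<theta> > 0" "\<And>E'. E' \<in> sets lebesgue \<Longrightarrow> E' \<subseteq> \<Omega> \<Longrightarrow> measure lebesgue (((E - E') \<union> (E' - E)) \<inter> \<Omega>) < \<theta> \<Longrightarrow>
    \<exists>\<beta>'\<in>spectrum \<Omega> (poincare_op \<Omega> E'). \<bar>\<beta>' - \<beta>\<bar> \<le> \<eta>"
proof -
  have "\<eta>\<^sup>2 / 4 > 0" using \<eta> by simp
  then obtain u f where u: "u \<in> test_functions \<Omega>" "f \<in> test_functions \<Omega>" "0 < (LINT x|M. (norm (grad u x))\<^sup>2)"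
    "(LINT x|M. (norm (flux_defect E \<beta> u f x))\<^sup>2) \<le> \<eta>\<^sup>2 / 4 * (LINT x|M. (norm (grad u x))\<^sup>2)"
    using q unfolding has_quasimodes_def by blast
  let ?X = "LINT x|M. (norm (grad u x))\<^sup>2"
  obtain B where B: "B \<ge> 0" "\<And>x. (norm (grad u x))\<^sup>2 \<le> B"
  proof -
    obtain B1 where B1: "\<And>x. \<bar>partial_deriv 1 u x\<bar> \<le> B1" using bounded_test_function[OF test_functions_partial_deriv[OF u(1)]] by metis
    obtain B2 where B2: "\<And>x. \<bar>partial_deriv 2 u x\<bar> \<le> B2" using bounded_test_function[OF test_functions_partial_deriv[OF u(1)]] by metis
    have "(norm (grad u x))\<^sup>2 \<le> B1\<^sup>2 + B2\<^sup>2" for x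
      unfolding norm_sq_cart2 using power_mono[OF B1[of x], of 2] power_mono[OF B2[of x], of 2]
      by (simp add: grad_def)
    then show ?thesis by (intro that[of "B1\<^sup>2 + B2\<^sup>2"]) auto
  qed
  define \<theta> where "\<theta> = \<eta>\<^sup>2 / 4 * ?X / (B + 1)"
  have \<theta>: "\<theta> > 0" using \<eta> u(3) B(1) by (simp add: \<theta>_def)
  show ?thesis
  proof (rule that[OF \<theta>])
    fix E' assume E': "E' \<in> sets lebesgue" "E' \<subseteq> \<Omega>" and small: "measure lebesgue (((E - E') \<union> (E' - E)) \<inter> \<Omega>) < \<theta>"
    let ?d = "\<lambda>x. (indicat_real E' x - indicat_real E x) *\<^sub>R grad u x"
    let ?S = "(E - E') \<union> (E' - E)"
    have S: "?S \<in> sets lebesgue" using E E'(1) by auto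
    have "(\<lambda>x. indicator E' x *\<^sub>R grad u x - indicator E x *\<^sub>R grad u x) \<in> L2 \<Omega>"
      by (intro L2_diff(1) flux_defect_L2(3)[OF E'(1) u(1,2)] flux_defect_L2(3)[OF E u(1,2)])
    then have d: "?d \<in> L2 \<Omega>" by (simp add: scaleR_diff_left)
    have SM: "?S \<inter> \<Omega> \<in> sets M" using S by (auto simp: sets_restrict_space)
    have "(LINT x|M. (norm (?d x))\<^sup>2) \<le> (LINT x|M. B * indicat_real (?S \<inter> \<Omega>) x)"
    proof (rule integral_mono)
      show "integrable M (\<lambda>x. (norm (?d x))\<^sup>2)" using L2_D(2)[OF d] .
      show "integrable M (\<lambda>x. B * indicat_real (?S \<inter> \<Omega>) x)"
        using SM by (auto simp: integrable_indicator_iff emeasure_finite less_top[symmetric])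
      show "(norm (?d x))\<^sup>2 \<le> B * indicat_real (?S \<inter> \<Omega>) x" if "x \<in> space M" for x
        using B that by (auto simp: indicator_def space_restrict_space)
    qed
    also have "\<dots> = B * measure lebesgue (?S \<inter> \<Omega>)"
      using SM S by (simp add: measure_restrict_space space_restrict_space Int_absorb2)
    also have "\<dots> \<le> (B + 1) * \<theta>" using B(1) small by (intro mult_mono) auto
    also have "\<dots> = \<eta>\<^sup>2 / 4 * ?X"
    proof -
      have nz: "B + 1 \<noteq> 0" using B(1) by simp
      show ?thesis unfolding \<theta>_def by (subst times_divide_eq_right) (rule nonzero_mult_div_cancel_left[OF nz])
    qed
    finally have d_le: "(LINT x|M. (norm (?d x))\<^sup>2) \<le> \<eta>\<^sup>2 / 4 * ?X" .
    have eq: "flux_defect E' \<beta> u f = (\<lambda>x. 1 *\<^sub>R flux_defect E \<beta> u f x + 1 *\<^sub>R ?d x)"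
      by (auto simp: flux_defect_def algebra_simps)
    have "(LINT x|M. (norm (flux_defect E' \<beta> u f x))\<^sup>2)
       \<le> 2 * 1\<^sup>2 * (LINT x|M. (norm (flux_defect E \<beta> u f x))\<^sup>2) + 2 * 1\<^sup>2 * (LINT x|M. (norm (?d x))\<^sup>2)"
      unfolding eq by (rule L2_lincomb(2)[OF flux_defect_L2(1)[OF E u(1,2)] d])
    then have "(LINT x|M. (norm (flux_defect E' \<beta> u f x))\<^sup>2) \<le> \<eta>\<^sup>2 * ?X" using u(4) d_le by simp
    then show "\<exists>\<beta>'\<in>spectrum \<Omega> (poincare_op \<Omega> E'). \<bar>\<beta>' - \<beta>\<bar> \<le> \<eta>"
      using spectrum_near_quasimode[OF E' u(1,2,3)] \<eta> by simp
  qed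
qed

end

section \<open>Bowties\<close>

text \<open>A compact subset of almost full measure stays inside of the open set under short
  translations.\<close>

lemma measure_translation_difference:
  fixes D :: "'a::euclidean_space set"
  assumes D: "open D" "bounded D" and e: "e > 0"
  obtains d where "d > 0" "\<And>h. norm h < d \<Longrightarrow> measure lebesgue ((D - (+) h ` D) \<union> ((+) h ` D - D)) < e"
proof -
  have Dm: "D \<in> lmeasurable" using D lmeasurable_open by blast
  obtain K where K: "closed K" "K \<subseteq> D" "D - K \<in> lmeasurable" "emeasure lebesgue (D - K) < ennreal (e / 2)"
    using sets_lebesgue_inner_closed[of D "e / 2"] Dm e by (metis fmeasurableD half_gt_zero)
  have cK: "compact K" using K D by (meson bounded_subset compact_eq_bounded_closed)
  then have Km: "K \<in> lmeasurable" by (rule lmeasurable_compact)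
  have mDK: "measure lebesgue (D - K) < e / 2"
    using K(3,4) e by (simp add: emeasure_eq_measure2 fmeasurableD2 ennreal_less_iff)
  obtain d where d: "d > 0" "(\<Union>x\<in>K. ball x d) \<subseteq> D"
    using compact_subset_open_imp_ball_epsilon_subset[OF cK D(1) K(2)] by blast
  show ?thesis
  proof (rule that[OF d(1)])
    fix h :: 'a assume h: "norm h < d"
    let ?D' = "(+) h ` D"
    have D'm: "?D' \<in> lmeasurable" using Dm by (rule measurable_translation)
    have "K \<subseteq> ?D'"
    proof
      fix x assume "x \<in> K"
      moreover have "x - h \<in> ball x d" using h by (simp add: dist_norm)
      ultimately have "x - h \<in> D" using d(2) by blast
      then show "x \<in> ?D'" by (metis add.commute diff_add_cancel imageI)
    qed
    have "measure lebesgue (?D' - K) = measure lebesgue (D - K)"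
      using measurable_measure_Diff[OF D'm _ \<open>K \<subseteq> ?D'\<close>] measurable_measure_Diff[OF Dm _ K(2)] Km
      by (simp add: measure_translation fmeasurableD)
    then have m: "measure lebesgue (?D' - K) < e / 2" using mDK by simp
    have "measure lebesgue ((D - ?D') \<union> (?D' - D)) \<le> measure lebesgue ((D - K) \<union> (?D' - K))"
      using \<open>K \<subseteq> ?D'\<close> K(2) Dm D'm Km by (intro measure_mono_fmeasurable) (auto intro!: fmeasurable.Un fmeasurable.Diff fmeasurableD)
    also have "\<dots> \<le> measure lebesgue (D - K) + measure lebesgue (?D' - K)"
      using Dm D'm Km by (intro measure_Un_le) (auto simp: fmeasurableD)
    finally show "measure lebesgue ((D - ?D') \<union> (?D' - D)) < e" using m mDK by linarith
  qed
qed

lemma polar_right_half_plane: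
  fixes q :: "real^2"
  assumes "q $ 1 > 0"
  shows "q = vector [norm q * cos (arctan (q $ 2 / q $ 1)), norm q * sin (arctan (q $ 2 / q $ 1))]"
proof -
  let ?z = "q $ 2 / q $ 1"
  have "1 + ?z\<^sup>2 = (norm q)\<^sup>2 / (q $ 1)\<^sup>2" unfolding norm_sq_cart2 using assms by (simp add: field_simps)
  then have s: "sqrt (1 + ?z\<^sup>2) = norm q / q $ 1" using assms by (simp add: real_sqrt_divide)
  have "norm q > 0" using assms by auto
  then show ?thesis using assms by (simp add: vec_eq_iff forall_2 cos_arctan sin_arctan s)
qed

context corner
begin

lemma wedge_pos_iff: "0 < wedge q \<longleftrightarrow> (c0 * q $ 2)\<^sup>2 < (s0 * q $ 1)\<^sup>2"
proof (cases "q = 0")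
  case True
  then show ?thesis by (simp add: wedge_def)
next
  case False
  then have "(norm q)\<^sup>2 > 0" by simp
  then show ?thesis by (simp add: wedge_def zero_less_divide_iff)
qed

lemma wedge_polar:
  assumes "q = vector [r * cos \<theta>, r * sin \<theta>]" "r > 0" "- \<alpha> / 2 < \<theta>" "\<theta> < \<alpha> / 2"
  shows "0 < wedge q"
proof -
  have "0 < r\<^sup>2 * (sin (\<alpha> / 2 - \<theta>) * sin (\<alpha> / 2 + \<theta>))"
    using assms \<alpha> by (intro mult_pos_pos sin_gt_zero) auto
  also have "\<dots> = (s0 * q $ 1)\<^sup>2 - (c0 * q $ 2)\<^sup>2"
  proof -
    have e: "sin (\<alpha> / 2 - \<theta>) * sin (\<alpha> / 2 + \<theta>) = s0\<^sup>2 * (cos \<theta>)\<^sup>2 - c0\<^sup>2 * (sin \<theta>)\<^sup>2"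
      by (simp add: sin_diff sin_add algebra_simps power2_eq_square)
    show ?thesis unfolding e by (simp add: assms(1) power_mult_distrib algebra_simps)
  qed
  finally show ?thesis by (simp add: wedge_pos_iff)
qed

lemma wedge_uminus: "wedge (- q) = wedge q" by (simp add: wedge_def)

lemma sector_right_if_wedge_pos:
  assumes "0 < wedge q" "q $ 1 > 0"
  shows "\<exists>\<theta>. - \<alpha> / 2 < \<theta> \<and> \<theta> < \<alpha> / 2 \<and> q = vector [norm q * cos \<theta>, norm q * sin \<theta>]"
proof -
  let ?z = "q $ 2 / q $ 1"
  have "(c0 * \<bar>q $ 2\<bar>)\<^sup>2 < (s0 * q $ 1)\<^sup>2" using assms(1) by (simp add: wedge_pos_iff power_mult_distrib)
  then have "c0 * \<bar>q $ 2\<bar> < s0 * q $ 1"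
    by (rule power_less_imp_less_base) (use s0 assms(2) in simp)
  then have "\<bar>?z\<bar> < tan (\<alpha> / 2)" using c0 assms(2) by (simp add: tan_def field_simps)
  then have "- tan (\<alpha> / 2) < ?z" "?z < tan (\<alpha> / 2)" by linarith+
  then have "arctan (- tan (\<alpha> / 2)) < arctan ?z" "arctan ?z < arctan (tan (\<alpha> / 2))"
    using arctan_less_iff by blast+
  moreover have "arctan (tan (\<alpha> / 2)) = \<alpha> / 2" using \<alpha> by (intro arctan_tan) auto
  ultimately show ?thesis using polar_right_half_plane[OF assms(2)] by (auto simp: arctan_minus)
qed

lemma sectors_iff_wedge_pos:
  assumes "norm q < r0"
  shows "q \<in> sector r0 (- \<alpha> / 2) (\<alpha> / 2) \<union> sector r0 (pi - \<alpha> / 2) (pi + \<alpha> / 2) \<longleftrightarrow> 0 < wedge q"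
proof
  assume "q \<in> sector r0 (- \<alpha> / 2) (\<alpha> / 2) \<union> sector r0 (pi - \<alpha> / 2) (pi + \<alpha> / 2)"
  then consider r \<theta> where "q = vector [r * cos \<theta>, r * sin \<theta>]" "0 < r" "- \<alpha> / 2 < \<theta>" "\<theta> < \<alpha> / 2"
    | r \<theta> where "q = vector [r * cos \<theta>, r * sin \<theta>]" "0 < r" "pi - \<alpha> / 2 < \<theta>" "\<theta> < pi + \<alpha> / 2"
    unfolding sector_def by blast
  then show "0 < wedge q"
  proof cases
    case 1
    then show ?thesis by (rule wedge_polar)
  next
    case 2
    have "- q = vector [r * cos (\<theta> - pi), r * sin (\<theta> - pi)]"
      using 2(1) by (simp add: vec_eq_iff forall_2 cos_diff sin_diff)
    from wedge_polar[OF this 2(2)] have "0 < wedge (- q)" using 2(3,4) by simp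
    then show ?thesis by (simp add: wedge_uminus)
  qed
next
  assume w: "0 < wedge q"
  then have q: "q \<noteq> 0" by (auto simp: wedge_def)
  have "q $ 1 \<noteq> 0" using wedge_axes(1)[OF q] w by auto
  then consider "q $ 1 > 0" | "(- q) $ 1 > 0" by fastforce
  then show "q \<in> sector r0 (- \<alpha> / 2) (\<alpha> / 2) \<union> sector r0 (pi - \<alpha> / 2) (pi + \<alpha> / 2)"
  proof cases
    case 1
    from sector_right_if_wedge_pos[OF w 1]
    obtain \<theta> where \<theta>: "- \<alpha> / 2 < \<theta>" "\<theta> < \<alpha> / 2" "q = vector [norm q * cos \<theta>, norm q * sin \<theta>]" by blast
    have "q \<in> sector r0 (- \<alpha> / 2) (\<alpha> / 2)"
      unfolding sector_def
      by (rule CollectI, rule exI[of _ "norm q"], rule exI[of _ \<theta>]) (use zero_less_norm_iff[of q] q assms \<theta> in blast)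
    then show ?thesis by blast
  next
    case 2
    from sector_right_if_wedge_pos[OF _ 2] w
    obtain \<theta> where \<theta>: "- \<alpha> / 2 < \<theta>" "\<theta> < \<alpha> / 2" "- q = vector [norm q * cos \<theta>, norm q * sin \<theta>]"
      by (auto simp: wedge_uminus)
    have eq: "q = vector [norm q * cos (pi + \<theta>), norm q * sin (pi + \<theta>)]"
      using \<theta>(3) by (simp add: vec_eq_iff forall_2 cos_add sin_add)
    have "q \<in> sector r0 (pi - \<alpha> / 2) (pi + \<alpha> / 2)"
      unfolding sector_def
      by (rule CollectI, rule exI[of _ "norm q"], rule exI[of _ "pi + \<theta>"], intro conjI) (use eq q assms \<theta>(1,2) in \<open>fact | simp\<close>)+
    then show ?thesis by blast
  qed
qed

end

text \<open>With \<open>\<tau> = tanh (\<xi> \<alpha> / 2) tanh (\<xi> (\<pi> - \<alpha>) / 2)\<close> the dispersion relation reads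
  \<open>\<beta> = \<tau> / (1 + \<tau>)\<close>, and \<open>\<tau>\<close> increases from \<open>0\<close> to \<open>1\<close> with the frequency. The intermediate
  value theorem provides the frequency.\<close>

lemma corner_\<beta>_surj:
  assumes \<alpha>: "0 < \<alpha>" "\<alpha> < pi" and b: "0 < b" "b < 1 / 2"
  obtains \<xi> where "corner \<xi> \<alpha>" "corner.\<beta> \<xi> \<alpha> = b"
proof -
  define p where "p = \<alpha> / 2"
  define q where "q = pi / 2 - \<alpha> / 2"
  have pq: "0 < p" "0 < q" using \<alpha> by (auto simp: p_def q_def)
  define N where "N x = sinh (x * p) * sinh (x * q) / (sinh (x * p) * sinh (x * q) + cosh (x * p) * cosh (x * q))" for x :: real
  have den: "sinh (x * p) * sinh (x * q) + cosh (x * p) * cosh (x * q) > 0" if "x \<ge> 0" for x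
    using that pq by (intro add_nonneg_pos mult_nonneg_nonneg mult_pos_pos) auto
  have "((\<lambda>x. tanh (x * p) * tanh (x * q)) \<longlongrightarrow> 1 * 1) at_top"
  proof (intro tendsto_mult)
    show "((\<lambda>x. tanh (x * p)) \<longlongrightarrow> 1) at_top" "((\<lambda>x. tanh (x * q)) \<longlongrightarrow> 1) at_top"
      using pq by (auto intro!: filterlim_compose[OF tanh_real_at_top] filterlim_tendsto_pos_mult_at_top filterlim_ident
          simp: mult.commute[of _ p] mult.commute[of _ q])
  qed
  moreover have "b / (1 - b) < 1 * 1" using b by simp
  ultimately have "eventually (\<lambda>x. b / (1 - b) < tanh (x * p) * tanh (x * q)) at_top"
    by (rule order_tendstoD(1))
  then obtain X0 where X0: "\<And>x. x \<ge> X0 \<Longrightarrow> b / (1 - b) < tanh (x * p) * tanh (x * q)"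
    by (auto simp: eventually_at_top_linorder)
  define X where "X = max 0 X0"
  have X: "0 \<le> X" "b / (1 - b) < tanh (X * p) * tanh (X * q)" using X0 by (auto simp: X_def)
  have "b \<le> N X"
  proof -
    let ?s = "sinh (X * p) * sinh (X * q)" and ?c = "cosh (X * p) * cosh (X * q)"
    have c: "?c > 0" by simp
    have "b / (1 - b) < ?s / ?c" using X(2) by (simp add: tanh_def)
    then have "b * ?c < ?s * (1 - b)" using c b by (simp add: divide_less_eq less_divide_eq mult.commute)
    then have "b * (?s + ?c) \<le> ?s" by (simp add: algebra_simps)
    then show ?thesis unfolding N_def using den[OF X(1)] by (simp add: pos_le_divide_eq)
  qed
  moreover have "N 0 \<le> b" using b by (simp add: N_def)
  moreover have "continuous_on {0..X} N"
    unfolding N_def using den by (intro continuous_intros) force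
  ultimately obtain \<xi> where root: "0 \<le> \<xi>" "\<xi> \<le> X" "N \<xi> = b" using IVT'[of N 0 b X] X(1) by auto
  have "\<xi> \<noteq> 0" using root(3) b by (auto simp: N_def)
  then interpret corner \<xi> \<alpha> using root(1) \<alpha> by unfold_locales auto
  have "\<beta> = b" using root(3) by (simp add: \<beta>_def N_def p_def q_def)
  then show ?thesis using that corner_axioms by blast
qed

text \<open>Near the tip the bowtie coincides with the double sector; the values \<open>0\<close>, \<open>1/2\<close> and \<open>1\<close>,
  which no frequency attains, are reached by closedness.\<close>

lemma bowtie_has_quasimodes:
  assumes "bounded_domain \<Omega>" and bow: "bowtie \<Omega> D1 D2" and \<Omega>0: "0 \<in> \<Omega>" and \<beta>: "\<beta> \<in> {0..1}"
  shows "bounded_domain.has_quasimodes \<Omega> (D1 \<union> D2) \<beta>"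
proof -
  interpret bounded_domain \<Omega> by fact
  obtain r0 \<alpha> where r0: "0 < r0" and \<alpha>: "0 < \<alpha>" "\<alpha> < pi"
    and D: "D1 \<inter> ball 0 r0 = sector r0 (- \<alpha> / 2) (\<alpha> / 2)" "D2 \<inter> ball 0 r0 = sector r0 (pi - \<alpha> / 2) (pi + \<alpha> / 2)"
    using bow unfolding bowtie_def by blast
  have E: "D1 \<union> D2 \<in> sets lebesgue" using bow by (auto simp: bowtie_def intro: borel_open)
  obtain r1 where r1: "r1 > 0" "cball 0 r1 \<subseteq> \<Omega>" using open_domain \<Omega>0 open_contains_cball by blast
  define \<rho> where "\<rho> = min r0 r1"
  have \<rho>: "\<rho> > 0" "cball 0 \<rho> \<subseteq> \<Omega>" using r0 r1 by (auto simp: \<rho>_def)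
  have half: "has_quasimodes (D1 \<union> D2) b" if b: "0 < b" "b < 1 / 2" for b
  proof -
    obtain \<xi> where \<xi>: "corner \<xi> \<alpha>" "corner.\<beta> \<xi> \<alpha> = b" using corner_\<beta>_surj[OF \<alpha> b] .
    have "q \<in> D1 \<union> D2 \<longleftrightarrow> 0 < corner.wedge \<alpha> q" if "norm q < \<rho>" for q
    proof -
      have n: "norm q < r0" using that by (simp add: \<rho>_def)
      then have "q \<in> D1 \<union> D2 \<longleftrightarrow> q \<in> (D1 \<inter> ball 0 r0) \<union> (D2 \<inter> ball 0 r0)" by auto
      then show ?thesis using corner.sectors_iff_wedge_pos[OF \<xi>(1) n] unfolding D by blast
    qed
    from corner_has_quasimodes[OF \<xi>(1) E \<rho> this] show ?thesis unfolding \<xi>(2) .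
  qed
  have other: "has_quasimodes (D1 \<union> D2) b" if b: "1 / 2 < b" "b < 1" for b
    using has_quasimodes_dual[OF E _ _ half[of "1 - b"]] b by simp
  show ?thesis
  proof (rule has_quasimodes_closed[OF E])
    fix e :: real assume e: "e > 0"
    \<comment> \<open>A point of the open intervals \<open>(0, 1/2)\<close> and \<open>(1/2, 1)\<close> close to \<open>\<beta>\<close>.\<close>
    define d where "d = min (e / 2) (1 / 8)"
    have d: "0 < d" "d < e" "d \<le> 1 / 8" using e by (auto simp: d_def)
    define b where "b = (if \<beta> < 1 / 4 then \<beta> + d else if \<beta> \<le> 1 / 2 then \<beta> - d else if \<beta> < 3 / 4 then \<beta> + d else \<beta> - d)"
    have "\<bar>b - \<beta>\<bar> < e" using d by (auto simp: b_def)
    moreover have "(0 < b \<and> b < 1 / 2) \<or> (1 / 2 < b \<and> b < 1)" using d \<beta> by (auto simp: b_def)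
    ultimately show "\<exists>\<beta>'. \<bar>\<beta>' - \<beta>\<bar> < e \<and> has_quasimodes (D1 \<union> D2) \<beta>'" using half other by blast
  qed
qed

lemma norm_vector_2: "norm (vector [a, 0] :: real^2) = \<bar>a\<bar>"
  by (simp add: norm_vec_def L2_set_def sum_2)

lemma near_bowtie_measure_tendsto:
  assumes D: "open D1" "bounded D1" "open D2" "bounded D2" and \<Omega>: "\<Omega> \<in> sets lebesgue" and e: "e > 0"
  obtains d where "d > 0" "\<And>\<delta>. 0 < \<delta> \<Longrightarrow> \<delta> < d \<Longrightarrow> measure lebesgue
    (((D1 \<union> D2 - near_bowtie D1 D2 \<delta>) \<union> (near_bowtie D1 D2 \<delta> - (D1 \<union> D2))) \<inter> \<Omega>) < e"
proof -
  obtain d1 where d1: "d1 > 0" "\<And>h. norm h < d1 \<Longrightarrow> measure lebesgue ((D1 - (+) h ` D1) \<union> ((+) h ` D1 - D1)) < e / 2"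
    using measure_translation_difference[OF D(1,2), of "e / 2"] e by auto
  obtain d2 where d2: "d2 > 0" "\<And>h. norm h < d2 \<Longrightarrow> measure lebesgue ((D2 - (+) h ` D2) \<union> ((+) h ` D2 - D2)) < e / 2"
    using measure_translation_difference[OF D(3,4), of "e / 2"] e by auto
  show ?thesis
  proof (rule that[of "min d1 d2"])
    fix \<delta> :: real assume \<delta>: "0 < \<delta>" "\<delta> < min d1 d2"
    let ?R = "right_wing D1 \<delta>" and ?L = "left_wing D2 \<delta>"
    have lm: "D1 \<in> lmeasurable" "D2 \<in> lmeasurable" "?R \<in> lmeasurable" "?L \<in> lmeasurable"
      using D by (auto simp: right_wing_def left_wing_def intro!: lmeasurable_open measurable_translation)
    have "measure lebesgue (((D1 \<union> D2 - near_bowtie D1 D2 \<delta>) \<union> (near_bowtie D1 D2 \<delta> - (D1 \<union> D2))) \<inter> \<Omega>)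
       \<le> measure lebesgue (((D1 - ?R) \<union> (?R - D1)) \<union> ((D2 - ?L) \<union> (?L - D2)))"
    proof (rule measure_mono_fmeasurable)
      show "((D1 \<union> D2 - near_bowtie D1 D2 \<delta>) \<union> (near_bowtie D1 D2 \<delta> - (D1 \<union> D2))) \<inter> \<Omega> \<in> sets lebesgue"
        unfolding near_bowtie_def by (intro sets.Int sets.Un sets.Diff fmeasurableD lm \<Omega>)
      show "((D1 - ?R) \<union> (?R - D1)) \<union> ((D2 - ?L) \<union> (?L - D2)) \<in> lmeasurable"
        by (intro fmeasurable.Un fmeasurable.Diff lm)
    qed (auto simp: near_bowtie_def)
    also have "\<dots> \<le> measure lebesgue ((D1 - ?R) \<union> (?R - D1)) + measure lebesgue ((D2 - ?L) \<union> (?L - D2))"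
      using lm by (intro measure_Un_le) (auto intro!: sets.Un sets.Diff simp: fmeasurableD)
    also have "\<dots> < e / 2 + e / 2"
      using \<delta> unfolding right_wing_def left_wing_def by (intro add_strict_mono d1 d2) (auto simp: norm_vector_2)
    finally show "measure lebesgue (((D1 \<union> D2 - near_bowtie D1 D2 \<delta>) \<union> (near_bowtie D1 D2 \<delta> - (D1 \<union> D2))) \<inter> \<Omega>) < e"
      by simp
  qed (use d1 d2 in auto)
qed

theorem corollary1:
  fixes \<Omega> D1 D2 :: "(real^2) set" and \<delta>0 :: real
  assumes "open \<Omega>" and "bounded \<Omega>" and "smooth_boundary \<Omega>" and "0 \<in> \<Omega>"
    and "bowtie \<Omega> D1 D2"
    and "0 < \<delta>0"
    and "\<And>\<delta>. 0 < \<delta> \<Longrightarrow> \<delta> < \<delta>0 \<Longrightarrow> closure (near_bowtie D1 D2 \<delta>) \<subseteq> \<Omega>"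
    and "\<And>\<delta>. 0 < \<delta> \<Longrightarrow> \<delta> < \<delta>0 \<Longrightarrow>
           closure (right_wing D1 \<delta>) \<inter> closure (left_wing D2 \<delta>) = {}"
  shows "limit_spectrum \<delta>0 (\<lambda>\<delta>. spectrum \<Omega> (poincare_op \<Omega> (near_bowtie D1 D2 \<delta>)))
           = spectrum \<Omega> (poincare_op \<Omega> (D1 \<union> D2))
       \<and> spectrum \<Omega> (poincare_op \<Omega> (D1 \<union> D2)) = {0..1}"
proof -
  interpret bounded_domain \<Omega> using assms(1,2) by unfold_locales
  have D: "open D1" "open D2" "D1 \<union> D2 \<subseteq> \<Omega>"
    using assms(5) closure_subset[of "D1 \<union> D2"] by (auto simp: bowtie_def)
  then have bd: "bounded D1" "bounded D2" using bounded_domain by (auto intro: bounded_subset)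
  have E: "D1 \<union> D2 \<in> sets lebesgue" using D by (auto intro: borel_open)
  have E': "near_bowtie D1 D2 \<delta> \<in> sets lebesgue" "near_bowtie D1 D2 \<delta> \<subseteq> \<Omega>" if "0 < \<delta>" "\<delta> < \<delta>0" for \<delta>
  proof -
    have "open (near_bowtie D1 D2 \<delta>)"
      using D by (auto simp: near_bowtie_def right_wing_def left_wing_def intro!: open_Un open_translation)
    then show "near_bowtie D1 D2 \<delta> \<in> sets lebesgue" by (auto intro: borel_open)
    show "near_bowtie D1 D2 \<delta> \<subseteq> \<Omega>" using assms(7)[OF that] closure_subset by blast
  qed
  have modes: "has_quasimodes (D1 \<union> D2) \<beta>" if "\<beta> \<in> {0..1}" for \<beta>
    by (rule bowtie_has_quasimodes[OF bounded_domain_axioms assms(5,4) that])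
  have spec: "spectrum \<Omega> (poincare_op \<Omega> (D1 \<union> D2)) = {0..1}"
    using spectrum_poincare_op_subset[OF E D(3)] in_spectrum_if_has_quasimodes[OF E D(3) modes] by blast
  have "limit_spectrum \<delta>0 (\<lambda>\<delta>. spectrum \<Omega> (poincare_op \<Omega> (near_bowtie D1 D2 \<delta>))) = {0..1}"
  proof
    show "limit_spectrum \<delta>0 (\<lambda>\<delta>. spectrum \<Omega> (poincare_op \<Omega> (near_bowtie D1 D2 \<delta>))) \<subseteq> {0..1}"
    proof
      fix \<beta> assume "\<beta> \<in> limit_spectrum \<delta>0 (\<lambda>\<delta>. spectrum \<Omega> (poincare_op \<Omega> (near_bowtie D1 D2 \<delta>)))"
      then obtain \<delta> b where d: "\<And>n. 0 < \<delta> n \<and> \<delta> n < \<delta>0"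
        "\<And>n. b n \<in> spectrum \<Omega> (poincare_op \<Omega> (near_bowtie D1 D2 (\<delta> n)))" "b \<longlonglongrightarrow> \<beta>"
        unfolding limit_spectrum_def by blast
      have "b n \<in> {0..1}" for n using spectrum_poincare_op_subset[OF E'] d by blast
      then show "\<beta> \<in> {0..1}" using closed_sequentially[OF closed_atLeastAtMost, of b 0 1] d(3) by blast
    qed
    show "{0..1} \<subseteq> limit_spectrum \<delta>0 (\<lambda>\<delta>. spectrum \<Omega> (poincare_op \<Omega> (near_bowtie D1 D2 \<delta>)))"
    proof
      fix \<beta> :: real assume \<beta>: "\<beta> \<in> {0..1}"
      have "\<exists>d>0. \<forall>\<delta>. 0 < \<delta> \<and> \<delta> < d \<and> \<delta> < \<delta>0 \<longrightarrow>
          (\<exists>\<beta>'\<in>spectrum \<Omega> (poincare_op \<Omega> (near_bowtie D1 D2 \<delta>)). \<bar>\<beta>' - \<beta>\<bar> \<le> 1 / real (Suc n))" for n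
      proof -
        obtain \<theta> where \<theta>: "\<theta> > 0" "\<And>E'. E' \<in> sets lebesgue \<Longrightarrow> E' \<subseteq> \<Omega> \<Longrightarrow>
            measure lebesgue (((D1 \<union> D2 - E') \<union> (E' - (D1 \<union> D2))) \<inter> \<Omega>) < \<theta> \<Longrightarrow>
            \<exists>\<beta>'\<in>spectrum \<Omega> (poincare_op \<Omega> E'). \<bar>\<beta>' - \<beta>\<bar> \<le> 1 / real (Suc n)"
          using spectrum_stability[OF E modes[OF \<beta>], of "1 / real (Suc n)"] by (metis of_nat_0_less_iff zero_less_Suc zero_less_divide_1_iff)
        obtain d where "d > 0" "\<And>\<delta>. 0 < \<delta> \<Longrightarrow> \<delta> < d \<Longrightarrow> measure lebesgue
            (((D1 \<union> D2 - near_bowtie D1 D2 \<delta>) \<union> (near_bowtie D1 D2 \<delta> - (D1 \<union> D2))) \<inter> \<Omega>) < \<theta>"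
          using near_bowtie_measure_tendsto[OF D(1) bd(1) D(2) bd(2) domain_measurable \<theta>(1)] by blast
        then show ?thesis using \<theta>(2)[OF E'] by blast
      qed
      then obtain d where d: "\<And>n. d n > 0" "\<And>n \<delta>. 0 < \<delta> \<Longrightarrow> \<delta> < d n \<Longrightarrow> \<delta> < \<delta>0 \<Longrightarrow>
          \<exists>\<beta>'\<in>spectrum \<Omega> (poincare_op \<Omega> (near_bowtie D1 D2 \<delta>)). \<bar>\<beta>' - \<beta>\<bar> \<le> 1 / real (Suc n)"
        by metis
      define m where "m n = Min (insert \<delta>0 (d ` {..n}))" for n
      have m: "0 < m n" "m n \<le> \<delta>0" "m n \<le> d n" "m (Suc n) \<le> m n" for n
      proof -
        show "0 < m n" unfolding m_def using assms(6) d(1) by (subst Min_gr_iff) auto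
        show "m n \<le> \<delta>0" "m n \<le> d n" unfolding m_def by (rule Min_le; simp)+
        show "m (Suc n) \<le> m n" unfolding m_def by (intro Min_antimono) auto
      qed
      \<comment> \<open>Dividing by \<open>n + 2\<close> makes the bound strict and the sequence converge to zero.\<close>
      define \<delta> where "\<delta> n = m n / real (n + 2)" for n
      have less: "\<delta> n < m n" for n
        using mult_strict_left_mono[of 1 "real (n + 2)" "m n"] m(1)[of n] by (simp add: \<delta>_def pos_divide_less_eq)
      have pos: "0 < \<delta> n" "\<delta> n < \<delta>0" "\<delta> n < d n" for n
        using m(1,2,3)[of n] less[of n] by (auto simp: \<delta>_def)
      have "\<forall>n. \<exists>b. b \<in> spectrum \<Omega> (poincare_op \<Omega> (near_bowtie D1 D2 (\<delta> n))) \<and> \<bar>b - \<beta>\<bar> \<le> 1 / real (Suc n)"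
        using d(2)[OF pos(1) pos(3) pos(2)] by blast
      from choice[OF this] obtain b where b: "\<And>n. b n \<in> spectrum \<Omega> (poincare_op \<Omega> (near_bowtie D1 D2 (\<delta> n)))"
          "\<And>n. \<bar>b n - \<beta>\<bar> \<le> 1 / real (Suc n)" by blast
      have "decseq \<delta>"
        unfolding \<delta>_def by (intro decseq_SucI frac_le m(4) less_imp_le[OF m(1)]) auto
      moreover have "\<delta> \<longlonglongrightarrow> 0"
      proof (rule tendsto_sandwich[OF _ _ tendsto_const])
        have "(\<lambda>n. \<delta>0 * (1 / real (n + 2))) \<longlonglongrightarrow> \<delta>0 * 0"
          by (intro tendsto_mult tendsto_const LIMSEQ_ignore_initial_segment lim_1_over_n)
        then show "(\<lambda>n. \<delta>0 * (1 / real (n + 2))) \<longlonglongrightarrow> 0" by simp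
        have "\<delta> n \<le> \<delta>0 * (1 / real (n + 2))" for n
          unfolding \<delta>_def using divide_right_mono[OF m(2)[of n], of "real (n + 2)"] by simp
        then show "eventually (\<lambda>n. \<delta> n \<le> \<delta>0 * (1 / real (n + 2))) sequentially" by simp
        show "eventually (\<lambda>n. 0 \<le> \<delta> n) sequentially" using less_imp_le[OF pos(1)] by simp
      qed
      moreover have "b \<longlonglongrightarrow> \<beta>"
      proof (rule LIM_zero_cancel, rule tendsto_rabs_zero_cancel, rule tendsto_sandwich[OF _ _ tendsto_const])
        show "(\<lambda>n. 1 / real (Suc n)) \<longlonglongrightarrow> 0"
          using LIMSEQ_inverse_real_of_nat by (simp add: inverse_eq_divide)
      qed (use b(2) in \<open>auto intro!: always_eventually\<close>)
      ultimately show "\<beta> \<in> limit_spectrum \<delta>0 (\<lambda>\<delta>. spectrum \<Omega> (poincare_op \<Omega> (near_bowtie D1 D2 \<delta>)))"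
        unfolding limit_spectrum_def using pos b(1) by blast
    qed
  qed
  then show ?thesis using spec by simp
qed

end
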